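(* Let $\mathcal F$ be an Ore forest-skein category with $F$- and $T$-forest-skein groups $G\subset G^T$, and let $\alpha:G^T\curvearrowright X$ be the action defined in the context. For $k\ge1$ let $X_k$ be the set of subsets of $X$ of cardinality $k$ and $\alpha_k:G^T\curvearrowright X_k$ the action deduced from $\alpha$. Then: (1) for each $A\in X_k$ there exist a tree $t$ with $n$ leaves (for some $n$) and distinct natural numbers $1\le j_1,\dots,j_k\le n$ such that $A=\{[t,j_i]:\ 1\le i\le k\}$; (2) the action $\alpha_k$ is transitive for all $k\ge1$; (3) if $A\in X_k$, then the fixed-point subgroup $\mathrm{Fix}(A)=\{g\in G^T:\ \alpha_g(x)=x\text{ for all }x\in A\}$ is isomorphic to $G^k$, and the stabiliser subgroup $\mathrm{Stab}(A)=\{g\in G^T:\ \alpha_g(A)=A\}$ is isomorphic to $G^k\rtimes\mathbf Z/k\mathbf Z$, where $\mathbf Z/k\mathbf Z$ acts by shifting indices modulo $k$.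
   Context: Trees are finite ordered rooted binary trees; a forest is a finite list of trees, with roots and leaves ordered from left to right. A coloured forest over a nonempty set $S$ has each interior (non-leaf) vertex labelled by an element of $S$. If $f$ has as many leaves as $g$ has roots, $f\circ g=fg$ is the stacking of $g$ on top of $f$; $f\otimes g$ is horizontal concatenation. Given a set $R$ of pairs of coloured trees with the same number of leaves, $\mathrm{ForC}\langle S\mid R\rangle$ is the quotient of the set of coloured forests over $S$ by the smallest equivalence relation containing $R$ and closed under composition and tensor product with forests, a small monoidal category. A forest-skein category is a category of this form. It is an Ore category if it is left-cancellative and for all $f,g$ with the same number of roots there are $p,q$ with $fp=gq$. The category $\mathcal F^T$ has elements $f\circ\sigma$, $f\in\mathcal F$ with $n$ leaves and $\sigma$ in the cyclic group $\mathbf Z/n\mathbf Z\subset\Sigma_n$ generated by $j\mapsto j+1$ mod $n$, composed using $\sigma\circ f=f^\sigma\circ\sigma^f$, where for $f=(f_1,\dots,f_r)$, $f^\sigma$ is the forest whose tree at position $\sigma(j)$ is $f_j$, and $\sigma^f$ sends the leaves of $f_j$ in order to the leaves of the $\sigma(j)$th tree of $f^\sigma$. $G^T=\mathrm{Frac}(\mathcal F^T,1)$ is the group of fractions $s\circ\pi\circ t^{-1}$ with $s,t$ trees with the same number $n$ of leaves and $\pi\in\mathbf Z/n\mathbf Z$, where fractions $xy^{-1}$ and $(xh)(yh)^{-1}$ are identified and $(xy^{-1})(x'y'^{-1})=(xp)(y'p')^{-1}$ whenever $yp=x'p'$. $G=\mathrm{Frac}(\mathcal F,1)$ is the subgroup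 of elements admitting a representative with $\pi=\mathrm{id}$. The set $X$: for a forest $f=(f_1,\dots,f_r)$ and $1\le j\le r$ let $j^f=1+$ (the number of leaves of $(f_1,\dots,f_{j-1})$). $X$ is the set of classes $[t,j]$ of pairs $(t,j)$ with $t$ a tree of $\mathcal F$ with $n$ leaves and $1\le j\le n$, for the equivalence relation generated by $(t,j)\sim(tf,j^f)$. The action $\alpha$ is determined by $\alpha_{s\circ\pi\circ t^{-1}}([t,j])=[s,\pi(j)]$. *)

theory Defs
  imports
    "HOL-Library.Tree"
    "HOL-Algebra.Group_Action"
    "HOL-Algebra.Product_Groups"
    "HOL-Algebra.Elementary_Groups"
begin

section \<open>Small categories and groups of fractions\<close>

text \<open>
  Composition is written in the order of stacking: \<open>Comp C f g\<close> is meaningful if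
  \<open>Tgt C f = Src C g\<close>.
\<close>

record ('o, 'm) cat =
  Arr :: "'m set"
  Src :: "'m \<Rightarrow> 'o"
  Tgt :: "'m \<Rightarrow> 'o"
  Comp :: "'m \<Rightarrow> 'm \<Rightarrow> 'm"
  Idt :: "'o \<Rightarrow> 'm"

definition left_cancellative :: "('o, 'm) cat \<Rightarrow> bool" where
  "left_cancellative C \<longleftrightarrow>
     (\<forall>f\<in>Arr C. \<forall>g\<in>Arr C. \<forall>h\<in>Arr C.
        Tgt C f = Src C g \<longrightarrow> Tgt C f = Src C h \<longrightarrow> Comp C f g = Comp C f h \<longrightarrow> g = h)"

definition ore_category :: "('o, 'm) cat \<Rightarrow> bool" where
  "ore_category C \<longleftrightarrow>
     left_cancellative C \<and>
     (\<forall>f\<in>Arr C. \<forall>g\<in>Arr C. Src C f = Src C g \<longrightarrow>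
        (\<exists>p\<in>Arr C. \<exists>q\<in>Arr C.
           Src C p = Tgt C f \<and> Src C q = Tgt C g \<and> Comp C f p = Comp C g q))"

definition frac_pairs :: "('o, 'm) cat \<Rightarrow> 'o \<Rightarrow> ('m \<times> 'm) set" where
  "frac_pairs C c =
     {(x, y). x \<in> Arr C \<and> y \<in> Arr C \<and> Src C x = c \<and> Src C y = c \<and> Tgt C x = Tgt C y}"

definition frac_step :: "('o, 'm) cat \<Rightarrow> 'o \<Rightarrow> 'm \<times> 'm \<Rightarrow> 'm \<times> 'm \<Rightarrow> bool" where
  "frac_step C c u v \<longleftrightarrow>
     u \<in> frac_pairs C c \<and>
     (\<exists>h\<in>Arr C. Src C h = Tgt C (fst u) \<and> v = (Comp C (fst u) h, Comp C (snd u) h))"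

text \<open>The fraction \<open>x y\<^sup>-\<^sup>1\<close>.\<close>

definition fraction :: "('o, 'm) cat \<Rightarrow> 'o \<Rightarrow> 'm \<Rightarrow> 'm \<Rightarrow> ('m \<times> 'm) set" where
  "fraction C c x y = {v. equivclp (frac_step C c) (x, y) v}"

definition Frac :: "('o, 'm) cat \<Rightarrow> 'o \<Rightarrow> ('m \<times> 'm) set monoid" where
  "Frac C c =
     \<lparr>carrier = {fraction C c x y |x y. (x, y) \<in> frac_pairs C c},
      mult = (\<lambda>g h. THE w. \<exists>x y x' y' p p'.
                (x, y) \<in> frac_pairs C c \<and> (x', y') \<in> frac_pairs C c \<and>
                g = fraction C c x y \<and> h = fraction C c x' y' \<and>
                p \<in> Arr C \<and> p' \<in> Arr C \<and> Src C p = Tgt C y \<and> Src C p' = Tgt C x' \<and>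
                Comp C y p = Comp C x' p' \<and>
                w = fraction C c (Comp C x p) (Comp C y' p')),
      one = fraction C c (Idt C c) (Idt C c)\<rparr>"

section \<open>Coloured forests and forest-skein categories\<close>

text \<open>
  The type \<open>'s\<close> is the nonempty set of colours; \<open>size1\<close> counts the leaves of a tree.
\<close>

type_synonym 's forest = "'s tree list"

definition leaves :: "'s forest \<Rightarrow> nat" where
  "leaves f = sum_list (map size1 f)"

fun graft :: "'s tree \<Rightarrow> 's forest \<Rightarrow> 's tree" where
  "graft Leaf g = hd g"
| "graft (Node l a r) g = Node (graft l (take (size1 l) g)) a (graft r (drop (size1 l) g))"

text \<open>\<open>stack f g\<close> is \<open>f \<circ> g\<close>, meaningful if \<open>leaves f = length g\<close>;
  the tensor product of forests is \<open>@\<close>.\<close>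

fun stack :: "'s forest \<Rightarrow> 's forest \<Rightarrow> 's forest" where
  "stack [] g = []"
| "stack (t # f) g = graft t (take (size1 t) g) # stack f (drop (size1 t) g)"

definition skein_relations :: "('s tree \<times> 's tree) set \<Rightarrow> bool" where
  "skein_relations R \<longleftrightarrow> (\<forall>(u, v)\<in>R. size1 u = size1 v)"

inductive skein_equiv :: "('s tree \<times> 's tree) set \<Rightarrow> 's forest \<Rightarrow> 's forest \<Rightarrow> bool"
  for R where
  base: "(u, v) \<in> R \<Longrightarrow> skein_equiv R [u] [v]"
| refl: "skein_equiv R f f"
| sym: "skein_equiv R f g \<Longrightarrow> skein_equiv R g f"
| trans: "skein_equiv R f g \<Longrightarrow> skein_equiv R g h \<Longrightarrow> skein_equiv R f h"
| comp_left: "skein_equiv R f g \<Longrightarrow> leaves h = length f \<Longrightarrow> leaves h = length g \<Longrightarrow>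
    skein_equiv R (stack h f) (stack h g)"
| comp_right: "skein_equiv R f g \<Longrightarrow> leaves f = length h \<Longrightarrow> leaves g = length h \<Longrightarrow>
    skein_equiv R (stack f h) (stack g h)"
| tensor_left: "skein_equiv R f g \<Longrightarrow> skein_equiv R (h @ f) (h @ g)"
| tensor_right: "skein_equiv R f g \<Longrightarrow> skein_equiv R (f @ h) (g @ h)"

definition skein_class :: "('s tree \<times> 's tree) set \<Rightarrow> 's forest \<Rightarrow> 's forest set" where
  "skein_class R f = {g. skein_equiv R f g}"

text \<open>
  Operations on classes of forests are computed on representatives. If \<open>skein_relations R\<close>
  holds, equivalent forests have the same number of roots and of leaves and are equivalent
  tree by tree, so nothing below depends on the chosen representative.
\<close>

definition forest_rep :: "'s forest set \<Rightarrow> 's forest" where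
  "forest_rep U = (SOME f. f \<in> U)"

definition ForC :: "('s tree \<times> 's tree) set \<Rightarrow> (nat, 's forest set) cat" where
  "ForC R =
     \<lparr>Arr = range (skein_class R),
      Src = (\<lambda>U. length (forest_rep U)),
      Tgt = (\<lambda>U. leaves (forest_rep U)),
      Comp = (\<lambda>U V. skein_class R (stack (forest_rep U) (forest_rep V))),
      Idt = (\<lambda>n. skein_class R (replicate n Leaf))\<rparr>"

section \<open>The category with cyclic permutations\<close>

text \<open>
  Roots and leaves are numbered from 1. Elements of \<open>\<int>/n\<int>\<close> are permutations of
  \<open>{1..n}\<close>, extended by the identity.
\<close>

definition cyc :: "nat \<Rightarrow> nat \<Rightarrow> nat" where
  "cyc n j = (if j \<in> {1..n} then j mod n + 1 else j)"

definition rotations :: "nat \<Rightarrow> (nat \<Rightarrow> nat) set" where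
  "rotations n = {cyc n ^^ i |i. True}"

text \<open>\<open>first_leaf f j\<close> is the index \<open>j\<^sup>f\<close> of the first leaf of the \<open>j\<close>th tree of \<open>f\<close>.\<close>

definition first_leaf :: "'s forest \<Rightarrow> nat \<Rightarrow> nat" where
  "first_leaf f j = 1 + leaves (take (j - 1) f)"

text \<open>\<open>perm_forest \<sigma> f\<close> is \<open>f\<^sup>\<sigma>\<close>, with \<open>f\<^sub>j\<close> at position \<open>\<sigma> j\<close>;
  \<open>perm_leaves \<sigma> f\<close> is \<open>\<sigma>\<^sup>f\<close>.\<close>

definition perm_forest :: "(nat \<Rightarrow> nat) \<Rightarrow> 's forest \<Rightarrow> 's forest" where
  "perm_forest \<sigma> f = map (\<lambda>i. f ! (inv_into {1..length f} \<sigma> i - 1)) [1..<Suc (length f)]"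

definition tree_of_leaf :: "'s forest \<Rightarrow> nat \<Rightarrow> nat" where
  "tree_of_leaf f l =
     (THE j. j \<in> {1..length f} \<and>
             l \<in> {first_leaf f j..<first_leaf f j + size1 (f ! (j - 1))})"

definition perm_leaves :: "(nat \<Rightarrow> nat) \<Rightarrow> 's forest \<Rightarrow> nat \<Rightarrow> nat" where
  "perm_leaves \<sigma> f l =
     (if l \<in> {1..leaves f}
      then let j = tree_of_leaf f l
           in first_leaf (perm_forest \<sigma> f) (\<sigma> j) + (l - first_leaf f j)
      else l)"

text \<open>
  The pair \<open>(U, \<sigma>)\<close> is \<open>U \<circ> \<sigma>\<close>, and
  \<open>(U \<circ> \<sigma>) \<circ> (V \<circ> \<tau>) = (U \<circ> V\<^sup>\<sigma>) \<circ> (\<sigma>\<^sup>V \<circ> \<tau>)\<close>.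
\<close>

definition ForCT ::
  "('s tree \<times> 's tree) set \<Rightarrow> (nat, 's forest set \<times> (nat \<Rightarrow> nat)) cat" where
  "ForCT R =
     \<lparr>Arr = {(U, \<sigma>). U \<in> Arr (ForC R) \<and> \<sigma> \<in> rotations (Tgt (ForC R) U)},
      Src = (\<lambda>(U, \<sigma>). Src (ForC R) U),
      Tgt = (\<lambda>(U, \<sigma>). Tgt (ForC R) U),
      Comp = (\<lambda>(U, \<sigma>) (V, \<tau>).
                (Comp (ForC R) U (skein_class R (perm_forest \<sigma> (forest_rep V))),
                 perm_leaves \<sigma> (forest_rep V) \<circ> \<tau>)),
      Idt = (\<lambda>n. (Idt (ForC R) n, id))\<rparr>"

type_synonym 's fracT = "(('s forest set \<times> (nat \<Rightarrow> nat)) \<times> ('s forest set \<times> (nat \<Rightarrow> nat))) set"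

text \<open>\<open>s \<circ> \<pi> \<circ> t\<^sup>-\<^sup>1\<close>\<close>

definition fracT ::
  "('s tree \<times> 's tree) set \<Rightarrow> 's forest set \<Rightarrow> (nat \<Rightarrow> nat) \<Rightarrow> 's forest set \<Rightarrow> 's fracT" where
  "fracT R s \<pi> t = fraction (ForCT R) 1 (s, \<pi>) (t, id)"

definition T_group :: "('s tree \<times> 's tree) set \<Rightarrow> 's fracT monoid" where
  "T_group R = Frac (ForCT R) 1"

text \<open>The trees of the category having \<open>n\<close> leaves.\<close>

definition skein_trees :: "('s tree \<times> 's tree) set \<Rightarrow> nat \<Rightarrow> 's forest set set" where
  "skein_trees R n = {t \<in> Arr (ForC R). Src (ForC R) t = 1 \<and> Tgt (ForC R) t = n}"

definition F_group :: "('s tree \<times> 's tree) set \<Rightarrow> 's fracT monoid" where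
  "F_group R =
     (T_group R)\<lparr>carrier := {fracT R s id t |s t n. s \<in> skein_trees R n \<and> t \<in> skein_trees R n}\<rparr>"

section \<open>The action\<close>

definition X_pairs :: "('s tree \<times> 's tree) set \<Rightarrow> ('s forest set \<times> nat) set" where
  "X_pairs R = {(t, j). \<exists>n. t \<in> skein_trees R n \<and> j \<in> {1..n}}"

definition X_step ::
  "('s tree \<times> 's tree) set \<Rightarrow> 's forest set \<times> nat \<Rightarrow> 's forest set \<times> nat \<Rightarrow> bool" where
  "X_step R u v \<longleftrightarrow>
     u \<in> X_pairs R \<and>
     (\<exists>f\<in>Arr (ForC R). Src (ForC R) f = Tgt (ForC R) (fst u) \<and>
        v = (Comp (ForC R) (fst u) f, first_leaf (forest_rep f) (snd u)))"

definition X_class ::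
  "('s tree \<times> 's tree) set \<Rightarrow> 's forest set \<Rightarrow> nat \<Rightarrow> ('s forest set \<times> nat) set" where
  "X_class R t j = {v. equivclp (X_step R) (t, j) v}"

definition X_set :: "('s tree \<times> 's tree) set \<Rightarrow> ('s forest set \<times> nat) set set" where
  "X_set R = {X_class R t j |t j. (t, j) \<in> X_pairs R}"

definition alpha ::
  "('s tree \<times> 's tree) set \<Rightarrow> 's fracT \<Rightarrow> ('s forest set \<times> nat) set \<Rightarrow> ('s forest set \<times> nat) set"
  where
  "alpha R g =
     (\<lambda>x\<in>X_set R. THE y. \<exists>n s \<pi> t j.
        s \<in> skein_trees R n \<and> t \<in> skein_trees R n \<and> \<pi> \<in> rotations n \<and> j \<in> {1..n} \<and>
        g = fracT R s \<pi> t \<and> x = X_class R t j \<and> y = X_class R s (\<pi> j))"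

definition X_sub :: "('s tree \<times> 's tree) set \<Rightarrow> nat \<Rightarrow> ('s forest set \<times> nat) set set set" where
  "X_sub R k = {A. A \<subseteq> X_set R \<and> finite A \<and> card A = k}"

definition alpha_sub ::
  "('s tree \<times> 's tree) set \<Rightarrow> nat \<Rightarrow> 's fracT \<Rightarrow>
   ('s forest set \<times> nat) set set \<Rightarrow> ('s forest set \<times> nat) set set" where
  "alpha_sub R k g = (\<lambda>A\<in>X_sub R k. alpha R g ` A)"

definition Fix :: "('s tree \<times> 's tree) set \<Rightarrow> ('s forest set \<times> nat) set set \<Rightarrow> 's fracT set" where
  "Fix R A = {g \<in> carrier (T_group R). \<forall>x\<in>A. alpha R g x = x}"

definition Stab :: "('s tree \<times> 's tree) set \<Rightarrow> ('s forest set \<times> nat) set set \<Rightarrow> 's fracT set" where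
  "Stab R A = {g \<in> carrier (T_group R). alpha R g ` A = A}"

section \<open>Powers and semidirect products\<close>

definition semidirect ::
  "('a, 'c) monoid_scheme \<Rightarrow> ('b, 'd) monoid_scheme \<Rightarrow> ('b \<Rightarrow> 'a \<Rightarrow> 'a) \<Rightarrow> ('a \<times> 'b) monoid" where
  "semidirect N H \<theta> =
     \<lparr>carrier = carrier N \<times> carrier H,
      mult = (\<lambda>(a, h) (b, h'). (a \<otimes>\<^bsub>N\<^esub> \<theta> h b, h \<otimes>\<^bsub>H\<^esub> h')),
      one = (\<one>\<^bsub>N\<^esub>, \<one>\<^bsub>H\<^esub>)\<rparr>"

text \<open>The factors of \<open>G\<^sup>k\<close> are indexed by the residues \<open>0, \<dots>, k - 1\<close>.\<close>

definition group_power :: "('a, 'c) monoid_scheme \<Rightarrow> nat \<Rightarrow> (int \<Rightarrow> 'a) monoid" where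
  "group_power G k = product_group {0..<int k} (\<lambda>_. G)"

definition shift :: "nat \<Rightarrow> int \<Rightarrow> (int \<Rightarrow> 'a) \<Rightarrow> int \<Rightarrow> 'a" where
  "shift k m a = (\<lambda>i\<in>{0..<int k}. a ((i - m) mod int k))"

end

theory Submission
  imports Defs
begin

text \<open>
  The set \<open>X\<close> is the direct limit of the leaf sets \<open>{1..n}\<close> of trees along the maps
  \<open>j \<mapsto> j\<^sup>f\<close> belonging to the expansions \<open>t \<mapsto> t \<circ> f\<close>. By the Ore property, finitely many
  points of \<open>X\<close> and finitely many fractions can be expanded until they live over one common tree, where
  \<open>s \<circ> \<pi> \<circ> t\<^sup>-\<^sup>1\<close> simply sends the leaf \<open>j\<close> of \<open>t\<close> to the leaf \<open>\<pi> j\<close> of \<open>s\<close>. Distinct leaves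
  of a tree are distinct points, because \<open>j \<mapsto> j\<^sup>f\<close> is strictly increasing and left cancellation makes
  \<open>f\<close> a function of \<open>t \<circ> f\<close> (lemma \<open>pt_inj\<close>). This gives the first claim.

  Fix a tree \<open>b\<close> with \<open>k\<close> leaves and let \<open>A\<^sub>0\<close> be the set of its leaves. Let \<open>A\<close> consist of the leaves
  \<open>J\<close> of a tree \<open>t\<close>. A rotation of the leaves of \<open>t\<close> moves an element of \<open>J\<close> to the first leaf, and a set of
  leaf numbers containing 1 is the set of first leaves of a forest \<open>h\<close> with \<open>k\<close> roots
  (lemma \<open>forest_with_first_leaves\<close>). Then a fraction with numerator \<open>t\<close> and denominator \<open>b \<circ> h\<close> carries
  \<open>A\<^sub>0\<close> to \<open>A\<close>. Hence the action is transitive, and conjugation reduces the third claim to \<open>A\<^sub>0\<close>.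

  An element of the stabiliser of \<open>A\<^sub>0\<close> can be written \<open>(b \<circ> f) \<circ> \<pi> \<circ> (b \<circ> h)\<^sup>-\<^sup>1\<close>. If it fixes the first leaf
  of \<open>b\<close>, then \<open>\<pi> 1 = 1\<close>, so the rotation \<open>\<pi>\<close> is the identity; since \<open>A\<^sub>0\<close> is preserved, the first leaves of
  \<open>f\<close> and of \<open>h\<close> are the same, so \<open>f\<^sub>i\<close> and \<open>h\<^sub>i\<close> have equally many leaves for each \<open>i\<close>
  (lemma \<open>\<Psi>_surj\<close>). The element is thus glued from the \<open>k\<close> fractions \<open>f\<^sub>i \<circ> h\<^sub>i\<^sup>-\<^sup>1\<close> of the \<open>F\<close>-group.
  Two glued elements agree exactly if their \<open>k\<close> components agree, because equality in the category is tested
  tree by tree (lemmas \<open>glue_eqI\<close> and \<open>glue_eqD\<close>). So gluing is an isomorphism \<open>\<Psi>\<close> from \<open>G\<^sup>k\<close> onto the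
  fixed-point subgroup of \<open>A\<^sub>0\<close>. The elements \<open>b \<circ> \<rho> \<circ> b\<^sup>-\<^sup>1\<close>, with \<open>\<rho>\<close> a rotation, form a copy of
  \<open>\<int>/k\<int>\<close> that permutes \<open>A\<^sub>0\<close> simply transitively and conjugates glued elements by shifting their components
  (lemma \<open>rot_\<Psi>\<close>). Every element of the stabiliser becomes one that fixes the first leaf of \<open>b\<close> after
  multiplication by one of them, which yields the semidirect product.
\<close>

section \<open>Groups of fractions of Ore categories\<close>

locale ore_cat =
  fixes C :: "('o, 'm) cat"
  assumes comp_arr: "\<lbrakk>f \<in> Arr C; g \<in> Arr C; Tgt C f = Src C g\<rbrakk> \<Longrightarrow> Comp C f g \<in> Arr C"
    and comp_src: "\<lbrakk>f \<in> Arr C; g \<in> Arr C; Tgt C f = Src C g\<rbrakk> \<Longrightarrow> Src C (Comp C f g) = Src C f"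
    and comp_tgt: "\<lbrakk>f \<in> Arr C; g \<in> Arr C; Tgt C f = Src C g\<rbrakk> \<Longrightarrow> Tgt C (Comp C f g) = Tgt C g"
    and comp_assoc: "\<lbrakk>f \<in> Arr C; g \<in> Arr C; h \<in> Arr C; Tgt C f = Src C g; Tgt C g = Src C h\<rbrakk>
        \<Longrightarrow> Comp C (Comp C f g) h = Comp C f (Comp C g h)"
    and idt_arr: "Idt C a \<in> Arr C"
    and idt_src: "Src C (Idt C a) = a"
    and idt_tgt: "Tgt C (Idt C a) = a"
    and comp_idt_left: "f \<in> Arr C \<Longrightarrow> Comp C (Idt C (Src C f)) f = f"
    and comp_idt_right: "f \<in> Arr C \<Longrightarrow> Comp C f (Idt C (Tgt C f)) = f"
    and ore: "ore_category C"
begin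

lemmas comp_simps = comp_arr comp_src comp_tgt comp_assoc

lemma cancel:
  "\<lbrakk>f \<in> Arr C; g \<in> Arr C; h \<in> Arr C; Tgt C f = Src C g; Tgt C f = Src C h;
    Comp C f g = Comp C f h\<rbrakk> \<Longrightarrow> g = h"
  using ore unfolding ore_category_def left_cancellative_def by blast

lemma ore_square:
  assumes "f \<in> Arr C" "g \<in> Arr C" "Src C f = Src C g"
  obtains p q where "p \<in> Arr C" "q \<in> Arr C" "Src C p = Tgt C f" "Src C q = Tgt C g"
    "Tgt C p = Tgt C q" "Comp C f p = Comp C g q"
proof -
  obtain p q where *: "p \<in> Arr C" "q \<in> Arr C" "Src C p = Tgt C f" "Src C q = Tgt C g"
    "Comp C f p = Comp C g q"
    using ore assms unfolding ore_category_def by blast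
  moreover have "Tgt C p = Tgt C q"
    using comp_tgt[of f p] comp_tgt[of g q] * assms by simp
  ultimately show ?thesis
    using that by blast
qed

text \<open>
  Substituting \<open>f \<circ> g = f' \<circ> g'\<close> below a further composition needs associativity on both sides, the form
  in which commuting squares are pasted.
\<close>

lemma comp_assoc_cong:
  assumes "Comp C f g = Comp C f' g'" "f \<in> Arr C" "g \<in> Arr C" "f' \<in> Arr C" "g' \<in> Arr C"
    "h \<in> Arr C" "Tgt C f = Src C g" "Tgt C f' = Src C g'" "Tgt C g = Src C h" "Tgt C g' = Src C h"
  shows "Comp C f (Comp C g h) = Comp C f' (Comp C g' h)"
  using assms comp_assoc[of f g h] comp_assoc[of f' g' h] by simp

text \<open>
  The relation generated by the expansion steps is the existence of a common expansion. Transitivity is the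
  point where the Ore squares enter.
\<close>

definition common_expansion :: "'m \<times> 'm \<Rightarrow> 'm \<times> 'm \<Rightarrow> bool" where
  "common_expansion u v \<longleftrightarrow>
     (\<exists>p q. p \<in> Arr C \<and> q \<in> Arr C \<and> Src C p = Tgt C (fst u) \<and> Src C q = Tgt C (fst v) \<and>
        Tgt C p = Tgt C q \<and>
        Comp C (fst u) p = Comp C (fst v) q \<and> Comp C (snd u) p = Comp C (snd v) q)"

lemma frac_pairs_expand:
  "\<lbrakk>(x, y) \<in> frac_pairs C c; h \<in> Arr C; Src C h = Tgt C x\<rbrakk>
    \<Longrightarrow> (Comp C x h, Comp C y h) \<in> frac_pairs C c"
  unfolding frac_pairs_def by (auto simp: comp_simps)

lemma common_expansion_trans:
  assumes uv: "u \<in> frac_pairs C c" "v \<in> frac_pairs C c" "w \<in> frac_pairs C c"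
    and e: "common_expansion u v" "common_expansion v w"
  shows "common_expansion u w"
proof -
  obtain p q where pq: "p \<in> Arr C" "q \<in> Arr C" "Src C p = Tgt C (fst u)" "Src C q = Tgt C (fst v)"
      "Tgt C p = Tgt C q"
      "Comp C (fst u) p = Comp C (fst v) q" "Comp C (snd u) p = Comp C (snd v) q"
    using e(1) unfolding common_expansion_def by blast
  obtain p' q' where pq': "p' \<in> Arr C" "q' \<in> Arr C" "Src C p' = Tgt C (fst v)"
      "Src C q' = Tgt C (fst w)" "Tgt C p' = Tgt C q'"
      "Comp C (fst v) p' = Comp C (fst w) q'" "Comp C (snd v) p' = Comp C (snd w) q'"
    using e(2) unfolding common_expansion_def by blast
  obtain a b where ab: "a \<in> Arr C" "b \<in> Arr C" "Src C a = Tgt C q" "Src C b = Tgt C p'"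
      "Tgt C a = Tgt C b" "Comp C q a = Comp C p' b"
    using ore_square[of q p'] pq pq' by metis
  have arr: "fst u \<in> Arr C" "snd u \<in> Arr C" "Tgt C (snd u) = Tgt C (fst u)"
      "fst v \<in> Arr C" "snd v \<in> Arr C" "Tgt C (snd v) = Tgt C (fst v)"
      "fst w \<in> Arr C" "snd w \<in> Arr C" "Tgt C (snd w) = Tgt C (fst w)"
    using uv unfolding frac_pairs_def by auto
  have "Comp C (fst u) (Comp C p a) = Comp C (fst v) (Comp C q a)"
      "Comp C (snd u) (Comp C p a) = Comp C (snd v) (Comp C q a)"
    using arr pq ab by - (rule comp_assoc_cong; simp)+
  moreover have "Comp C (fst v) (Comp C p' b) = Comp C (fst w) (Comp C q' b)"
      "Comp C (snd v) (Comp C p' b) = Comp C (snd w) (Comp C q' b)"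
    using arr pq pq' ab by - (rule comp_assoc_cong; simp)+
  ultimately have 1: "Comp C (fst u) (Comp C p a) = Comp C (fst w) (Comp C q' b)"
      "Comp C (snd u) (Comp C p a) = Comp C (snd w) (Comp C q' b)"
    using ab(6) by simp_all
  show ?thesis
    unfolding common_expansion_def
    apply (rule exI[of _ "Comp C p a"], rule exI[of _ "Comp C q' b"])
    using 1 arr pq pq' ab by (simp add: comp_arr comp_src comp_tgt)
qed

lemma common_expansion_sym: "common_expansion u v \<Longrightarrow> common_expansion v u"
  unfolding common_expansion_def by metis

lemma common_expansion_refl: "u \<in> frac_pairs C c \<Longrightarrow> common_expansion u u"
  unfolding common_expansion_def frac_pairs_def
  by (intro exI[of _ "Idt C (Tgt C (fst u))"]) (auto simp: idt_arr idt_src)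

lemma frac_step_pairs:
  "frac_step C c u v \<Longrightarrow> u \<in> frac_pairs C c \<and> v \<in> frac_pairs C c"
  unfolding frac_step_def by (cases u) (auto simp: frac_pairs_expand)

lemma frac_step_common_expansion:
  assumes "frac_step C c u v"
  shows "common_expansion u v"
proof -
  obtain h where h: "h \<in> Arr C" "Src C h = Tgt C (fst u)"
      "v = (Comp C (fst u) h, Comp C (snd u) h)" "u \<in> frac_pairs C c"
    using assms unfolding frac_step_def by blast
  then have "Comp C (fst v) (Idt C (Tgt C h)) = fst v" "Comp C (snd v) (Idt C (Tgt C h)) = snd v"
      "Tgt C (fst v) = Tgt C h"
    by (auto simp: frac_pairs_def comp_simps comp_idt_right idt_arr idt_src)
  then show ?thesis
    unfolding common_expansion_def using h
    apply (rule_tac exI[of _ h], rule_tac exI[of _ "Idt C (Tgt C h)"])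
    by (simp add: idt_arr idt_src idt_tgt)
qed

lemma equivclp_frac_step:
  assumes "u \<in> frac_pairs C c"
  shows "equivclp (frac_step C c) u v \<longleftrightarrow> v \<in> frac_pairs C c \<and> common_expansion u v"
proof
  assume "equivclp (frac_step C c) u v"
  then show "v \<in> frac_pairs C c \<and> common_expansion u v"
  proof (induction rule: equivclp_induct)
    case base
    show ?case using assms common_expansion_refl by blast
  next
    case (step v w)
    then have "w \<in> frac_pairs C c" "common_expansion v w"
      using frac_step_pairs frac_step_common_expansion common_expansion_sym by blast+
    then show ?case
      using step.IH assms common_expansion_trans by blast
  qed
next
  assume v: "v \<in> frac_pairs C c \<and> common_expansion u v"
  then obtain p q where pq: "p \<in> Arr C" "q \<in> Arr C" "Src C p = Tgt C (fst u)"
      "Src C q = Tgt C (fst v)"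
      "Comp C (fst u) p = Comp C (fst v) q" "Comp C (snd u) p = Comp C (snd v) q"
    unfolding common_expansion_def by blast
  have "frac_step C c u (Comp C (fst u) p, Comp C (snd u) p)"
    using assms pq unfolding frac_step_def by auto
  moreover have "frac_step C c v (Comp C (fst u) p, Comp C (snd u) p)"
    using v pq unfolding frac_step_def by auto
  ultimately show "equivclp (frac_step C c) u v"
    by (meson equivclp_sym equivclp_trans r_into_equivclp)
qed

lemma fraction_eq_iff_equivclp:
  "fraction C c x y = fraction C c x' y' \<longleftrightarrow> equivclp (frac_step C c) (x, y) (x', y')"
  unfolding fraction_def set_eq_iff mem_Collect_eq
  by (meson equivclp_refl equivclp_sym equivclp_trans)

lemma fraction_eq_iff:
  assumes "(x, y) \<in> frac_pairs C c" "(x', y') \<in> frac_pairs C c"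
  shows "fraction C c x y = fraction C c x' y' \<longleftrightarrow>
    (\<exists>p q. p \<in> Arr C \<and> q \<in> Arr C \<and> Src C p = Tgt C x \<and> Src C q = Tgt C x' \<and> Tgt C p = Tgt C q \<and>
        Comp C x p = Comp C x' q \<and> Comp C y p = Comp C y' q)"
  using equivclp_frac_step[OF assms(1), of "(x', y')"] assms(2)
  unfolding fraction_eq_iff_equivclp common_expansion_def by simp

lemma fraction_expand:
  assumes "(x, y) \<in> frac_pairs C c" "h \<in> Arr C" "Src C h = Tgt C x"
  shows "fraction C c (Comp C x h) (Comp C y h) = fraction C c x y"
proof -
  have "frac_step C c (x, y) (Comp C x h, Comp C y h)"
    using assms unfolding frac_step_def by auto
  then show ?thesis
    unfolding fraction_eq_iff_equivclp by (rule converse_r_into_equivclp)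
qed

text \<open>
  The two equalities come with expansions of \<open>y\<close> that need not agree. An Ore square makes them agree, and
  left cancellation of \<open>y'\<close> transfers the agreement to the primed side.
\<close>

lemma fraction_compose_well_defined:
  assumes p: "(x, y) \<in> frac_pairs C c" "(y, z) \<in> frac_pairs C c"
    and p': "(x', y') \<in> frac_pairs C c" "(y', z') \<in> frac_pairs C c"
    and e: "fraction C c x y = fraction C c x' y'" "fraction C c y z = fraction C c y' z'"
  shows "fraction C c x z = fraction C c x' z'"
proof -
  have arr: "x \<in> Arr C" "y \<in> Arr C" "z \<in> Arr C" "x' \<in> Arr C" "y' \<in> Arr C" "z' \<in> Arr C"
      "Tgt C y = Tgt C x" "Tgt C z = Tgt C x" "Tgt C y' = Tgt C x'" "Tgt C z' = Tgt C x'"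
      "Src C x = c" "Src C y = c" "Src C z = c" "Src C x' = c" "Src C y' = c" "Src C z' = c"
    using p p' unfolding frac_pairs_def by auto
  obtain a a' where a: "a \<in> Arr C" "a' \<in> Arr C" "Src C a = Tgt C x" "Src C a' = Tgt C x'"
      "Tgt C a = Tgt C a'" "Comp C x a = Comp C x' a'" "Comp C y a = Comp C y' a'"
    using e(1) unfolding fraction_eq_iff[OF p(1) p'(1)] by blast
  obtain b b' where b: "b \<in> Arr C" "b' \<in> Arr C" "Src C b = Tgt C y" "Src C b' = Tgt C y'"
      "Tgt C b = Tgt C b'" "Comp C y b = Comp C y' b'" "Comp C z b = Comp C z' b'"
    using e(2) unfolding fraction_eq_iff[OF p(2) p'(2)] by blast
  obtain d e where de: "d \<in> Arr C" "e \<in> Arr C" "Src C d = Tgt C a" "Src C e = Tgt C b"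
      "Tgt C d = Tgt C e" "Comp C a d = Comp C b e"
    using ore_square[of a b] a b arr by metis
  have "Comp C y (Comp C a d) = Comp C y' (Comp C a' d)"
    using arr a de by - (rule comp_assoc_cong; simp)
  moreover have "Comp C y (Comp C b e) = Comp C y' (Comp C b' e)"
    using arr a b de by - (rule comp_assoc_cong; simp)
  ultimately have "Comp C y' (Comp C a' d) = Comp C y' (Comp C b' e)"
    using de(6) by simp
  then have eq: "Comp C a' d = Comp C b' e"
    using arr a b de by - (rule cancel[of y'], simp_all add: comp_arr comp_src)
  have 1: "Comp C x (Comp C a d) = Comp C x' (Comp C a' d)"
    using arr a de by - (rule comp_assoc_cong; simp)
  have "Comp C z (Comp C b e) = Comp C z' (Comp C b' e)"
    using arr b de by - (rule comp_assoc_cong; simp)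
  then have 2: "Comp C z (Comp C a d) = Comp C z' (Comp C a' d)"
    using de(6) eq by simp
  have "(x, z) \<in> frac_pairs C c" "(x', z') \<in> frac_pairs C c"
    using arr unfolding frac_pairs_def by auto
  from fraction_eq_iff[OF this] show ?thesis
    apply (rule iffD2)
    apply (rule exI[of _ "Comp C a d"], rule exI[of _ "Comp C a' d"])
    using 1 2 arr a de(1-5) by (simp add: comp_arr comp_src comp_tgt)
qed

text \<open>
  With fractions brought to a common middle term the product is read off; this rule replaces the definite
  description in the definition of the multiplication.
\<close>

lemma mult_Frac:
  assumes p: "(x, y) \<in> frac_pairs C c" "(y, z) \<in> frac_pairs C c"
  shows "fraction C c x y \<otimes>\<^bsub>Frac C c\<^esub> fraction C c y z = fraction C c x z"
proof -
  have arr: "x \<in> Arr C" "y \<in> Arr C" "z \<in> Arr C" "Tgt C y = Tgt C x" "Tgt C z = Tgt C x"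
    using p unfolding frac_pairs_def by auto
  have "(THE w. \<exists>x1 y1 x' y' p p'.
                (x1, y1) \<in> frac_pairs C c \<and> (x', y') \<in> frac_pairs C c \<and>
                fraction C c x y = fraction C c x1 y1 \<and> fraction C c y z = fraction C c x' y' \<and>
                p \<in> Arr C \<and> p' \<in> Arr C \<and> Src C p = Tgt C y1 \<and> Src C p' = Tgt C x' \<and>
                Comp C y1 p = Comp C x' p' \<and>
                w = fraction C c (Comp C x1 p) (Comp C y' p')) = fraction C c x z" (is "The ?P = _")
  proof (rule the_equality)
    show "?P (fraction C c x z)"
      using p arr
      apply (rule_tac exI[of _ x], rule_tac exI[of _ y], rule_tac exI[of _ y], rule_tac exI[of _ z])
      apply (rule_tac exI[of _ "Idt C (Tgt C x)"], rule_tac exI[of _ "Idt C (Tgt C x)"])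
      using comp_idt_right[of x] comp_idt_right[of z] by (simp add: idt_arr idt_src)
  next
    fix w assume "?P w"
    then obtain x1 y1 x' y' q q' where w: "(x1, y1) \<in> frac_pairs C c" "(x', y') \<in> frac_pairs C c"
        "fraction C c x y = fraction C c x1 y1" "fraction C c y z = fraction C c x' y'"
        "q \<in> Arr C" "q' \<in> Arr C" "Src C q = Tgt C y1" "Src C q' = Tgt C x'"
        "Comp C y1 q = Comp C x' q'" "w = fraction C c (Comp C x1 q) (Comp C y' q')"
      by blast
    have t: "Tgt C x1 = Tgt C y1"
      using w(1) unfolding frac_pairs_def by auto
    have "fraction C c (Comp C x1 q) (Comp C y1 q) = fraction C c x y"
      using fraction_expand[OF w(1), of q] w t by simp
    moreover have "fraction C c (Comp C y1 q) (Comp C y' q') = fraction C c y z"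
      using fraction_expand[OF w(2), of q'] w by simp
    moreover have "(Comp C x1 q, Comp C y1 q) \<in> frac_pairs C c"
        "(Comp C y1 q, Comp C y' q') \<in> frac_pairs C c"
      using frac_pairs_expand[OF w(1), of q] frac_pairs_expand[OF w(2), of q'] w t by auto
    ultimately show "w = fraction C c x z"
      using fraction_compose_well_defined p w(10) by blast
  qed
  then show ?thesis
    unfolding Frac_def by simp
qed

lemma carrier_FracE:
  assumes "g \<in> carrier (Frac C c)"
  obtains x y where "(x, y) \<in> frac_pairs C c" "g = fraction C c x y"
  using assms unfolding Frac_def by auto

lemma fraction_in_carrier: "(x, y) \<in> frac_pairs C c \<Longrightarrow> fraction C c x y \<in> carrier (Frac C c)"
  unfolding Frac_def by auto

lemma composable_fractions:
  assumes "g \<in> carrier (Frac C c)" "h \<in> carrier (Frac C c)"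
  obtains x y z where "(x, y) \<in> frac_pairs C c" "(y, z) \<in> frac_pairs C c"
    "g = fraction C c x y" "h = fraction C c y z"
proof -
  obtain x y where g: "(x, y) \<in> frac_pairs C c" "g = fraction C c x y"
    using assms(1) by (rule carrier_FracE)
  obtain y' z where h: "(y', z) \<in> frac_pairs C c" "h = fraction C c y' z"
    using assms(2) by (rule carrier_FracE)
  have yy': "y \<in> Arr C" "y' \<in> Arr C" "Src C y = Src C y'"
    using g h unfolding frac_pairs_def by auto
  obtain p q where pq: "p \<in> Arr C" "q \<in> Arr C" "Src C p = Tgt C y" "Src C q = Tgt C y'"
      "Comp C y p = Comp C y' q"
    using ore_square[OF yy'] by blast
  have t: "Tgt C x = Tgt C y"
    using g unfolding frac_pairs_def by auto
  show ?thesis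
  proof (rule that)
    show "(Comp C x p, Comp C y p) \<in> frac_pairs C c"
      using frac_pairs_expand[OF g(1), of p] pq t by simp
    show "(Comp C y p, Comp C z q) \<in> frac_pairs C c"
      using frac_pairs_expand[OF h(1), of q] pq t by simp
    show "g = fraction C c (Comp C x p) (Comp C y p)"
      using fraction_expand[OF g(1), of p] g pq t by simp
    show "h = fraction C c (Comp C y p) (Comp C z q)"
      using fraction_expand[OF h(1), of q] h pq t by simp
  qed
qed

lemma fraction_self:
  assumes "(y, y) \<in> frac_pairs C c"
  shows "fraction C c y y = \<one>\<^bsub>Frac C c\<^esub>"
proof -
  have "(Idt C c, Idt C c) \<in> frac_pairs C c"
    by (simp add: frac_pairs_def idt_arr idt_src)
  moreover have y: "y \<in> Arr C" "Src C y = c"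
    using assms unfolding frac_pairs_def by simp_all
  ultimately have "fraction C c (Comp C (Idt C c) y) (Comp C (Idt C c) y) =
      fraction C c (Idt C c) (Idt C c)"
    by (simp add: fraction_expand idt_tgt)
  then show ?thesis
    using comp_idt_left[of y] y by (simp add: Frac_def)
qed

theorem group_Frac: "group (Frac C c)"
proof (rule groupI)
  fix g h assume gh: "g \<in> carrier (Frac C c)" "h \<in> carrier (Frac C c)"
  obtain x y z where *: "(x, y) \<in> frac_pairs C c" "(y, z) \<in> frac_pairs C c"
    "g = fraction C c x y" "h = fraction C c y z"
    using composable_fractions[OF gh] .
  then have "(x, z) \<in> frac_pairs C c"
    by (auto simp: frac_pairs_def)
  then show "g \<otimes>\<^bsub>Frac C c\<^esub> h \<in> carrier (Frac C c)"
    using * mult_Frac fraction_in_carrier by simp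
next
  have "(Idt C c, Idt C c) \<in> frac_pairs C c"
    by (simp add: frac_pairs_def idt_arr idt_src)
  then show "\<one>\<^bsub>Frac C c\<^esub> \<in> carrier (Frac C c)"
    by (metis fraction_in_carrier fraction_self)
next
  fix g h k assume ghk: "g \<in> carrier (Frac C c)" "h \<in> carrier (Frac C c)" "k \<in> carrier (Frac C c)"
  obtain x y z where *: "(x, y) \<in> frac_pairs C c" "(y, z) \<in> frac_pairs C c"
    "g = fraction C c x y" "h = fraction C c y z"
    using composable_fractions[OF ghk(1,2)] .
  obtain z' w where k: "(z', w) \<in> frac_pairs C c" "k = fraction C c z' w"
    using ghk(3) by (rule carrier_FracE)
  have zz': "z \<in> Arr C" "z' \<in> Arr C" "Src C z = Src C z'"
    using * k unfolding frac_pairs_def by auto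
  obtain p q where pq: "p \<in> Arr C" "q \<in> Arr C" "Src C p = Tgt C z" "Src C q = Tgt C z'"
      "Comp C z p = Comp C z' q"
    using ore_square[OF zz'] by blast
  have t: "Tgt C x = Tgt C z" "Tgt C y = Tgt C z"
    using * unfolding frac_pairs_def by auto
  let ?x = "Comp C x p" and ?y = "Comp C y p" and ?z = "Comp C z p" and ?w = "Comp C w q"
  have f: "(?x, ?y) \<in> frac_pairs C c" "(?y, ?z) \<in> frac_pairs C c" "(?z, ?w) \<in> frac_pairs C c"
    using frac_pairs_expand[OF *(1), of p] frac_pairs_expand[OF *(2), of p]
      frac_pairs_expand[OF k(1), of q] pq t
    by simp_all
  then have f': "(?x, ?z) \<in> frac_pairs C c" "(?y, ?w) \<in> frac_pairs C c"
    unfolding frac_pairs_def by auto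
  have "g = fraction C c ?x ?y" "h = fraction C c ?y ?z" "k = fraction C c ?z ?w"
    using fraction_expand[OF *(1), of p] fraction_expand[OF *(2), of p]
      fraction_expand[OF k(1), of q] * k pq t
    by simp_all
  then show "g \<otimes>\<^bsub>Frac C c\<^esub> h \<otimes>\<^bsub>Frac C c\<^esub> k = g \<otimes>\<^bsub>Frac C c\<^esub> (h \<otimes>\<^bsub>Frac C c\<^esub> k)"
    using f f' by (simp add: mult_Frac)
next
  fix g assume "g \<in> carrier (Frac C c)"
  then obtain x y where g: "(x, y) \<in> frac_pairs C c" "g = fraction C c x y"
    by (rule carrier_FracE)
  then have p: "(x, x) \<in> frac_pairs C c" "(y, x) \<in> frac_pairs C c" "(y, y) \<in> frac_pairs C c"
    unfolding frac_pairs_def by auto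
  show "\<one>\<^bsub>Frac C c\<^esub> \<otimes>\<^bsub>Frac C c\<^esub> g = g"
    using mult_Frac[OF p(1) g(1)] g(2) fraction_self[OF p(1)] by simp
  show "\<exists>h\<in>carrier (Frac C c). h \<otimes>\<^bsub>Frac C c\<^esub> g = \<one>\<^bsub>Frac C c\<^esub>"
    using mult_Frac[OF p(2) g(1)] g(2) fraction_self[OF p(3)] fraction_in_carrier[OF p(2)] by auto
qed

end

section \<open>Stacking of forests\<close>

lemma leaves_Nil [simp]: "leaves [] = 0"
  and leaves_Cons [simp]: "leaves (t # f) = size1 t + leaves f"
  and leaves_append [simp]: "leaves (f @ g) = leaves f + leaves g"
  unfolding leaves_def by simp_all

lemma leaves_replicate_Leaf [simp]: "leaves (replicate n Leaf) = n"
  by (induction n) simp_all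

lemma length_stack [simp]: "length (stack f g) = length f"
  by (induction f g rule: stack.induct) simp_all

lemma leaves_take_drop: "leaves (take n f) + leaves (drop n f) = leaves f"
  by (metis append_take_drop_id leaves_append)

lemma size1_graft: "length g = size1 t \<Longrightarrow> size1 (graft t g) = leaves g"
proof (induction t g rule: graft.induct)
  case (1 g)
  then obtain u where "g = [u]" by (auto simp: length_Suc_conv)
  then show ?case by simp
next
  case (2 l a r g)
  then show ?case using leaves_take_drop[of "size1 l" g] by simp
qed

lemma leaves_stack [simp]: "length g = leaves f \<Longrightarrow> leaves (stack f g) = leaves g"
proof (induction f g rule: stack.induct)
  case (2 t f g)
  then show ?case using leaves_take_drop[of "size1 t" g] by (simp add: size1_graft)
qed simp

text \<open>
  Concatenation and stacking obey the interchange law, so that a forest can be cut between two roots.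
\<close>

lemma stack_append:
  "length g = leaves f \<Longrightarrow> stack (f @ f') (g @ g') = stack f g @ stack f' g'"
  by (induction f g rule: stack.induct) simp_all

lemma graft_graft:
  "\<lbrakk>length g = size1 t; length h = leaves g\<rbrakk> \<Longrightarrow> graft (graft t g) h = graft t (stack g h)"
proof (induction t g arbitrary: h rule: graft.induct)
  case (1 g)
  then obtain u where "g = [u]" by (auto simp: length_Suc_conv)
  then show ?case using 1 by simp
next
  case (2 l a r g)
  let ?g1 = "take (size1 l) g" and ?g2 = "drop (size1 l) g"
  let ?h1 = "take (leaves ?g1) h" and ?h2 = "drop (leaves ?g1) h"
  have len: "length ?g1 = size1 l" "length ?g2 = size1 r" "length ?h1 = leaves ?g1"
      "length ?h2 = leaves ?g2"
    using 2(3,4) leaves_take_drop[of "size1 l" g] by simp_all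
  have "stack g h = stack (?g1 @ ?g2) (?h1 @ ?h2)"
    by simp
  also have "\<dots> = stack ?g1 ?h1 @ stack ?g2 ?h2"
    using len by (intro stack_append)
  finally have "take (size1 l) (stack g h) = stack ?g1 ?h1"
      "drop (size1 l) (stack g h) = stack ?g2 ?h2"
    using len by simp_all
  then show ?case
    using 2(1)[OF len(1,3)] 2(2)[OF len(2,4)] len by (simp add: size1_graft)
qed

lemma stack_assoc:
  "\<lbrakk>length g = leaves f; length h = leaves g\<rbrakk> \<Longrightarrow> stack (stack f g) h = stack f (stack g h)"
proof (induction f g arbitrary: h rule: stack.induct)
  case (2 t f g)
  let ?g1 = "take (size1 t) g" and ?g2 = "drop (size1 t) g"
  let ?h1 = "take (leaves ?g1) h" and ?h2 = "drop (leaves ?g1) h"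
  have len: "length ?g1 = size1 t" "length ?g2 = leaves f" "length ?h1 = leaves ?g1"
      "length ?h2 = leaves ?g2"
    using 2(2,3) leaves_take_drop[of "size1 t" g] by simp_all
  have "stack g h = stack (?g1 @ ?g2) (?h1 @ ?h2)"
    by simp
  also have "\<dots> = stack ?g1 ?h1 @ stack ?g2 ?h2"
    using len by (intro stack_append)
  finally have "take (size1 t) (stack g h) = stack ?g1 ?h1"
      "drop (size1 t) (stack g h) = stack ?g2 ?h2"
    using len by simp_all
  then show ?case
    using 2(1)[OF len(2,4)] len by (simp add: size1_graft graft_graft)
qed simp

lemma graft_Leaves: "graft t (replicate (size1 t) Leaf) = t"
  by (induction t) (simp_all add: min_def)

lemma stack_Leaves_right [simp]: "stack f (replicate (leaves f) Leaf) = f"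
  by (induction f) (simp_all add: graft_Leaves min_def)

lemma stack_Leaves_left: "length g = n \<Longrightarrow> stack (replicate n Leaf) g = g"
proof (induction n arbitrary: g)
  case (Suc n)
  then show ?case by (cases g) simp_all
qed simp

lemma nth_stack:
  "\<lbrakk>length g = leaves f; i < length f\<rbrakk>
    \<Longrightarrow> stack f g ! i = graft (f ! i) (take (size1 (f ! i)) (drop (leaves (take i f)) g))"
proof (induction f g arbitrary: i rule: stack.induct)
  case (2 t f g)
  then show ?case by (cases i) (simp_all add: add.commute)
qed simp

section \<open>Forests modulo skein relations\<close>

text \<open>
  Each rule of \<open>skein_equiv\<close> preserves the property of being equivalent tree by tree, because stacking acts
  on the trees of a forest separately. Consequently the numbers of leaves of the individual trees are invariants
  of a class, which makes all the constructions on representatives well defined.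
\<close>

abbreviation tree_equiv :: "('s tree \<times> 's tree) set \<Rightarrow> 's tree \<Rightarrow> 's tree \<Rightarrow> bool" where
  "tree_equiv R u v \<equiv> skein_equiv R [u] [v] \<and> size1 u = size1 v"

lemma skein_equiv_if_tree_equiv: "list_all2 (tree_equiv R) f g \<Longrightarrow> skein_equiv R f g"
proof (induction rule: list_all2_induct)
  case Nil
  show ?case by (rule skein_equiv.refl)
next
  case (Cons x xs y ys)
  have "skein_equiv R ([x] @ xs) ([y] @ xs)"
    using Cons by (blast intro: skein_equiv.tensor_right)
  moreover have "skein_equiv R ([y] @ xs) ([y] @ ys)"
    using Cons by (blast intro: skein_equiv.tensor_left)
  ultimately show ?case using skein_equiv.trans by fastforce
qed

lemma leaves_if_tree_equiv: "list_all2 (tree_equiv R) f g \<Longrightarrow> leaves f = leaves g"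
  by (induction rule: list_all2_induct) simp_all

text \<open>
  Each tree on the left receives its own segment of \<open>h\<close>, and these segments are the same on both sides
  because equivalent trees have equally many leaves.
\<close>

lemma stack_tree_equiv_left:
  "\<lbrakk>list_all2 (tree_equiv R) f g; leaves f = length h\<rbrakk>
    \<Longrightarrow> list_all2 (tree_equiv R) (stack f h) (stack g h)"
proof (induction arbitrary: h rule: list_all2_induct)
  case (Cons x xs y ys)
  let ?h = "take (size1 x) h"
  have len: "length ?h = size1 x" "length ?h = size1 y"
    using Cons by auto
  have "skein_equiv R (stack [x] ?h) (stack [y] ?h)"
    using Cons len by (intro skein_equiv.comp_right) auto
  moreover have "size1 (graft x ?h) = size1 (graft y ?h)"
    using len by (simp add: size1_graft)
  moreover have "list_all2 (tree_equiv R) (stack xs (drop (size1 x) h)) (stack ys (drop (size1 x) h))"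
    using Cons by auto
  ultimately show ?case
    using Cons.hyps len by (auto simp: min_def split: if_splits)
qed simp

lemma stack_tree_equiv_right:
  "\<lbrakk>list_all2 (tree_equiv R) f g; leaves h = length f\<rbrakk>
    \<Longrightarrow> list_all2 (tree_equiv R) (stack h f) (stack h g)"
proof (induction h arbitrary: f g)
  case (Cons t h)
  let ?f = "take (size1 t) f" and ?g = "take (size1 t) g"
  have l: "list_all2 (tree_equiv R) ?f ?g"
    using Cons.prems by (blast intro: list_all2_takeI)
  have lg: "length g = length f"
    using Cons.prems list_all2_lengthD by fastforce
  have len: "length ?f = size1 t" "length ?g = size1 t"
    using Cons.prems lg by auto
  have "skein_equiv R (stack [t] ?f) (stack [t] ?g)"
    using skein_equiv_if_tree_equiv[OF l] len by (intro skein_equiv.comp_left) auto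
  moreover have "size1 (graft t ?f) = size1 (graft t ?g)"
    using len leaves_if_tree_equiv[OF l] by (simp add: size1_graft)
  moreover have "list_all2 (tree_equiv R) (stack h (drop (size1 t) f)) (stack h (drop (size1 t) g))"
    using Cons by (auto intro: list_all2_dropI)
  ultimately show ?case
    using len by simp
qed simp

lemma tree_equiv_refl: "list_all2 (tree_equiv R) f f"
  by (simp add: list_all2_refl skein_equiv.refl)

lemma tree_equiv_if_skein_equiv:
  assumes "skein_relations R" "skein_equiv R f g"
  shows "list_all2 (tree_equiv R) f g"
  using assms(2)
proof (induction rule: skein_equiv.induct)
  case (base u v)
  then show ?case
    using assms(1) by (auto simp: skein_relations_def intro: skein_equiv.base)
next
  case (refl f)
  show ?case by (rule tree_equiv_refl)
next
  case (sym f g)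
  then show ?case
    by (auto simp: list_all2_conv_all_nth intro: skein_equiv.sym)
next
  case (trans f g h)
  have "tree_equiv R a c" if "tree_equiv R a b" "tree_equiv R b c" for a b c
    using that skein_equiv.trans by auto
  from list_all2_trans[OF this trans.IH] show ?case by simp
next
  case (comp_left f g h)
  then show ?case by (intro stack_tree_equiv_right)
next
  case (comp_right f g h)
  then show ?case by (intro stack_tree_equiv_left)
next
  case (tensor_left f g h)
  then show ?case by (intro list_all2_appendI tree_equiv_refl)
next
  case (tensor_right f g h)
  then show ?case by (intro list_all2_appendI tree_equiv_refl)
qed

lemma skein_class_eq_iff: "skein_class R f = skein_class R g \<longleftrightarrow> skein_equiv R f g"
  unfolding skein_class_def set_eq_iff mem_Collect_eq
  by (meson skein_equiv.refl skein_equiv.sym skein_equiv.trans)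

lemma skein_equiv_forest_rep: "skein_equiv R f (forest_rep (skein_class R f))"
proof -
  have "f \<in> skein_class R f"
    by (simp add: skein_class_def skein_equiv.refl)
  then have "forest_rep (skein_class R f) \<in> skein_class R f"
    unfolding forest_rep_def by (rule someI)
  then show ?thesis by (simp add: skein_class_def)
qed

lemma Arr_ForC: "Arr (ForC R) = range (skein_class R)"
  by (simp add: ForC_def)

locale skein =
  fixes R :: "('s tree \<times> 's tree) set"
  assumes skein_relations: "skein_relations R"
begin

abbreviation cl :: "'s forest \<Rightarrow> 's forest set" where "cl \<equiv> skein_class R"

lemma cl_eq_iff: "cl f = cl g \<longleftrightarrow> list_all2 (tree_equiv R) f g"
  unfolding skein_class_eq_iff
  using skein_equiv_if_tree_equiv tree_equiv_if_skein_equiv[OF skein_relations] by (rule iffI[rotated])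

lemma cl_eqD:
  assumes "cl f = cl g"
  shows "length f = length g" "leaves f = leaves g" "map size1 f = map size1 g"
proof -
  have l: "list_all2 (tree_equiv R) f g"
    using assms cl_eq_iff by blast
  show "length f = length g" using l by (rule list_all2_lengthD)
  show "leaves f = leaves g" using l by (rule leaves_if_tree_equiv)
  show "map size1 f = map size1 g"
    using l by (induction rule: list_all2_induct) simp_all
qed

lemma cl_forest_rep [simp]: "cl (forest_rep (cl f)) = cl f"
  using skein_class_eq_iff skein_equiv_forest_rep by blast

lemma Src_ForC [simp]: "Src (ForC R) (cl f) = length f"
  and Tgt_ForC [simp]: "Tgt (ForC R) (cl f) = leaves f"
  unfolding ForC_def using cl_eqD[OF cl_forest_rep] by simp_all

lemma Idt_ForC [simp]: "Idt (ForC R) n = cl (replicate n Leaf)"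
  by (simp add: ForC_def)

lemma cl_stack_cong:
  "\<lbrakk>cl f = cl f'; cl g = cl g'; leaves f = length g\<rbrakk> \<Longrightarrow> cl (stack f g) = cl (stack f' g')"
proof -
  assume *: "cl f = cl f'" "cl g = cl g'" "leaves f = length g"
  then have "cl (stack f g) = cl (stack f' g)"
    unfolding cl_eq_iff by (intro stack_tree_equiv_left)
  also have "\<dots> = cl (stack f' g')"
    using * cl_eqD(2)[OF *(1)] unfolding cl_eq_iff by (intro stack_tree_equiv_right) simp_all
  finally show ?thesis .
qed

lemma cl_append_cong: "\<lbrakk>cl f = cl f'; cl g = cl g'\<rbrakk> \<Longrightarrow> cl (f @ g) = cl (f' @ g')"
  unfolding cl_eq_iff by (rule list_all2_appendI)

lemma Comp_ForC [simp]: "leaves f = length g \<Longrightarrow> Comp (ForC R) (cl f) (cl g) = cl (stack f g)"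
  unfolding ForC_def using cl_eqD[OF cl_forest_rep]
  by (simp del: length_stack) (rule cl_stack_cong, simp_all)

lemma cl_eq_nth_iff:
  "cl f = cl g \<longleftrightarrow> length f = length g \<and> (\<forall>i<length f. cl [f ! i] = cl [g ! i])"
  unfolding cl_eq_iff by (simp add: list_all2_conv_all_nth)

end

section \<open>Rotations of roots and leaves\<close>

lemma cyc_funpow: "(cyc n ^^ i) j = (if j \<in> {1..n} then (j - 1 + i) mod n + 1 else j)"
proof (induction i)
  case 0
  show ?case by auto
next
  case (Suc i)
  show ?case
  proof (cases "j \<in> {1..n}")
    case True
    then have n: "0 < n" by simp
    let ?m = "(j - 1 + i) mod n"
    have "cyc n (m + 1) = Suc m mod n + 1" if "m < n" for m
      using that by (simp add: cyc_def)
    then have "cyc n (?m + 1) = Suc ?m mod n + 1"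
      using n by simp
    then have "(cyc n ^^ Suc i) j = Suc ?m mod n + 1"
      by (simp only: funpow.simps o_apply Suc if_P[OF True])
    also have "Suc ?m mod n = (j - 1 + Suc i) mod n"
      by (simp add: mod_Suc_eq)
    finally show ?thesis using True by simp
  next
    case False
    then show ?thesis using Suc by (auto simp: cyc_def)
  qed
qed

lemma cyc_funpow_self: "cyc n ^^ n = id"
proof (rule ext)
  fix j
  have "(j - 1 + n) mod n + 1 = j" if "j \<in> {1..n}"
    using that by (simp only: mod_add_self2) auto
  then show "(cyc n ^^ n) j = id j"
    by (simp only: cyc_funpow id_apply split: if_split) blast
qed

lemma cyc_funpow_mod: "cyc n ^^ (i mod n) = cyc n ^^ i"
  by (rule ext) (simp only: cyc_funpow mod_add_right_eq)

lemma cyc_funpow_in_rotations [simp]: "cyc n ^^ i \<in> rotations n"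
  by (auto simp: rotations_def)

lemma rotationsE:
  assumes "\<sigma> \<in> rotations n"
  obtains i where "i \<le> n" "\<sigma> = cyc n ^^ i"
proof -
  obtain i where i: "\<sigma> = cyc n ^^ i"
    using assms by (auto simp: rotations_def)
  show ?thesis
  proof (cases "n = 0")
    case True
    then have "\<sigma> = cyc n ^^ 0" unfolding i by (auto simp: cyc_funpow)
    then show ?thesis using that[of 0] by blast
  next
    case False
    then have "i mod n < n" by simp
    then show ?thesis using that[of "i mod n"] i cyc_funpow_mod by simp
  qed
qed

lemma id_in_rotations [simp]: "id \<in> rotations n"
  by (metis cyc_funpow_in_rotations funpow.simps(1))

lemma rotations_comp: "\<lbrakk>\<sigma> \<in> rotations n; \<tau> \<in> rotations n\<rbrakk> \<Longrightarrow> \<sigma> \<circ> \<tau> \<in> rotations n"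
  by (auto simp: rotations_def simp flip: funpow_add)

lemma rotations_inverse:
  assumes "\<sigma> \<in> rotations n"
  obtains \<tau> where "\<tau> \<in> rotations n" "\<sigma> \<circ> \<tau> = id" "\<tau> \<circ> \<sigma> = id"
proof -
  obtain i where i: "i \<le> n" "\<sigma> = cyc n ^^ i"
    using assms by (rule rotationsE)
  show ?thesis
  proof (rule that)
    show "cyc n ^^ (n - i) \<in> rotations n" by simp
    show "\<sigma> \<circ> cyc n ^^ (n - i) = id" "cyc n ^^ (n - i) \<circ> \<sigma> = id"
      using i cyc_funpow_self[of n] by (simp_all flip: funpow_add)
  qed
qed

lemma rotations_range: "\<lbrakk>\<sigma> \<in> rotations n; j \<in> {1..n}\<rbrakk> \<Longrightarrow> \<sigma> j \<in> {1..n}"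
  by (auto simp: rotations_def cyc_funpow Suc_le_eq)

lemma rotations_bij_betw:
  assumes "\<sigma> \<in> rotations n"
  shows "bij_betw \<sigma> {1..n} {1..n}"
proof -
  obtain \<tau> where \<tau>: "\<tau> \<in> rotations n" "\<sigma> \<circ> \<tau> = id" "\<tau> \<circ> \<sigma> = id"
    using assms by (rule rotations_inverse)
  then show ?thesis
    using assms rotations_range
    by (intro bij_betw_byWitness[where f' = \<tau>]) (auto simp: pointfree_idE image_subset_iff)
qed

lemma rotation_one_eq_id:
  assumes "\<sigma> \<in> rotations n" "\<sigma> 1 = 1"
  shows "\<sigma> = id"
proof -
  obtain i where i: "\<sigma> = cyc n ^^ i"
    using assms by (auto simp: rotations_def)
  show ?thesis
  proof (cases "n = 0")
    case True
    then show ?thesis unfolding i by (auto simp: cyc_funpow)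
  next
    case False
    then have "i mod n = 0" using assms(2) unfolding i by (auto simp: cyc_funpow)
    then show ?thesis using cyc_funpow_mod[where n = n and i = i] i by (simp add: id_def)
  qed
qed

text \<open>
  A rotation of the roots cuts the forest in two parts and exchanges them. In this form the laws of
  \<open>perm_forest\<close> and \<open>perm_leaves\<close> become identities between lists.
\<close>

lemma forest_rotationE:
  assumes "\<sigma> \<in> rotations (length f)"
  obtains a b where "f = a @ b" "\<sigma> = cyc (length f) ^^ length b"
proof -
  obtain i where i: "i \<le> length f" "\<sigma> = cyc (length f) ^^ i"
    using assms by (rule rotationsE)
  show ?thesis
    by (rule that[of "take (length f - i) f" "drop (length f - i) f"]) (use i in simp_all)
qed

lemma length_perm_forest [simp]: "length (perm_forest \<sigma> f) = length f"
  by (simp add: perm_forest_def del: upt_Suc)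

lemma nth_perm_forest:
  assumes "\<sigma> \<in> rotations (length f)" "j \<in> {1..length f}"
  shows "perm_forest \<sigma> f ! (\<sigma> j - 1) = f ! (j - 1)"
proof -
  have "\<sigma> j \<in> {1..length f}"
    using assms by (rule rotations_range)
  moreover have "inv_into {1..length f} \<sigma> (\<sigma> j) = j"
    using rotations_bij_betw[OF assms(1)] assms(2) by (intro inv_into_f_f) (auto simp: bij_betw_def)
  ultimately show ?thesis
    by (auto simp: perm_forest_def simp del: upt_Suc)
qed

lemma perm_forest_append:
  assumes "\<sigma> = cyc (length a + length b) ^^ length b"
  shows "perm_forest \<sigma> (a @ b) = b @ a"
proof (rule nth_equalityI)
  show "length (perm_forest \<sigma> (a @ b)) = length (b @ a)"
    by simp
next
  fix m assume "m < length (perm_forest \<sigma> (a @ b))"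
  then have m: "m < length a + length b" by simp
  define j where "j = (if m < length b then length a + m + 1 else m - length b + 1)"
  have j: "j \<in> {1..length (a @ b)}"
    using m by (auto simp: j_def)
  have "(length a + m + length b) mod (length a + length b) = m"
    using m mod_add_self2[of m "length a + length b"] by (simp add: add_ac)
  then have "\<sigma> j - 1 = m"
    using j m by (auto simp: assms cyc_funpow j_def)
  then have "perm_forest \<sigma> (a @ b) ! m = (a @ b) ! (j - 1)"
    using nth_perm_forest[of \<sigma> "a @ b" j] j assms by simp
  also have "\<dots> = (b @ a) ! m"
    using m by (auto simp: j_def nth_append)
  finally show "perm_forest \<sigma> (a @ b) ! m = (b @ a) ! m" .
qed

lemma first_leaf_1 [simp]: "first_leaf f (Suc 0) = Suc 0"
  by (simp add: first_leaf_def)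

lemma first_leaf_Suc:
  "\<lbrakk>1 \<le> j; j \<le> length f\<rbrakk> \<Longrightarrow> first_leaf f (Suc j) = first_leaf f j + size1 (f ! (j - 1))"
  by (cases j) (auto simp: first_leaf_def take_Suc_conv_app_nth)

lemma first_leaf_strict:
  assumes "1 \<le> i" "i < j" "j \<le> Suc (length f)"
  shows "first_leaf f i + size1 (f ! (i - 1)) \<le> first_leaf f j"
  using assms(2,3)
proof (induction j)
  case (Suc j)
  then show ?case
    using first_leaf_Suc[of j f] assms(1) by (cases "i = j") auto
qed simp

lemma first_leaf_less:
  "\<lbrakk>1 \<le> i; i < j; j \<le> Suc (length f)\<rbrakk> \<Longrightarrow> first_leaf f i < first_leaf f j"
  using first_leaf_strict[of i j f] size1_ge0[of "f ! (i - 1)"] by linarith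

lemma first_leaf_inj:
  "\<lbrakk>i \<in> {1..length f}; j \<in> {1..length f}; first_leaf f i = first_leaf f j\<rbrakk> \<Longrightarrow> i = j"
  using first_leaf_less[of i j f] first_leaf_less[of j i f] by (cases i j rule: linorder_cases) auto

lemma first_leaf_range: "j \<in> {1..length f} \<Longrightarrow> first_leaf f j \<in> {1..leaves f}"
  using first_leaf_less[of j "Suc (length f)" f] by (auto simp: first_leaf_def)

lemma first_leaf_append_left: "j \<le> Suc (length f) \<Longrightarrow> first_leaf (f @ g) j = first_leaf f j"
  by (simp add: first_leaf_def)

lemma first_leaf_append_right:
  "1 \<le> j \<Longrightarrow> first_leaf (f @ g) (length f + j) = leaves f + first_leaf g j"
  by (simp add: first_leaf_def)

text \<open>
  A leaf is determined by its tree and by its position in that tree; \<open>perm_leaves\<close> is defined in these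
  coordinates.
\<close>

lemma leaf_coordinates:
  assumes "l \<in> {1..leaves f}"
  obtains j k where "j \<in> {1..length f}" "k < size1 (f ! (j - 1))" "l = first_leaf f j + k"
  using assms
proof (induction f arbitrary: l thesis rule: rev_induct)
  case (snoc t f)
  show ?case
  proof (cases "l \<le> leaves f")
    case True
    then obtain j k where "j \<in> {1..length f}" "k < size1 (f ! (j - 1))" "l = first_leaf f j + k"
      using snoc.IH[of l] snoc.prems by auto
    then show ?thesis
      by (intro snoc.prems(1)[of j k]) (auto simp: nth_append first_leaf_append_left)
  next
    case False
    then show ?thesis
      using snoc.prems(2)
      by (intro snoc.prems(1)[of "Suc (length f)" "l - Suc (leaves f)"])
        (auto simp: first_leaf_def)
  qed
qed simp

lemma tree_of_leaf_eq:
  assumes "j \<in> {1..length f}" "k < size1 (f ! (j - 1))"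
  shows "tree_of_leaf f (first_leaf f j + k) = j"
  unfolding tree_of_leaf_def
proof (rule the_equality)
  show "j \<in> {1..length f} \<and> first_leaf f j + k \<in> {first_leaf f j..<first_leaf f j + size1 (f ! (j - 1))}"
    using assms by simp
next
  fix i assume i: "i \<in> {1..length f} \<and>
    first_leaf f j + k \<in> {first_leaf f i..<first_leaf f i + size1 (f ! (i - 1))}"
  show "i = j"
  proof (cases i j rule: linorder_cases)
    case less
    then show ?thesis using first_leaf_strict[of i j f] i assms by auto
  next
    case greater
    then show ?thesis using first_leaf_strict[of j i f] i assms by auto
  qed
qed

lemma leaf_in_range:
  assumes "j \<in> {1..length f}" "k < size1 (f ! (j - 1))"
  shows "first_leaf f j + k \<in> {1..leaves f}"
proof -
  have "first_leaf f j + size1 (f ! (j - 1)) \<le> first_leaf f (Suc (length f))"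
    using assms by (intro first_leaf_strict) auto
  then show ?thesis using assms by (auto simp: first_leaf_def)
qed

lemma perm_leaves_eq:
  assumes "j \<in> {1..length f}" "k < size1 (f ! (j - 1))"
  shows "perm_leaves \<sigma> f (first_leaf f j + k) = first_leaf (perm_forest \<sigma> f) (\<sigma> j) + k"
  using leaf_in_range[OF assms] tree_of_leaf_eq[OF assms] by (simp add: perm_leaves_def)

lemma perm_leaves_first_leaf:
  "j \<in> {1..length f} \<Longrightarrow> perm_leaves \<sigma> f (first_leaf f j) = first_leaf (perm_forest \<sigma> f) (\<sigma> j)"
  using perm_leaves_eq[of j f 0] by simp

text \<open>
  The exchange of the parts \<open>a\<close> and \<open>b\<close> moves the leaves of \<open>b\<close> in front of those of \<open>a\<close>.
  This is again a rotation, so rotations are stable under \<open>\<sigma> \<mapsto> \<sigma>\<^sup>f\<close>.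
\<close>

lemma perm_leaves_append:
  assumes "\<sigma> = cyc (length a + length b) ^^ length b"
  shows "perm_leaves \<sigma> (a @ b) = cyc (leaves a + leaves b) ^^ leaves b"
proof
  fix l
  show "perm_leaves \<sigma> (a @ b) l = (cyc (leaves a + leaves b) ^^ leaves b) l"
  proof (cases "l \<in> {1..leaves (a @ b)}")
    case True
    obtain j k where jk: "j \<in> {1..length (a @ b)}" "k < size1 ((a @ b) ! (j - 1))"
        "l = first_leaf (a @ b) j + k"
      using True by (rule leaf_coordinates)
    have *: "perm_leaves \<sigma> (a @ b) l = first_leaf (b @ a) (\<sigma> j) + k"
      unfolding jk(3) perm_leaves_eq[OF jk(1,2)] perm_forest_append[OF assms] ..
    show ?thesis
    proof (cases "j \<le> length a")
      case j: True
      have "first_leaf a j + k \<in> {1..leaves a}"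
        using jk j by (intro leaf_in_range) (auto simp: nth_append split: if_splits)
      moreover have "\<sigma> j = length b + j"
        using jk(1) j by (auto simp: assms cyc_funpow)
      ultimately show ?thesis
        using * jk j True
        by (auto simp: first_leaf_append_right first_leaf_append_left cyc_funpow)
    next
      case j: False
      have \<sigma>j: "\<sigma> j = j - length a"
      proof -
        have "j - 1 + length b = (j - length a - 1) + (length a + length b)"
          using j by simp
        moreover have "j - length a - 1 < length a + length b"
          using jk(1) j by auto
        ultimately have "(j - 1 + length b) mod (length a + length b) = j - length a - 1"
          by (simp only: mod_add_self2 mod_less)
        then show ?thesis
          using jk(1) j by (simp add: assms cyc_funpow)
      qed
      have b: "first_leaf b (j - length a) + k \<in> {1..leaves b}"
        using jk j by (intro leaf_in_range) (auto simp: nth_append split: if_splits)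
      have l: "l = leaves a + first_leaf b (j - length a) + k"
        using first_leaf_append_right[of "j - length a" a b] j jk by simp
      have "l - 1 + leaves b = (first_leaf b (j - length a) + k - 1) + (leaves a + leaves b)"
        using l b by simp
      moreover have "first_leaf b (j - length a) + k - 1 < leaves a + leaves b"
        using b by auto
      ultimately have "(l - 1 + leaves b) mod (leaves a + leaves b) = first_leaf b (j - length a) + k - 1"
        by (simp only: mod_add_self2 mod_less)
      moreover have "perm_leaves \<sigma> (a @ b) l = first_leaf b (j - length a) + k"
        using * \<sigma>j jk(1) j by (simp add: first_leaf_append_left)
      ultimately show ?thesis
        using True b by (simp add: cyc_funpow) linarith
    qed
  next
    case False
    then show ?thesis by (auto simp: perm_leaves_def cyc_funpow)
  qed
qed

lemma leaves_perm_forest [simp]: "\<sigma> \<in> rotations (length f) \<Longrightarrow> leaves (perm_forest \<sigma> f) = leaves f"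
  by (erule forest_rotationE) (simp add: perm_forest_append)

lemma perm_leaves_in_rotations: "\<sigma> \<in> rotations (length f) \<Longrightarrow> perm_leaves \<sigma> f \<in> rotations (leaves f)"
  by (erule forest_rotationE) (simp add: perm_leaves_append)

lemma perm_forest_id [simp]: "perm_forest id f = f"
  using perm_forest_append[where \<sigma> = id and a = f and b = "[]"] by simp

lemma perm_leaves_id [simp]: "perm_leaves id f = id"
  using perm_leaves_append[where \<sigma> = id and a = f and b = "[]"] by simp

text \<open>
  Rotating \<open>a @ b\<close> to \<open>b @ a = c @ d\<close> and then to \<open>d @ c\<close> is a single rotation. Either \<open>d\<close> is a final segment
  of \<open>a\<close>, or \<open>d\<close> contains \<open>a\<close> and the two rotations together make a full turn more than the result.
\<close>

lemma perm_comp: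
  assumes "\<sigma> \<in> rotations (length f)" "\<tau> \<in> rotations (length f)"
  shows perm_forest_comp: "perm_forest (\<sigma> \<circ> \<tau>) f = perm_forest \<sigma> (perm_forest \<tau> f)"
    and perm_leaves_comp: "perm_leaves (\<sigma> \<circ> \<tau>) f = perm_leaves \<sigma> (perm_forest \<tau> f) \<circ> perm_leaves \<tau> f"
proof -
  obtain a b where ab: "f = a @ b" "\<tau> = cyc (length f) ^^ length b"
    using assms(2) by (rule forest_rotationE)
  have \<tau>: "perm_forest \<tau> f = b @ a" "perm_leaves \<tau> f = cyc (leaves f) ^^ leaves b"
    using ab by (simp_all add: perm_forest_append perm_leaves_append)
  have ba: "length (b @ a) = length f"
    using ab(1) by simp
  obtain c d where cd: "b @ a = c @ d" "\<sigma> = cyc (length f) ^^ length d"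
    using forest_rotationE[of \<sigma> "b @ a", unfolded ba] assms(1) by blast
  have len: "length f = length c + length d" "leaves f = leaves c + leaves d"
    using arg_cong[OF cd(1), of length] arg_cong[OF cd(1), of leaves] ab by simp_all
  have \<sigma>: "perm_forest \<sigma> (b @ a) = d @ c" "perm_leaves \<sigma> (b @ a) = cyc (leaves f) ^^ leaves d"
    unfolding cd(1) using cd(2) len by (simp_all add: perm_forest_append perm_leaves_append)
  have comp: "\<sigma> \<circ> \<tau> = cyc (length f) ^^ (length d + length b)"
    unfolding cd ab(2) funpow_add ..
  have goal: "perm_forest (\<sigma> \<circ> \<tau>) f = d @ c \<and>
      perm_leaves (\<sigma> \<circ> \<tau>) f = cyc (leaves f) ^^ (leaves d + leaves b)"
  proof -
    from cd(1) consider e where "c = b @ e" "a = e @ d" | e where "b = c @ e" "d = e @ a"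
      by (auto simp: append_eq_append_conv2)
    then show ?thesis
    proof cases
      case 1
      then show ?thesis
        using perm_forest_append[where \<sigma> = "\<sigma> \<circ> \<tau>" and a = e and b = "d @ b"] perm_leaves_append[where \<sigma> = "\<sigma> \<circ> \<tau>" and a = e and b = "d @ b"]
          ab(1) comp by (simp add: add_ac)
    next
      case 2
      have "cyc (length f) ^^ (length d + length b) = cyc (length f) ^^ length e"
        using cyc_funpow_mod[where n = "length f" and i = "length d + length b"]
          cyc_funpow_mod[where n = "length f" and i = "length e"]
          2 ab(1) mod_add_self2[of "length e" "length f"] by (simp add: add_ac)
      moreover have "cyc (leaves f) ^^ (leaves d + leaves b) = cyc (leaves f) ^^ leaves e"
        using cyc_funpow_mod[where n = "leaves f" and i = "leaves d + leaves b"]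
          cyc_funpow_mod[where n = "leaves f" and i = "leaves e"]
          2 ab(1) mod_add_self2[of "leaves e" "leaves f"] by (simp add: add_ac)
      ultimately show ?thesis
        using 2 perm_forest_append[where \<sigma> = "\<sigma> \<circ> \<tau>" and a = "a @ c" and b = e] perm_leaves_append[where \<sigma> = "\<sigma> \<circ> \<tau>" and a = "a @ c" and b = e]
          ab(1) comp by (simp add: add_ac)
    qed
  qed
  show "perm_forest (\<sigma> \<circ> \<tau>) f = perm_forest \<sigma> (perm_forest \<tau> f)"
    using goal \<sigma> \<tau> by simp
  show "perm_leaves (\<sigma> \<circ> \<tau>) f = perm_leaves \<sigma> (perm_forest \<tau> f) \<circ> perm_leaves \<tau> f"
    using goal \<sigma> \<tau> by (simp add: funpow_add)
qed

text \<open>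
  Cutting \<open>v\<close> between two roots cuts the forest \<open>w\<close> stacked on it between the corresponding roots.
\<close>

lemma perm_stack:
  assumes "\<sigma> \<in> rotations (length v)" "length w = leaves v"
  shows perm_forest_stack:
      "perm_forest \<sigma> (stack v w) = stack (perm_forest \<sigma> v) (perm_forest (perm_leaves \<sigma> v) w)"
    and perm_leaves_stack: "perm_leaves \<sigma> (stack v w) = perm_leaves (perm_leaves \<sigma> v) w"
proof -
  obtain a b where ab: "v = a @ b" "\<sigma> = cyc (length v) ^^ length b"
    using assms(1) by (rule forest_rotationE)
  define c d where "c = take (leaves a) w" and "d = drop (leaves a) w"
  have cd: "w = c @ d" "length c = leaves a" "length d = leaves b"
    using assms(2) ab(1) by (simp_all add: c_def d_def)
  have vw: "stack v w = stack a c @ stack b d"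
    unfolding cd ab(1) using cd by (simp add: stack_append)
  have \<sigma>: "\<sigma> = cyc (length (stack a c) + length (stack b d)) ^^ length (stack b d)"
    using ab by simp
  have \<sigma>v: "perm_forest \<sigma> v = b @ a" "perm_leaves \<sigma> v = cyc (leaves v) ^^ leaves b"
    using ab by (simp_all add: perm_forest_append perm_leaves_append)
  then have \<sigma>v': "perm_leaves \<sigma> v = cyc (length c + length d) ^^ length d"
    using cd ab(1) by simp
  show "perm_forest \<sigma> (stack v w) = stack (perm_forest \<sigma> v) (perm_forest (perm_leaves \<sigma> v) w)"
    unfolding vw perm_forest_append[OF \<sigma>] \<sigma>v(1) unfolding cd(1) perm_forest_append[OF \<sigma>v']
    using cd by (simp add: stack_append)
  show "perm_leaves \<sigma> (stack v w) = perm_leaves (perm_leaves \<sigma> v) w"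
    unfolding vw perm_leaves_append[OF \<sigma>] unfolding cd(1) perm_leaves_append[OF \<sigma>v']
    using cd by simp
qed

lemma perm_Leaves:
  assumes "\<sigma> \<in> rotations n"
  shows "perm_forest \<sigma> (replicate n Leaf) = replicate n Leaf"
    and "perm_leaves \<sigma> (replicate n Leaf) = \<sigma>"
proof -
  obtain i where i: "i \<le> n" "\<sigma> = cyc n ^^ i"
    using assms by (rule rotationsE)
  have r: "replicate n Leaf = replicate (n - i) Leaf @ replicate i Leaf"
    using i by (simp flip: replicate_add)
  show "perm_forest \<sigma> (replicate n Leaf) = replicate n Leaf"
    unfolding r using i by (subst perm_forest_append) (simp_all flip: replicate_add)
  have r: "replicate n Leaf = replicate (n - i) Leaf @ replicate i Leaf"
    using i by (simp flip: replicate_add)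
  show "perm_leaves \<sigma> (replicate n Leaf) = \<sigma>"
    unfolding r using i by (subst perm_leaves_append) simp_all
qed

lemma leaves_take_if_sizes: "map size1 f = map size1 g \<Longrightarrow> leaves (take n f) = leaves (take n g)"
  unfolding leaves_def take_map[symmetric] by simp

lemma first_leaf_cong: "map size1 f = map size1 g \<Longrightarrow> first_leaf f j = first_leaf g j"
  unfolding first_leaf_def using leaves_take_if_sizes[of f g "j - 1"] by simp

lemma perm_leaves_cong:
  assumes "\<sigma> \<in> rotations (length f)" "map size1 f = map size1 g"
  shows "perm_leaves \<sigma> f = perm_leaves \<sigma> g"
proof -
  obtain a b where ab: "f = a @ b" "\<sigma> = cyc (length f) ^^ length b"
    using assms(1) by (rule forest_rotationE)
  define c d where "c = take (length a) g" and "d = drop (length a) g"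
  have "length f = length g"
    using arg_cong[OF assms(2), of length] by simp
  then have cd: "g = c @ d" "length c = length a" "length d = length b"
    using ab by (simp_all add: c_def d_def)
  have "map size1 c = map size1 a" "map size1 d = map size1 b"
    using assms(2) ab(1) cd by simp_all
  then have "leaves c = leaves a" "leaves d = leaves b"
    by (simp_all add: leaves_def)
  then show ?thesis
    using perm_leaves_append[where \<sigma> = \<sigma> and a = a and b = b]
      perm_leaves_append[where \<sigma> = \<sigma> and a = c and b = d] ab cd by simp
qed

lemma first_leaf_stack:
  assumes "length g = leaves f" "j \<in> {1..length f}"
  shows "first_leaf (stack f g) j = first_leaf g (first_leaf f j)"
proof -
  define a b where "a = take (j - 1) f" and "b = drop (j - 1) f"
  define c d where "c = take (leaves a) g" and "d = drop (leaves a) g"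
  have ab: "f = a @ b" "length a = j - 1"
    using assms(2) by (auto simp: a_def b_def min_def)
  have cd: "g = c @ d" "length c = leaves a"
    using assms(1) ab by (simp_all add: c_def d_def)
  have "stack f g = stack a c @ stack b d"
    unfolding ab(1) cd(1) using cd by (simp add: stack_append)
  then show ?thesis
    using ab cd by (simp add: first_leaf_def)
qed

lemma first_leaf_Leaves [simp]: "j \<in> {1..Suc n} \<Longrightarrow> first_leaf (replicate n Leaf) j = j"
  by (auto simp: first_leaf_def)

context skein
begin

lemma cl_perm_forest:
  assumes "\<sigma> \<in> rotations (length f)" "cl f = cl g"
  shows "cl (perm_forest \<sigma> f) = cl (perm_forest \<sigma> g)"
proof -
  obtain a b where ab: "f = a @ b" "\<sigma> = cyc (length f) ^^ length b"
    using assms(1) by (rule forest_rotationE)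
  define c d where "c = take (length a) g" and "d = drop (length a) g"
  have len: "length f = length g"
    using cl_eqD[OF assms(2)] by simp
  then have cd: "g = c @ d" "length c = length a" "length d = length b"
    using ab by (simp_all add: c_def d_def)
  have "cl a = cl c" "cl b = cl d"
    using assms(2) cd ab(1) unfolding cl_eq_iff by (simp_all add: list_all2_append)
  then have "cl (b @ a) = cl (d @ c)"
    by (intro cl_append_cong)
  moreover have "perm_forest \<sigma> f = b @ a" "perm_forest \<sigma> g = d @ c"
    using ab cd by (simp_all add: perm_forest_append)
  ultimately show ?thesis by simp
qed

end

section \<open>The Ore category with cyclic permutations\<close>

context skein
begin

lemma Arr_ForCT: "Arr (ForCT R) = {(cl f, \<sigma>) |f \<sigma>. \<sigma> \<in> rotations (leaves f)}"
  unfolding ForCT_def Arr_ForC by (auto simp: image_iff)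

lemma Arr_ForCT_iff [simp]: "(cl f, \<sigma>) \<in> Arr (ForCT R) \<longleftrightarrow> \<sigma> \<in> rotations (leaves f)"
  unfolding ForCT_def Arr_ForC by simp

lemma Src_ForCT [simp]: "Src (ForCT R) (cl f, \<sigma>) = length f"
  and Tgt_ForCT [simp]: "Tgt (ForCT R) (cl f, \<sigma>) = leaves f"
  and Idt_ForCT [simp]: "Idt (ForCT R) n = (cl (replicate n Leaf), id)"
  by (simp_all add: ForCT_def)

lemma cl_perm_forest_rep:
  assumes "\<sigma> \<in> rotations (length g)"
  shows "cl (perm_forest \<sigma> (forest_rep (cl g))) = cl (perm_forest \<sigma> g)"
    and "perm_leaves \<sigma> (forest_rep (cl g)) = perm_leaves \<sigma> g"
proof -
  have "cl (perm_forest \<sigma> g) = cl (perm_forest \<sigma> (forest_rep (cl g)))"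
    by (rule cl_perm_forest[OF assms]) simp
  then show "cl (perm_forest \<sigma> (forest_rep (cl g))) = cl (perm_forest \<sigma> g)" ..
  have "perm_leaves \<sigma> g = perm_leaves \<sigma> (forest_rep (cl g))"
    by (rule perm_leaves_cong[OF assms]) (simp add: cl_eqD(3)[OF cl_forest_rep])
  then show "perm_leaves \<sigma> (forest_rep (cl g)) = perm_leaves \<sigma> g" ..
qed

lemma Comp_ForCT [simp]:
  assumes "leaves f = length g" "\<sigma> \<in> rotations (leaves f)"
  shows "Comp (ForCT R) (cl f, \<sigma>) (cl g, \<tau>) =
    (cl (stack f (perm_forest \<sigma> g)), perm_leaves \<sigma> g \<circ> \<tau>)"
  using assms by (simp add: ForCT_def cl_perm_forest_rep)

end

locale ore_skein = skein R for R :: "('s tree \<times> 's tree) set" +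
  assumes ore_ForC: "ore_category (ForC R)"
begin

lemma forest_cancel:
  assumes "length g = leaves f" "length h = leaves f" "cl (stack f g) = cl (stack f h)"
  shows "cl g = cl h"
proof -
  have "Comp (ForC R) (cl f) (cl g) = Comp (ForC R) (cl f) (cl h)"
    using assms by simp
  then show ?thesis
    using ore_ForC assms unfolding ore_category_def left_cancellative_def Arr_ForC by auto
qed

lemma forest_ore_square:
  assumes "length f = length g"
  obtains p q where "length p = leaves f" "length q = leaves g"
    "cl (stack f p) = cl (stack g q)" "leaves p = leaves q"
proof -
  have "\<exists>p\<in>Arr (ForC R). \<exists>q\<in>Arr (ForC R). Src (ForC R) p = Tgt (ForC R) (cl f) \<and>
      Src (ForC R) q = Tgt (ForC R) (cl g) \<and> Comp (ForC R) (cl f) p = Comp (ForC R) (cl g) q"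
    using ore_ForC assms unfolding ore_category_def by (simp add: Arr_ForC)
  then obtain p q where pq: "length p = leaves f" "length q = leaves g"
      "cl (stack f p) = cl (stack g q)"
    by (auto simp: Arr_ForC)
  moreover have "leaves p = leaves q"
    using cl_eqD(2)[OF pq(3)] pq(1,2) by simp
  ultimately show ?thesis
    using that by blast
qed

lemma perm_forest_cancel:
  assumes "\<sigma> \<in> rotations (length f)" "length f = length g"
    "cl (perm_forest \<sigma> f) = cl (perm_forest \<sigma> g)"
  shows "cl f = cl g"
proof -
  obtain \<tau> where \<tau>: "\<tau> \<in> rotations (length f)" "\<tau> \<circ> \<sigma> = id"
    using assms(1) by (rule rotations_inverse)
  have "cl (perm_forest \<tau> (perm_forest \<sigma> f)) = cl (perm_forest \<tau> (perm_forest \<sigma> g))"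
    using \<tau>(1) assms(3) by - (rule cl_perm_forest, simp_all)
  then show ?thesis
    using perm_forest_comp[of \<tau> f \<sigma>] perm_forest_comp[of \<tau> g \<sigma>] \<tau> assms by simp
qed

lemma perm_forest_surj:
  assumes "\<sigma> \<in> rotations (length g)"
  obtains f where "length f = length g" "perm_forest \<sigma> f = g" "leaves f = leaves g"
proof -
  obtain \<tau> where \<tau>: "\<tau> \<in> rotations (length g)" "\<sigma> \<circ> \<tau> = id"
    using assms by (rule rotations_inverse)
  show ?thesis
    using that[of "perm_forest \<tau> g"] perm_forest_comp[of \<sigma> g \<tau>] \<tau> assms by simp
qed

lemma rotations_cancel:
  assumes "\<sigma> \<in> rotations n" "\<sigma> \<circ> \<tau> = \<sigma> \<circ> \<tau>'"
  shows "\<tau> = \<tau>'"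
proof -
  obtain \<upsilon> where "\<upsilon> \<circ> \<sigma> = id"
    using assms(1) by (rule rotations_inverse)
  then show ?thesis
    by (metis assms(2) comp_assoc id_comp)
qed

text \<open>
  Associativity is the pair of laws \<open>(v w)\<^sup>\<sigma> = v\<^sup>\<sigma> w\<^sup>\<tau>\<close> and \<open>\<sigma>\<^bsup>v w\<^esup> = \<tau>\<^sup>w\<close> for \<open>\<tau> = \<sigma>\<^sup>v\<close>, together with the
  compatibility with products of rotations. Cancellation and Ore squares are inherited from the forests, since
  \<open>f \<mapsto> f\<^sup>\<sigma>\<close> is a bijection and rotations are invertible.
\<close>

sublocale T: ore_cat "ForCT R"
proof (unfold_locales, goal_cases)
  case (1 x y)
  then obtain f \<sigma> g \<tau> where "x = (cl f, \<sigma>)" "y = (cl g, \<tau>)"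
      "\<sigma> \<in> rotations (leaves f)" "\<tau> \<in> rotations (leaves g)" "leaves f = length g"
    by (auto simp: Arr_ForCT)
  then show ?case
    by (simp add: perm_leaves_in_rotations rotations_comp)
next
  case (2 f g)
  then show ?case
    by (auto simp: Arr_ForCT)
next
  case (3 f g)
  then show ?case
    by (auto simp: Arr_ForCT)
next
  case (4 x y z)
  then obtain f \<sigma> g \<tau> h \<upsilon> where x: "x = (cl f, \<sigma>)" "y = (cl g, \<tau>)" "z = (cl h, \<upsilon>)"
      and \<sigma>: "\<sigma> \<in> rotations (leaves f)" "\<tau> \<in> rotations (leaves g)" "\<upsilon> \<in> rotations (leaves h)"
      and len: "leaves f = length g" "leaves g = length h"
    by (auto simp: Arr_ForCT)
  let ?\<sigma>g = "perm_leaves \<sigma> g"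
  have \<sigma>g: "?\<sigma>g \<in> rotations (length h)"
    using perm_leaves_in_rotations[of \<sigma> g] \<sigma> len by simp
  have "stack (stack f (perm_forest \<sigma> g)) (perm_forest (?\<sigma>g \<circ> \<tau>) h) =
      stack f (stack (perm_forest \<sigma> g) (perm_forest ?\<sigma>g (perm_forest \<tau> h)))"
    using \<sigma> \<sigma>g len by (simp add: stack_assoc perm_forest_comp)
  also have "\<dots> = stack f (perm_forest \<sigma> (stack g (perm_forest \<tau> h)))"
    using \<sigma> len by (simp add: perm_forest_stack)
  finally have 1: "stack (stack f (perm_forest \<sigma> g)) (perm_forest (?\<sigma>g \<circ> \<tau>) h) =
      stack f (perm_forest \<sigma> (stack g (perm_forest \<tau> h)))" .
  have 2: "perm_leaves (?\<sigma>g \<circ> \<tau>) h = perm_leaves \<sigma> (stack g (perm_forest \<tau> h)) \<circ> perm_leaves \<tau> h"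
    using \<sigma> \<sigma>g len by (simp add: perm_leaves_comp perm_leaves_stack)
  show ?case
    unfolding x using \<sigma> \<sigma>g len 1 2 by (simp add: rotations_comp o_assoc)
next
  case (5 n)
  then show ?case by simp
next
  case (6 n)
  then show ?case by simp
next
  case (7 n)
  then show ?case by simp
next
  case (8 x)
  then show ?case by (auto simp: Arr_ForCT stack_Leaves_left)
next
  case (9 x)
  then show ?case by (auto simp: Arr_ForCT perm_Leaves)
next
  case 10
  have "left_cancellative (ForCT R)"
    unfolding left_cancellative_def
  proof (intro ballI impI)
    fix x y z assume *: "x \<in> Arr (ForCT R)" "y \<in> Arr (ForCT R)" "z \<in> Arr (ForCT R)"
      "Tgt (ForCT R) x = Src (ForCT R) y" "Tgt (ForCT R) x = Src (ForCT R) z"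
      "Comp (ForCT R) x y = Comp (ForCT R) x z"
    then obtain f \<sigma> g \<tau> h \<upsilon> where x: "x = (cl f, \<sigma>)" "y = (cl g, \<tau>)" "z = (cl h, \<upsilon>)"
        and \<sigma>: "\<sigma> \<in> rotations (leaves f)" "\<tau> \<in> rotations (leaves g)" "\<upsilon> \<in> rotations (leaves h)"
        and len: "leaves f = length g" "leaves f = length h"
      by (auto simp: Arr_ForCT)
    have eq: "cl (stack f (perm_forest \<sigma> g)) = cl (stack f (perm_forest \<sigma> h))"
        "perm_leaves \<sigma> g \<circ> \<tau> = perm_leaves \<sigma> h \<circ> \<upsilon>"
      using *(6) \<sigma> len unfolding x by simp_all
    have "cl (perm_forest \<sigma> g) = cl (perm_forest \<sigma> h)"
      using eq(1) len by - (rule forest_cancel[where f = f], simp_all)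
    then have gh: "cl g = cl h"
      using \<sigma> len by - (rule perm_forest_cancel[where \<sigma> = \<sigma>], simp_all)
    then have "perm_leaves \<sigma> g = perm_leaves \<sigma> h"
      using cl_eqD(3)[OF gh] \<sigma> len by - (rule perm_leaves_cong, simp_all)
    moreover have "perm_leaves \<sigma> g \<in> rotations (leaves g)"
      using \<sigma> len by (simp add: perm_leaves_in_rotations)
    ultimately have "\<tau> = \<upsilon>"
      using rotations_cancel[of "perm_leaves \<sigma> g" "leaves g" \<tau> \<upsilon>] eq(2) by metis
    then show "y = z"
      using gh x by simp
  qed
  moreover have "\<exists>p\<in>Arr (ForCT R). \<exists>q\<in>Arr (ForCT R).
      Src (ForCT R) p = Tgt (ForCT R) x \<and> Src (ForCT R) q = Tgt (ForCT R) y \<and>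
      Comp (ForCT R) x p = Comp (ForCT R) y q"
    if xy: "x \<in> Arr (ForCT R)" "y \<in> Arr (ForCT R)" "Src (ForCT R) x = Src (ForCT R) y" for x y
  proof -
    obtain f \<sigma> g \<tau> where x: "x = (cl f, \<sigma>)" "y = (cl g, \<tau>)"
        and \<sigma>: "\<sigma> \<in> rotations (leaves f)" "\<tau> \<in> rotations (leaves g)" and len: "length f = length g"
      using xy by (auto simp: Arr_ForCT)
    obtain p' q' where pq': "length p' = leaves f" "length q' = leaves g"
        "cl (stack f p') = cl (stack g q')" "leaves p' = leaves q'"
      using len by (rule forest_ore_square)
    obtain p where p: "length p = length p'" "perm_forest \<sigma> p = p'" "leaves p = leaves p'"
      using \<sigma> pq' by (metis perm_forest_surj)
    obtain q where q: "length q = length q'" "perm_forest \<tau> q = q'" "leaves q = leaves q'"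
      using \<sigma> pq' by (metis perm_forest_surj)
    have "perm_leaves \<sigma> p \<in> rotations (leaves p)" "perm_leaves \<tau> q \<in> rotations (leaves q)"
      using perm_leaves_in_rotations[of \<sigma> p] perm_leaves_in_rotations[of \<tau> q] \<sigma> p(1) q(1) pq'(1,2)
      by simp_all
    then obtain \<sigma>' \<tau>' where \<sigma>': "\<sigma>' \<in> rotations (leaves p)" "perm_leaves \<sigma> p \<circ> \<sigma>' = id"
        "\<tau>' \<in> rotations (leaves q)" "perm_leaves \<tau> q \<circ> \<tau>' = id"
      by (metis rotations_inverse)
    show ?thesis
      unfolding x using \<sigma>' \<sigma> p q pq'
      by (intro bexI[of _ "(cl p, \<sigma>')"] bexI[of _ "(cl q, \<tau>')"]) simp_all
  qed
  ultimately show ?case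
    unfolding ore_category_def by blast
qed

abbreviation G :: "'s fracT monoid" where "G \<equiv> T_group R"

text \<open>
  Representing forests are used for the numerator and the denominator, so that equalities of fractions follow
  from rewriting with list identities; \<open>fr_ok\<close> says that the three parts fit together.
\<close>

abbreviation fr :: "'s forest \<Rightarrow> (nat \<Rightarrow> nat) \<Rightarrow> 's forest \<Rightarrow> 's fracT" where
  "fr s \<pi> t \<equiv> fracT R (cl s) \<pi> (cl t)"

definition fr_ok :: "'s forest \<Rightarrow> (nat \<Rightarrow> nat) \<Rightarrow> 's forest \<Rightarrow> bool" where
  "fr_ok s \<pi> t \<longleftrightarrow> length s = 1 \<and> length t = 1 \<and> leaves s = leaves t \<and> \<pi> \<in> rotations (leaves t)"

lemma fr_ok_pairs: "fr_ok s \<pi> t \<Longrightarrow> ((cl s, \<pi>), (cl t, id)) \<in> frac_pairs (ForCT R) 1"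
  by (simp add: fr_ok_def frac_pairs_def)

lemma group_G: "group G"
  unfolding T_group_def by (rule T.group_Frac)

lemma fr_ok_expand:
  "\<lbrakk>fr_ok s \<pi> t; length f = leaves t\<rbrakk>
    \<Longrightarrow> fr_ok (stack s (perm_forest \<pi> f)) (perm_leaves \<pi> f) (stack t f)"
  by (simp add: fr_ok_def perm_leaves_in_rotations)

lemma fr_expand:
  assumes "fr_ok s \<pi> t" "length f = leaves t"
  shows "fr (stack s (perm_forest \<pi> f)) (perm_leaves \<pi> f) (stack t f) = fr s \<pi> t"
  using T.fraction_expand[OF fr_ok_pairs[OF assms(1)], of "(cl f, id)"] assms
  by (simp add: fracT_def fr_ok_def)

lemma fr_in_carrier: "fr_ok s \<pi> t \<Longrightarrow> fr s \<pi> t \<in> carrier G"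
  unfolding fracT_def T_group_def by (rule T.fraction_in_carrier[OF fr_ok_pairs])

text \<open>
  Multiplying by \<open>\<rho>\<close> on the right changes \<open>s \<circ> \<pi> \<circ> t\<^sup>-\<^sup>1\<close> to \<open>(s \<circ> \<pi> \<circ> \<rho>) \<circ> (t \<circ> \<rho>)\<^sup>-\<^sup>1\<close>, whose
  denominator is the numerator of the second factor.
\<close>

lemma fr_mult:
  assumes "fr_ok s \<pi> t" "fr_ok t \<rho> u"
  shows "fr s \<pi> t \<otimes>\<^bsub>G\<^esub> fr t \<rho> u = fr s (\<pi> \<circ> \<rho>) u"
proof -
  let ?l = "replicate (leaves t) Leaf :: 's forest"
  have "fraction (ForCT R) 1 (Comp (ForCT R) (cl s, \<pi>) (cl ?l, \<rho>))
      (Comp (ForCT R) (cl t, id) (cl ?l, \<rho>)) = fr s \<pi> t"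
    unfolding fracT_def
    using assms by (intro T.fraction_expand fr_ok_pairs) (simp_all add: fr_ok_def)
  then have "fraction (ForCT R) 1 (cl s, \<pi> \<circ> \<rho>) (cl t, \<rho>) = fr s \<pi> t"
    using assms stack_Leaves_right[of s] by (simp add: fr_ok_def perm_Leaves)
  moreover have "((cl s, \<pi> \<circ> \<rho>), (cl t, \<rho>)) \<in> frac_pairs (ForCT R) 1"
    using assms by (simp add: fr_ok_def frac_pairs_def rotations_comp)
  ultimately show ?thesis
    using T.mult_Frac[of "(cl s, \<pi> \<circ> \<rho>)" "(cl t, \<rho>)" 1 "(cl u, id)"] fr_ok_pairs[OF assms(2)]
    by (simp add: fracT_def T_group_def)
qed

lemma fr_ok_comp: "\<lbrakk>fr_ok s \<pi> t; fr_ok t \<rho> u\<rbrakk> \<Longrightarrow> fr_ok s (\<pi> \<circ> \<rho>) u"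
  by (simp add: fr_ok_def rotations_comp)

lemma fr_one: "length t = 1 \<Longrightarrow> fr t id t = \<one>\<^bsub>G\<^esub>"
  unfolding fracT_def T_group_def by (intro T.fraction_self) (simp add: frac_pairs_def)

text \<open>
  A rotation in the denominator is moved to the numerator by expanding with its inverse.
\<close>

lemma carrier_GE:
  assumes "g \<in> carrier G"
  obtains s \<pi> t where "fr_ok s \<pi> t" "g = fr s \<pi> t"
proof -
  obtain x y where xy: "(x, y) \<in> frac_pairs (ForCT R) 1" "g = fraction (ForCT R) 1 x y"
    using assms unfolding T_group_def by (rule T.carrier_FracE)
  then obtain s \<sigma> t \<tau> where x: "x = (cl s, \<sigma>)" "y = (cl t, \<tau>)" "\<sigma> \<in> rotations (leaves s)"
      "\<tau> \<in> rotations (leaves t)" "length s = 1" "length t = 1" "leaves s = leaves t"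
    by (auto simp: frac_pairs_def Arr_ForCT)
  obtain \<tau>' where \<tau>': "\<tau>' \<in> rotations (leaves t)" "\<tau> \<circ> \<tau>' = id"
    using x(4) by (rule rotations_inverse)
  let ?l = "replicate (leaves t) Leaf :: 's forest"
  have "fraction (ForCT R) 1 (Comp (ForCT R) x (cl ?l, \<tau>')) (Comp (ForCT R) y (cl ?l, \<tau>')) = g"
    unfolding xy(2) using xy(1) x \<tau>' by (intro T.fraction_expand) simp_all
  moreover have "Comp (ForCT R) x (cl ?l, \<tau>') = (cl s, \<sigma> \<circ> \<tau>')" "Comp (ForCT R) y (cl ?l, \<tau>') = (cl t, id)"
    using x \<tau>' stack_Leaves_right[of s] by (simp_all add: perm_Leaves)
  ultimately show ?thesis
    using that[of s "\<sigma> \<circ> \<tau>'" t] x \<tau>' by (simp add: fr_ok_def fracT_def rotations_comp)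
qed

lemma fr_eq_iff:
  assumes "fr_ok s \<pi> t" "fr_ok s' \<pi>' t'"
  shows "fr s \<pi> t = fr s' \<pi>' t' \<longleftrightarrow>
    (\<exists>f f'. length f = leaves t \<and> length f' = leaves t' \<and> leaves f = leaves f' \<and>
       cl (stack s (perm_forest \<pi> f)) = cl (stack s' (perm_forest \<pi>' f')) \<and>
       cl (stack t f) = cl (stack t' f') \<and> perm_leaves \<pi> f = perm_leaves \<pi>' f')"
    (is "_ \<longleftrightarrow> ?rhs")
proof
  assume "fr s \<pi> t = fr s' \<pi>' t'"
  then obtain p q where pq: "p \<in> Arr (ForCT R)" "q \<in> Arr (ForCT R)"
      "Src (ForCT R) p = Tgt (ForCT R) (cl s, \<pi>)" "Src (ForCT R) q = Tgt (ForCT R) (cl s', \<pi>')"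
      "Tgt (ForCT R) p = Tgt (ForCT R) q"
      "Comp (ForCT R) (cl s, \<pi>) p = Comp (ForCT R) (cl s', \<pi>') q"
      "Comp (ForCT R) (cl t, id) p = Comp (ForCT R) (cl t', id) q"
    unfolding fracT_def T.fraction_eq_iff[OF fr_ok_pairs[OF assms(1)] fr_ok_pairs[OF assms(2)]] by blast
  then obtain f \<sigma> f' \<sigma>' where x: "p = (cl f, \<sigma>)" "q = (cl f', \<sigma>')" "\<sigma> \<in> rotations (leaves f)"
      "\<sigma>' \<in> rotations (leaves f')"
    by (auto simp: Arr_ForCT)
  have f: "length f = leaves t" "length f' = leaves t'" "leaves f = leaves f'"
    using pq(3-5) assms unfolding x by (simp_all add: fr_ok_def)
  have *: "cl (stack s (perm_forest \<pi> f)) = cl (stack s' (perm_forest \<pi>' f'))"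
      "perm_leaves \<pi> f \<circ> \<sigma> = perm_leaves \<pi>' f' \<circ> \<sigma>'"
    using pq(6) assms f unfolding x by (simp_all add: fr_ok_def)
  have **: "cl (stack t f) = cl (stack t' f')" "\<sigma> = \<sigma>'"
    using pq(7) assms f unfolding x by (simp_all add: fr_ok_def)
  obtain \<tau> where "\<sigma> \<circ> \<tau> = id"
    using x(3) by (rule rotations_inverse)
  then have "perm_leaves \<pi> f = perm_leaves \<pi>' f'"
    using *(2) **(2) by (metis comp_assoc comp_id)
  then show ?rhs
    using * ** f by blast
next
  assume ?rhs
  then obtain f f' where *: "length f = leaves t" "length f' = leaves t'"
       "cl (stack s (perm_forest \<pi> f)) = cl (stack s' (perm_forest \<pi>' f'))"
       "cl (stack t f) = cl (stack t' f')" "perm_leaves \<pi> f = perm_leaves \<pi>' f'"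
    by blast
  have "fr s \<pi> t = fr (stack s (perm_forest \<pi> f)) (perm_leaves \<pi> f) (stack t f)"
    using fr_expand[OF assms(1) *(1)] by simp
  also have "\<dots> = fr (stack s' (perm_forest \<pi>' f')) (perm_leaves \<pi>' f') (stack t' f')"
    unfolding * ..
  also have "\<dots> = fr s' \<pi>' t'"
    using fr_expand[OF assms(2) *(2)] by simp
  finally show "fr s \<pi> t = fr s' \<pi>' t'" .
qed

text \<open>
  An Ore square expands the denominator until it also extends \<open>u\<close>.
\<close>

lemma prescribe_denominator:
  assumes "g \<in> carrier G" "length u = 1"
  obtains s \<pi> f where "length f = leaves u" "fr_ok s \<pi> (stack u f)" "g = fr s \<pi> (stack u f)"
proof -
  obtain s \<pi> t where g: "fr_ok s \<pi> t" "g = fr s \<pi> t"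
    using assms(1) by (rule carrier_GE)
  obtain p q where pq: "length p = leaves t" "length q = leaves u" "cl (stack t p) = cl (stack u q)"
      "leaves p = leaves q"
    using forest_ore_square[of t u] g(1) assms(2) by (auto simp: fr_ok_def)
  show ?thesis
  proof (rule that)
    show "fr_ok (stack s (perm_forest \<pi> p)) (perm_leaves \<pi> p) (stack u q)"
      using fr_ok_expand[OF g(1) pq(1)] pq(1,2,4) assms(2) by (simp add: fr_ok_def)
    show "g = fr (stack s (perm_forest \<pi> p)) (perm_leaves \<pi> p) (stack u q)"
      using fr_expand[OF g(1) pq(1)] unfolding g(2) pq(3) by simp
  qed (rule pq)
qed

text \<open>
  For the numerator the expanding forest has to be rotated back, because \<open>\<pi>\<close> stands between it and \<open>t\<close>.
\<close>

lemma prescribe_numerator: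
  assumes "g \<in> carrier G" "length u = 1"
  obtains t \<pi> f where "length f = leaves u" "fr_ok (stack u f) \<pi> t" "g = fr (stack u f) \<pi> t"
proof -
  obtain s \<pi> t where g: "fr_ok s \<pi> t" "g = fr s \<pi> t"
    using assms(1) by (rule carrier_GE)
  obtain p' q where pq: "length p' = leaves s" "length q = leaves u" "cl (stack s p') = cl (stack u q)"
      "leaves p' = leaves q"
    using forest_ore_square[of s u] g(1) assms(2) by (auto simp: fr_ok_def)
  obtain p where p: "length p = length p'" "perm_forest \<pi> p = p'" "leaves p = leaves p'"
    using g(1) pq by (metis fr_ok_def perm_forest_surj)
  have lp: "length p = leaves t"
    using p pq g by (simp add: fr_ok_def)
  show ?thesis
  proof (rule that)
    show "fr_ok (stack u q) (perm_leaves \<pi> p) (stack t p)"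
      using fr_ok_expand[OF g(1) lp] pq(2,4) p(3) lp assms(2) by (simp add: fr_ok_def)
    show "g = fr (stack u q) (perm_leaves \<pi> p) (stack t p)"
      using fr_expand[OF g(1) lp] unfolding g(2) p(2) pq(3) by simp
  qed (rule pq)
qed

lemma composable_representatives:
  assumes "g \<in> carrier G" "h \<in> carrier G" "length u = 1"
  obtains s \<pi> t \<rho> f where "fr_ok s \<pi> t" "fr_ok t \<rho> (stack u f)" "length f = leaves u"
    "g = fr s \<pi> t" "h = fr t \<rho> (stack u f)"
proof -
  obtain t \<rho> f where h: "length f = leaves u" "fr_ok t \<rho> (stack u f)" "h = fr t \<rho> (stack u f)"
    using assms(2,3) by (rule prescribe_denominator)
  have "length t = 1"
    using h by (simp add: fr_ok_def)
  then obtain s \<pi> p' where g: "length p' = leaves t" "fr_ok s \<pi> (stack t p')" "g = fr s \<pi> (stack t p')"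
    using assms(1) prescribe_denominator by blast
  obtain p where p: "length p = length p'" "perm_forest \<rho> p = p'" "leaves p = leaves p'"
    using h(2) g by (metis fr_ok_def perm_forest_surj)
  have lp: "length p = leaves (stack u f)"
    using p g h by (simp add: fr_ok_def)
  have sa: "stack (stack u f) p = stack u (stack f p)"
    using h(1) lp by (simp add: stack_assoc)
  show ?thesis
  proof (rule that[of s \<pi> "stack t p'" "perm_leaves \<rho> p" "stack f p"])
    show "fr_ok (stack t p') (perm_leaves \<rho> p) (stack u (stack f p))"
      using fr_ok_expand[OF h(2) lp] p sa by simp
    show "h = fr (stack t p') (perm_leaves \<rho> p) (stack u (stack f p))"
      using fr_expand[OF h(2) lp] h(3) p sa by simp
    show "length (stack f p) = leaves u"
      using h by simp
  qed (use g in simp_all)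
qed

end

section \<open>The action on classes of leaves\<close>

context ore_skein
begin

abbreviation pt :: "'s forest \<Rightarrow> nat \<Rightarrow> ('s forest set \<times> nat) set" where
  "pt t j \<equiv> X_class R (cl t) j"

lemma X_pairs_iff: "(U, j) \<in> X_pairs R \<longleftrightarrow> (\<exists>t. U = cl t \<and> length t = 1 \<and> j \<in> {1..leaves t})"
  unfolding X_pairs_def skein_trees_def Arr_ForC by (auto 0 4)

lemma skein_trees_iff: "U \<in> skein_trees R n \<longleftrightarrow> (\<exists>t. U = cl t \<and> length t = 1 \<and> leaves t = n)"
  unfolding skein_trees_def Arr_ForC by auto

lemma first_leaf_cl: "cl f = cl g \<Longrightarrow> first_leaf f j = first_leaf g j"
  using cl_eqD(3) first_leaf_cong by blast

lemma cl_stack_stack_cong: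
  assumes "cl (stack t f) = cl (stack s g)" "length f = leaves t" "length g = leaves s"
    "length p = leaves f"
  shows "cl (stack t (stack f p)) = cl (stack s (stack g p))"
proof -
  have "leaves f = leaves g"
    using cl_eqD(2)[OF assms(1)] assms(2,3) by simp
  then have "cl (stack (stack t f) p) = cl (stack (stack s g) p)"
    using assms by - (rule cl_stack_cong, simp_all)
  then show ?thesis
    using stack_assoc[of f t p] stack_assoc[of g s p] assms \<open>leaves f = leaves g\<close> by simp
qed

text \<open>
  As for fractions, the generated equivalence is the existence of a common expansion, here of the two marked
  trees.
\<close>

definition same_point :: "'s forest set \<times> nat \<Rightarrow> 's forest set \<times> nat \<Rightarrow> bool" where
  "same_point u v \<longleftrightarrow> (\<exists>t j s i f g. u = (cl t, j) \<and> v = (cl s, i) \<and> length t = 1 \<and> length s = 1 \<and>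
     j \<in> {1..leaves t} \<and> i \<in> {1..leaves s} \<and> length f = leaves t \<and> length g = leaves s \<and>
     cl (stack t f) = cl (stack s g) \<and> first_leaf f j = first_leaf g i)"

lemma same_pointI:
  assumes "length t = 1" "length s = 1" "j \<in> {1..leaves t}" "i \<in> {1..leaves s}"
    "length f = leaves t" "length g = leaves s"
    "cl (stack t f) = cl (stack s g)" "first_leaf f j = first_leaf g i"
  shows "same_point (cl t, j) (cl s, i)"
  unfolding same_point_def using assms by blast

lemma same_point_refl:
  assumes "u \<in> X_pairs R"
  shows "same_point u u"
proof -
  obtain t j where t: "u = (cl t, j)" "length t = 1" "j \<in> {1..leaves t}"
    using assms by (cases u) (auto simp: X_pairs_iff)
  show ?thesis
    unfolding t(1)
    by (rule same_pointI[of t t j j "replicate (leaves t) Leaf" "replicate (leaves t) Leaf"])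
      (use t in simp_all)
qed

lemma same_point_sym: "same_point u v \<Longrightarrow> same_point v u"
  unfolding same_point_def by metis

lemma same_point_trans:
  assumes "same_point u v" "same_point v w"
  shows "same_point u w"
proof -
  obtain t j s i f g where 1: "u = (cl t, j)" "v = (cl s, i)" "length t = 1" "length s = 1"
     "j \<in> {1..leaves t}" "i \<in> {1..leaves s}" "length f = leaves t" "length g = leaves s"
     "cl (stack t f) = cl (stack s g)" "first_leaf f j = first_leaf g i"
    using assms(1) unfolding same_point_def by blast
  obtain s' r l f' g' where 2: "v = (cl s', i)" "w = (cl r, l)" "length s' = 1" "length r = 1"
     "i \<in> {1..leaves s'}" "l \<in> {1..leaves r}" "length f' = leaves s'" "length g' = leaves r"
     "cl (stack s' f') = cl (stack r g')" "first_leaf f' i = first_leaf g' l"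
    using assms(2) 1(2) unfolding same_point_def by auto
  have s: "cl s = cl s'" "leaves s = leaves s'"
    using 1(2) 2(1) cl_eqD(2)[of s s'] by simp_all
  obtain p q where pq: "length p = leaves g" "length q = leaves f'"
      "cl (stack g p) = cl (stack f' q)" "leaves p = leaves q"
    using forest_ore_square[of g f'] 1(8) 2(7) s(2) by auto
  have lp: "length p = leaves f"
    using cl_eqD(2)[OF 1(9)] 1(7,8) pq(1) by simp
  have lq: "length q = leaves g'"
    using cl_eqD(2)[OF 2(9)] 2(7,8) pq(2) by simp
  have "cl (stack t (stack f p)) = cl (stack s (stack g p))"
    using 1(9,7,8) lp by (rule cl_stack_stack_cong)
  also have "\<dots> = cl (stack s' (stack f' q))"
    using s(1) pq(3) by (rule cl_stack_cong) (simp add: 1(8))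
  also have "\<dots> = cl (stack r (stack g' q))"
    using 2(9,7,8) pq(2) by (rule cl_stack_stack_cong)
  finally have c: "cl (stack t (stack f p)) = cl (stack r (stack g' q))" .
  have "first_leaf (stack f p) j = first_leaf p (first_leaf f j)"
    using lp 1(5,7) by (simp add: first_leaf_stack)
  also have "\<dots> = first_leaf (stack g p) i"
    using pq(1) 1(6,8,10) by (simp add: first_leaf_stack)
  also have "\<dots> = first_leaf (stack f' q) i"
    using pq(3) by (rule first_leaf_cl)
  also have "\<dots> = first_leaf q (first_leaf g' l)"
    using pq(2) 2(5,7,10) by (simp add: first_leaf_stack)
  also have "\<dots> = first_leaf (stack g' q) l"
    using lq 2(6,8) by (simp add: first_leaf_stack)
  finally have "first_leaf (stack f p) j = first_leaf (stack g' q) l" .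
  with c show ?thesis
    unfolding 1(1) 2(2) using 1 2 by (intro same_pointI[of t r j l "stack f p" "stack g' q"]) simp_all
qed

lemma X_stepE:
  assumes "X_step R u v"
  obtains t j f where "u = (cl t, j)" "v = (cl (stack t f), first_leaf f j)" "length t = 1"
    "j \<in> {1..leaves t}" "length f = leaves t"
proof -
  obtain t j where t: "u = (cl t, j)" "length t = 1" "j \<in> {1..leaves t}"
    using assms unfolding X_step_def by (cases u) (auto simp: X_pairs_iff)
  obtain f where f: "length f = leaves t"
      "v = (Comp (ForC R) (cl t) (cl f), first_leaf (forest_rep (cl f)) j)"
    using assms unfolding X_step_def t Arr_ForC by auto
  have "v = (cl (stack t f), first_leaf f j)"
    using f first_leaf_cl[OF cl_forest_rep] by simp
  then show ?thesis
    using that t f by blast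
qed

lemma X_step_expand:
  assumes "length t = 1" "j \<in> {1..leaves t}" "length f = leaves t"
  shows "X_step R (cl t, j) (cl (stack t f), first_leaf f j)"
  unfolding X_step_def using assms first_leaf_cl[OF cl_forest_rep]
  by (auto simp: X_pairs_iff Arr_ForC)

lemma X_step_same_point: "X_step R u v \<Longrightarrow> same_point u v"
proof (erule X_stepE)
  fix t j f
  assume *: "u = (cl t, j)" "v = (cl (stack t f), first_leaf f j)" "length t = 1"
    "j \<in> {1..leaves t}" "length f = leaves t"
  have fl: "first_leaf f j \<in> {1..leaves f}"
    using *(4,5) first_leaf_range[of j f] by simp
  have "stack (stack t f) (replicate (leaves f) Leaf) = stack t f"
    using *(5) stack_Leaves_right[of "stack t f"] by simp
  then show "same_point u v"
    unfolding *(1,2) using * fl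
    by (intro same_pointI[of t "stack t f" j "first_leaf f j" f "replicate (leaves f) Leaf"]) simp_all
qed

lemma equivclp_X_step:
  assumes "u \<in> X_pairs R" "equivclp (X_step R) u v"
  shows "same_point u v"
  using assms(2)
proof (induction rule: equivclp_induct)
  case base
  show ?case using assms(1) by (rule same_point_refl)
next
  case (step y z)
  then show ?case
    using X_step_same_point same_point_sym same_point_trans by blast
qed

lemma pt_eq_iff_equivclp: "pt t j = pt s i \<longleftrightarrow> equivclp (X_step R) (cl t, j) (cl s, i)"
  unfolding X_class_def set_eq_iff mem_Collect_eq
  by (meson equivclp_refl equivclp_sym equivclp_trans)

lemma pt_expand:
  assumes "length t = 1" "j \<in> {1..leaves t}" "length f = leaves t"
  shows "pt (stack t f) (first_leaf f j) = pt t j"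
  unfolding pt_eq_iff_equivclp using X_step_expand[OF assms] by (rule converse_r_into_equivclp)

text \<open>
  Two expansions of \<open>t\<close> to the same tree are by the same forest, and first leaves of different trees of
  that forest differ.
\<close>

lemma pt_inj:
  assumes "length t = 1" "j \<in> {1..leaves t}" "i \<in> {1..leaves t}" "pt t j = pt t i"
  shows "j = i"
proof -
  have "same_point (cl t, j) (cl t, i)"
    using assms by (intro equivclp_X_step) (auto simp: X_pairs_iff pt_eq_iff_equivclp)
  then obtain t' s f g where *: "cl t = cl t'" "cl t = cl s" "length f = leaves t'" "length g = leaves s"
     "cl (stack t' f) = cl (stack s g)" "first_leaf f j = first_leaf g i"
    unfolding same_point_def by auto
  have l: "length f = leaves t" "length g = leaves t"
    using * cl_eqD(2)[OF *(1)] cl_eqD(2)[OF *(2)] by simp_all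
  have "cl (stack t f) = cl (stack t' f)" "cl (stack t g) = cl (stack s g)"
    using cl_stack_cong[OF *(1), of f f] cl_stack_cong[OF *(2), of g g] l by simp_all
  then have "cl (stack t f) = cl (stack t g)"
    using *(5) by simp
  with l have "cl f = cl g"
    by (rule forest_cancel)
  then have "first_leaf f j = first_leaf f i"
    using *(6) first_leaf_cl[of f g i] by simp
  then show ?thesis
    using assms l by - (rule first_leaf_inj[of j f i], simp_all)
qed

lemma inj_on_pt: "length t = 1 \<Longrightarrow> inj_on (pt t) {1..leaves t}"
  using pt_inj by (intro inj_onI) blast

lemma X_set_eq: "X_set R = {pt t j |t j. length t = 1 \<and> j \<in> {1..leaves t}}"
  unfolding X_set_def X_pairs_iff by auto

lemma pt_in_X_set: "\<lbrakk>length t = 1; j \<in> {1..leaves t}\<rbrakk> \<Longrightarrow> pt t j \<in> X_set R"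
  unfolding X_set_eq by blast

lemma X_set_refine:
  assumes "x \<in> X_set R" "length u = 1"
  obtains f j where "length f = leaves u" "j \<in> {1..leaves f}" "x = pt (stack u f) j"
proof -
  obtain t i where t: "length t = 1" "i \<in> {1..leaves t}" "x = pt t i"
    using assms(1) unfolding X_set_eq by blast
  obtain p q where pq: "length p = leaves t" "length q = leaves u" "cl (stack t p) = cl (stack u q)"
      "leaves p = leaves q"
    using forest_ore_square[of t u] t assms by auto
  have "x = pt (stack u q) (first_leaf p i)"
    using pt_expand[OF t(1,2) pq(1)] unfolding t(3) pq(3) by simp
  moreover have "first_leaf p i \<in> {1..leaves q}"
    using first_leaf_range[of i p] t pq by simp
  ultimately show ?thesis
    using that pq by blast
qed

text \<open>
  Over a common expansion of the two fractions the marked leaves of the denominators coincide by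
  \<open>pt_inj\<close>, hence so do their images in the numerators.
\<close>

lemma fr_point_well_defined:
  assumes ok: "fr_ok s \<pi> t" "fr_ok s' \<pi>' t'"
    and j: "j \<in> {1..leaves t}" "j' \<in> {1..leaves t'}"
    and eq: "fr s \<pi> t = fr s' \<pi>' t'" "pt t j = pt t' j'"
  shows "pt s (\<pi> j) = pt s' (\<pi>' j')"
proof -
  obtain f f' where f: "length f = leaves t" "length f' = leaves t'" "leaves f = leaves f'"
       "cl (stack s (perm_forest \<pi> f)) = cl (stack s' (perm_forest \<pi>' f'))"
       "cl (stack t f) = cl (stack t' f')" "perm_leaves \<pi> f = perm_leaves \<pi>' f'"
    using eq(1) unfolding fr_eq_iff[OF ok] by blast
  have "pt (stack t f) (first_leaf f j) = pt (stack t f) (first_leaf f' j')"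
    using pt_expand[of t j f] pt_expand[of t' j' f'] eq(2) f j ok by (simp add: fr_ok_def)
  then have fl: "first_leaf f j = first_leaf f' j'"
    using first_leaf_range[of j f] first_leaf_range[of j' f'] j f(1-3) ok
    by - (rule pt_inj[of "stack t f"], simp_all add: fr_ok_def)
  have e: "pt (stack s (perm_forest \<pi> f)) (perm_leaves \<pi> f (first_leaf f j)) = pt s (\<pi> j)"
    if "fr_ok s \<pi> t" "j \<in> {1..leaves t}" "length f = leaves t" for s \<pi> t j and f :: "'s forest"
  proof -
    have "perm_leaves \<pi> f (first_leaf f j) = first_leaf (perm_forest \<pi> f) (\<pi> j)"
      using that by (intro perm_leaves_first_leaf) simp
    moreover have "\<pi> j \<in> {1..leaves s}"
      using that rotations_range[of \<pi> "leaves t" j] by (simp add: fr_ok_def)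
    ultimately show ?thesis
      using pt_expand[of s "\<pi> j" "perm_forest \<pi> f"] that by (simp add: fr_ok_def)
  qed
  have "pt s (\<pi> j) = pt (stack s (perm_forest \<pi> f)) (perm_leaves \<pi> f (first_leaf f j))"
    using e[OF ok(1) j(1) f(1)] by simp
  also have "\<dots> = pt (stack s' (perm_forest \<pi>' f')) (perm_leaves \<pi>' f' (first_leaf f' j'))"
    unfolding f(4,6) fl ..
  also have "\<dots> = pt s' (\<pi>' j')"
    using e[OF ok(2) j(2) f(2)] .
  finally show ?thesis .
qed

lemma alpha_fr:
  assumes "fr_ok s \<pi> t" "j \<in> {1..leaves t}"
  shows "alpha R (fr s \<pi> t) (pt t j) = pt s (\<pi> j)"
proof -
  have "(THE y. \<exists>n s' \<pi>' t' j'.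
        s' \<in> skein_trees R n \<and> t' \<in> skein_trees R n \<and> \<pi>' \<in> rotations n \<and> j' \<in> {1..n} \<and>
        fr s \<pi> t = fracT R s' \<pi>' t' \<and> pt t j = X_class R t' j' \<and> y = X_class R s' (\<pi>' j')) =
      pt s (\<pi> j)" (is "The ?P = _")
  proof (rule the_equality)
    have "cl s \<in> skein_trees R (leaves t)" "cl t \<in> skein_trees R (leaves t)" "\<pi> \<in> rotations (leaves t)"
      using assms by (auto simp: skein_trees_iff fr_ok_def)
    then show "?P (pt s (\<pi> j))"
      using assms(2) by blast
  next
    fix y assume "?P y"
    then obtain n U \<pi>' V j' where *: "U \<in> skein_trees R n" "V \<in> skein_trees R n"
        "\<pi>' \<in> rotations n" "j' \<in> {1..n}" "fr s \<pi> t = fracT R U \<pi>' V" "pt t j = X_class R V j'"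
        "y = X_class R U (\<pi>' j')"
      by blast
    then obtain s' t' where st: "U = cl s'" "V = cl t'" "length s' = 1" "length t' = 1" "leaves s' = n"
        "leaves t' = n"
      unfolding skein_trees_iff by blast
    then have "fr_ok s' \<pi>' t'"
      using * by (simp add: fr_ok_def)
    then show "y = pt s (\<pi> j)"
      using fr_point_well_defined[OF assms(1) _ assms(2), of s' \<pi>' t' j'] * st by simp
  qed
  moreover have "pt t j \<in> X_set R"
    using assms by (intro pt_in_X_set) (simp_all add: fr_ok_def)
  ultimately show ?thesis
    unfolding alpha_def by simp
qed

lemma action_representatives:
  assumes "g \<in> carrier G" "x \<in> X_set R"
  obtains s \<pi> t j where "fr_ok s \<pi> t" "j \<in> {1..leaves t}" "g = fr s \<pi> t" "x = pt t j"
proof -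
  obtain u i where u: "length u = 1" "i \<in> {1..leaves u}" "x = pt u i"
    using assms(2) unfolding X_set_eq by blast
  obtain s \<pi> f where f: "length f = leaves u" "fr_ok s \<pi> (stack u f)" "g = fr s \<pi> (stack u f)"
    using assms(1) u(1) by (rule prescribe_denominator)
  show ?thesis
  proof (rule that)
    show "first_leaf f i \<in> {1..leaves (stack u f)}"
      using first_leaf_range[of i f] u f by simp
    show "x = pt (stack u f) (first_leaf f i)"
      using pt_expand[OF u(1,2) f(1)] u(3) by simp
  qed (fact f)+
qed

lemma alpha_closed:
  assumes "g \<in> carrier G" "x \<in> X_set R"
  shows "alpha R g x \<in> X_set R"
proof -
  obtain s \<pi> t j where *: "fr_ok s \<pi> t" "j \<in> {1..leaves t}" "g = fr s \<pi> t" "x = pt t j"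
    using assms by (rule action_representatives)
  moreover have "\<pi> j \<in> {1..leaves s}"
    using * rotations_range[of \<pi> "leaves t" j] by (simp add: fr_ok_def)
  ultimately show ?thesis
    using alpha_fr[OF *(1,2)] by (auto intro!: pt_in_X_set simp: fr_ok_def)
qed

lemma alpha_one:
  assumes "x \<in> X_set R"
  shows "alpha R \<one>\<^bsub>G\<^esub> x = x"
proof -
  obtain t j where t: "length t = 1" "j \<in> {1..leaves t}" "x = pt t j"
    using assms unfolding X_set_eq by blast
  then show ?thesis
    using alpha_fr[of t id t j] fr_one[of t] by (simp add: fr_ok_def)
qed

text \<open>
  Both fractions are written with a common middle tree \<open>t\<close>, over a denominator that also carries \<open>x\<close>.
\<close>

lemma alpha_mult:
  assumes "g \<in> carrier G" "h \<in> carrier G" "x \<in> X_set R"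
  shows "alpha R (g \<otimes>\<^bsub>G\<^esub> h) x = alpha R g (alpha R h x)"
proof -
  obtain u i where u: "length u = 1" "i \<in> {1..leaves u}" "x = pt u i"
    using assms(3) unfolding X_set_eq by blast
  obtain s \<pi> t \<rho> f where f: "fr_ok s \<pi> t" "fr_ok t \<rho> (stack u f)" "length f = leaves u"
    "g = fr s \<pi> t" "h = fr t \<rho> (stack u f)"
    using assms(1,2) u(1) by (rule composable_representatives)
  let ?j = "first_leaf f i"
  have x: "x = pt (stack u f) ?j"
    using pt_expand[OF u(1,2) f(3)] u(3) by simp
  have j: "?j \<in> {1..leaves (stack u f)}"
    using first_leaf_range[of i f] u f by simp
  then have "\<rho> ?j \<in> {1..leaves t}"
    using f(2) rotations_range[of \<rho> "leaves (stack u f)" ?j] by (simp add: fr_ok_def)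
  then have "alpha R g (alpha R h x) = pt s (\<pi> (\<rho> ?j))"
    unfolding f(4,5) x alpha_fr[OF f(2) j] using alpha_fr[OF f(1)] by simp
  also have "\<dots> = alpha R (fr s (\<pi> \<circ> \<rho>) (stack u f)) x"
    unfolding x using alpha_fr[OF fr_ok_comp[OF f(1,2)] j] by simp
  also have "fr s (\<pi> \<circ> \<rho>) (stack u f) = g \<otimes>\<^bsub>G\<^esub> h"
    using fr_mult[OF f(1,2)] f(4,5) by simp
  finally show ?thesis by simp
qed

lemma alpha_inverse:
  assumes "g \<in> carrier G" "x \<in> X_set R"
  shows "alpha R (inv\<^bsub>G\<^esub> g) (alpha R g x) = x" "alpha R g (alpha R (inv\<^bsub>G\<^esub> g) x) = x"
proof -
  interpret group G by (rule group_G)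
  show "alpha R (inv\<^bsub>G\<^esub> g) (alpha R g x) = x"
    using alpha_mult[of "inv\<^bsub>G\<^esub> g" g x] assms alpha_one by simp
  show "alpha R g (alpha R (inv\<^bsub>G\<^esub> g) x) = x"
    using alpha_mult[of g "inv\<^bsub>G\<^esub> g" x] assms alpha_one by simp
qed

text \<open>
  A new point is brought over an expansion of the tree that carries the previous ones.
\<close>

lemma finite_subset_of_X:
  assumes "finite A" "A \<subseteq> X_set R"
  obtains t J where "length t = 1" "J \<subseteq> {1..leaves t}" "A = pt t ` J"
  using assms
proof (induction A arbitrary: thesis)
  case empty
  show ?case
    by (rule empty(1)[of "[Leaf]" "{}"]) simp_all
next
  case (insert x A)
  obtain t J where t: "length t = 1" "J \<subseteq> {1..leaves t}" "A = pt t ` J"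
    using insert.IH insert.prems(2) by blast
  obtain f j where f: "length f = leaves t" "j \<in> {1..leaves f}" "x = pt (stack t f) j"
    using X_set_refine[of x t] insert.prems(2) t(1) by blast
  have "pt t i = pt (stack t f) (first_leaf f i)" if "i \<in> J" for i
    using pt_expand[of t i f] t f that by auto
  then have "A = pt (stack t f) ` first_leaf f ` J"
    unfolding t(3) by (force simp: image_image)
  moreover have "first_leaf f ` J \<subseteq> {1..leaves f}"
    using first_leaf_range[of _ f] t(2) f(1) by auto
  ultimately show ?case
    using t f by (intro insert.prems(1)[of "stack t f" "insert j (first_leaf f ` J)"]) simp_all
qed

end

lemma group_actionI:
  assumes "group G"
    and ext: "\<And>g. g \<in> carrier G \<Longrightarrow> \<phi> g \<in> extensional E"
    and closed: "\<And>g x. \<lbrakk>g \<in> carrier G; x \<in> E\<rbrakk> \<Longrightarrow> \<phi> g x \<in> E"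
    and one: "\<And>x. x \<in> E \<Longrightarrow> \<phi> \<one>\<^bsub>G\<^esub> x = x"
    and mult: "\<And>g h x. \<lbrakk>g \<in> carrier G; h \<in> carrier G; x \<in> E\<rbrakk> \<Longrightarrow> \<phi> (g \<otimes>\<^bsub>G\<^esub> h) x = \<phi> g (\<phi> h x)"
  shows "group_action G E \<phi>"
proof -
  interpret group G by fact
  have bij: "\<phi> g \<in> Bij E" if g: "g \<in> carrier G" for g
  proof -
    have "bij_betw (\<phi> g) E E"
    proof (rule bij_betw_byWitness[where f' = "\<phi> (inv\<^bsub>G\<^esub> g)"])
      show "\<forall>x\<in>E. \<phi> (inv\<^bsub>G\<^esub> g) (\<phi> g x) = x" "\<forall>x\<in>E. \<phi> g (\<phi> (inv\<^bsub>G\<^esub> g) x) = x"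
        using g one by (simp_all flip: mult)
      show "\<phi> g ` E \<subseteq> E" "\<phi> (inv\<^bsub>G\<^esub> g) ` E \<subseteq> E"
        using g closed by auto
    qed
    then show ?thesis using ext g by (simp add: Bij_def)
  qed
  have "\<phi> \<in> hom G (BijGroup E)"
  proof (rule homI)
    fix g h assume gh: "g \<in> carrier G" "h \<in> carrier G"
    have "\<phi> (g \<otimes>\<^bsub>G\<^esub> h) = compose E (\<phi> g) (\<phi> h)"
      by (rule extensionalityI[of _ E]) (use gh ext mult in \<open>auto simp: compose_def\<close>)
    then show "\<phi> (g \<otimes>\<^bsub>G\<^esub> h) = \<phi> g \<otimes>\<^bsub>BijGroup E\<^esub> \<phi> h"
      using gh bij by (simp add: BijGroup_def)
  qed (simp add: BijGroup_def bij)
  then show ?thesis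
    unfolding group_action_def group_hom_def group_hom_axioms_def
    using group_BijGroup \<open>group G\<close> by blast
qed

lemma (in ore_skein) alpha_sub_group_action:
  "group_action G (X_sub R k) (alpha_sub R k)"
proof (rule group_actionI[OF group_G])
  fix g A assume *: "g \<in> carrier G" "A \<in> X_sub R k"
  then have A: "A \<subseteq> X_set R" "finite A" "card A = k"
    by (simp_all add: X_sub_def)
  have "inj_on (alpha R g) A"
    using alpha_inverse(1)[OF *(1)] A(1) by (metis inj_onI subsetD)
  then show "alpha_sub R k g A \<in> X_sub R k"
    using alpha_closed[OF *(1)] A *(2) by (auto simp: alpha_sub_def X_sub_def card_image)
next
  fix A assume *: "A \<in> X_sub R k"
  then have "alpha R \<one>\<^bsub>G\<^esub> ` A = A"
    using alpha_one by (force simp: X_sub_def)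
  then show "alpha_sub R k \<one>\<^bsub>G\<^esub> A = A"
    using * by (simp add: alpha_sub_def)
next
  fix g h A assume *: "g \<in> carrier G" "h \<in> carrier G" "A \<in> X_sub R k"
  have A: "A \<subseteq> X_set R" "finite A" "card A = k"
    using * by (simp_all add: X_sub_def)
  have "inj_on (alpha R h) A"
    using alpha_inverse(1)[OF *(2)] A(1) by (metis inj_onI subsetD)
  then have "alpha R h ` A \<in> X_sub R k"
    using alpha_closed[OF *(2)] A by (auto simp: X_sub_def card_image)
  moreover have "alpha R (g \<otimes>\<^bsub>G\<^esub> h) ` A = alpha R g ` alpha R h ` A"
    using alpha_mult[OF *(1,2)] A(1) by (force simp: image_image)
  ultimately show "alpha_sub R k (g \<otimes>\<^bsub>G\<^esub> h) A = alpha_sub R k g (alpha_sub R k h A)"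
    using *(3) by (simp add: alpha_sub_def)
qed (simp add: alpha_sub_def)

section \<open>Transitivity and conjugation\<close>

lemma obtain_tree_with_leaves:
  assumes "1 \<le> k"
  obtains t :: "'s forest" where "length t = 1" "leaves t = k"
proof -
  have "\<exists>u :: 's tree. size1 u = Suc m" for m
  proof (induction m)
    case 0
    have "size1 (Leaf :: 's tree) = Suc 0" by simp
    then show ?case by blast
  next
    case (Suc m)
    then obtain u :: "'s tree" where "size1 u = Suc m" by blast
    then have "size1 (Node Leaf undefined u) = Suc (Suc m)" by simp
    then show ?case by blast
  qed
  then obtain u :: "'s tree" where "size1 u = Suc (k - 1)" by blast
  then show ?thesis
    using that[of "[u]"] assms by simp
qed

text \<open>
  Leaves are added from left to right: a number in \<open>J\<close> starts a new tree, a number outside \<open>J\<close> enlarges the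
  last tree by one leaf, which leaves its first leaf in place.
\<close>

lemma forest_with_first_leaves:
  assumes "J \<subseteq> {1..Suc m}" "1 \<in> J"
  shows "\<exists>h :: 's forest. length h = card J \<and> leaves h = Suc m \<and> first_leaf h ` {1..card J} = J"
  using assms
proof (induction m arbitrary: J)
  case 0
  then have "J = {1}" by auto
  then show ?case
    by (intro exI[of _ "[Leaf]"]) simp
next
  case (Suc m)
  have fin: "finite J"
    using Suc.prems(1) finite_subset by blast
  show ?case
  proof (cases "Suc (Suc m) \<in> J")
    case True
    let ?J = "J - {Suc (Suc m)}"
    have "?J \<subseteq> {1..Suc m}"
    proof
      fix x assume x: "x \<in> ?J"
      then have "x \<in> {1..Suc (Suc m)}" using Suc.prems(1) by blast
      then show "x \<in> {1..Suc m}" using x by auto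
    qed
    moreover have "1 \<in> ?J"
      using Suc.prems(2) by simp
    ultimately obtain h :: "'s forest" where h: "length h = card ?J" "leaves h = Suc m"
        "first_leaf h ` {1..card ?J} = ?J"
      using Suc.IH by blast
    have c: "card J = Suc (card ?J)"
      using fin True by (rule card.remove)
    have "first_leaf (h @ [Leaf]) i = first_leaf h i" if "i \<in> {1..card ?J}" for i
      using that h(1) by (intro first_leaf_append_left) simp
    then have "first_leaf (h @ [Leaf]) ` {1..card ?J} = first_leaf h ` {1..card ?J}"
      by (rule image_cong[OF HOL.refl])
    then have "first_leaf (h @ [Leaf]) ` {1..card ?J} = ?J"
      using h(3) by (rule HOL.trans)
    moreover have "first_leaf (h @ [Leaf]) (Suc (card ?J)) = Suc (Suc m)"
      using h by (simp add: first_leaf_def)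
    moreover have "{1..card J} = insert (Suc (card ?J)) {1..card ?J}"
      unfolding c by auto
    ultimately have "first_leaf (h @ [Leaf]) ` {1..card J} = J"
      using True by auto
    then show ?thesis
      using h c by (intro exI[of _ "h @ [Leaf]"]) simp
  next
    case False
    have "J \<subseteq> {1..Suc m}"
    proof
      fix x assume x: "x \<in> J"
      then have "x \<in> {1..Suc (Suc m)}" using Suc.prems(1) by blast
      then show "x \<in> {1..Suc m}" using x False by (cases "x = Suc (Suc m)") auto
    qed
    then obtain h :: "'s forest" where h: "length h = card J" "leaves h = Suc m"
        "first_leaf h ` {1..card J} = J"
      using Suc.IH Suc.prems(2) by blast
    have "h \<noteq> []" using h(2) by auto
    then obtain h' t where h': "h = h' @ [t]"
      by (metis append_butlast_last_id)
    \<comment> \<open>the colour of the new vertex does not matter\<close>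
    let ?h = "h' @ [Node t undefined Leaf]"
    have "first_leaf ?h i = first_leaf h i" if "i \<in> {1..card J}" for i
      using that h(1) unfolding h' by (simp add: first_leaf_append_left)
    then have "first_leaf ?h ` {1..card J} = first_leaf h ` {1..card J}"
      by (rule image_cong[OF HOL.refl])
    then have "first_leaf ?h ` {1..card J} = J"
      using h(3) by (rule HOL.trans)
    then show ?thesis
      using h h' by (intro exI[of _ ?h]) simp
  qed
qed

lemma conjugate_carriers_iso:
  assumes "group G" "g \<in> carrier G" "H \<subseteq> carrier G" "K \<subseteq> carrier G"
    and HK: "\<And>h. h \<in> H \<Longrightarrow> g \<otimes>\<^bsub>G\<^esub> h \<otimes>\<^bsub>G\<^esub> inv\<^bsub>G\<^esub> g \<in> K"
    and KH: "\<And>h. h \<in> K \<Longrightarrow> inv\<^bsub>G\<^esub> g \<otimes>\<^bsub>G\<^esub> h \<otimes>\<^bsub>G\<^esub> g \<in> H"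
  shows "G\<lparr>carrier := K\<rparr> \<cong> G\<lparr>carrier := H\<rparr>"
proof (rule is_isoI)
  interpret group G by fact
  let ?f = "\<lambda>h. inv\<^bsub>G\<^esub> g \<otimes>\<^bsub>G\<^esub> h \<otimes>\<^bsub>G\<^esub> g"
  have cancel: "g \<otimes>\<^bsub>G\<^esub> (inv\<^bsub>G\<^esub> g \<otimes>\<^bsub>G\<^esub> x) = x" "inv\<^bsub>G\<^esub> g \<otimes>\<^bsub>G\<^esub> (g \<otimes>\<^bsub>G\<^esub> x) = x" if "x \<in> carrier G" for x
    using that assms(2) by (simp_all add: m_assoc[symmetric])
  show "?f \<in> iso (G\<lparr>carrier := K\<rparr>) (G\<lparr>carrier := H\<rparr>)"
  proof (rule isoI)
    show "?f \<in> hom (G\<lparr>carrier := K\<rparr>) (G\<lparr>carrier := H\<rparr>)"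
    proof (rule homI)
      fix x y assume "x \<in> carrier (G\<lparr>carrier := K\<rparr>)" "y \<in> carrier (G\<lparr>carrier := K\<rparr>)"
      then have "x \<in> carrier G" "y \<in> carrier G" using assms(4) by auto
      then show "?f (x \<otimes>\<^bsub>G\<lparr>carrier := K\<rparr>\<^esub> y) = ?f x \<otimes>\<^bsub>G\<lparr>carrier := H\<rparr>\<^esub> ?f y"
        using assms(2) cancel by (simp add: m_assoc)
    qed (use KH in simp)
    show "bij_betw ?f (carrier (G\<lparr>carrier := K\<rparr>)) (carrier (G\<lparr>carrier := H\<rparr>))"
    proof (rule bij_betw_byWitness[where f' = "\<lambda>h. g \<otimes>\<^bsub>G\<^esub> h \<otimes>\<^bsub>G\<^esub> inv\<^bsub>G\<^esub> g"])
      have "g \<otimes>\<^bsub>G\<^esub> ?f h \<otimes>\<^bsub>G\<^esub> inv\<^bsub>G\<^esub> g = h" if "h \<in> carrier G" for h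
        using that assms(2) cancel by (simp add: m_assoc)
      then show "\<forall>h\<in>carrier (G\<lparr>carrier := K\<rparr>). g \<otimes>\<^bsub>G\<^esub> ?f h \<otimes>\<^bsub>G\<^esub> inv\<^bsub>G\<^esub> g = h"
        using assms(4) by auto
      have "?f (g \<otimes>\<^bsub>G\<^esub> h \<otimes>\<^bsub>G\<^esub> inv\<^bsub>G\<^esub> g) = h" if "h \<in> carrier G" for h
        using that assms(2) cancel by (simp add: m_assoc)
      then show "\<forall>h\<in>carrier (G\<lparr>carrier := H\<rparr>). ?f (g \<otimes>\<^bsub>G\<^esub> h \<otimes>\<^bsub>G\<^esub> inv\<^bsub>G\<^esub> g) = h"
        using assms(3) by auto
    qed (use HK KH in auto)
  qed
qed

text \<open>
  The inverse of a bijective homomorphism is a homomorphism as soon as the domain is closed under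
  multiplication. It is applied with powers and semidirect products as domains.
\<close>

lemma iso_sym_magma:
  assumes "\<phi> \<in> iso A B" "\<And>x y. \<lbrakk>x \<in> carrier A; y \<in> carrier A\<rbrakk> \<Longrightarrow> x \<otimes>\<^bsub>A\<^esub> y \<in> carrier A"
  shows "B \<cong> A"
proof (rule is_isoI)
  let ?\<psi> = "inv_into (carrier A) \<phi>"
  have \<phi>: "\<phi> \<in> hom A B" and bij: "bij_betw \<phi> (carrier A) (carrier B)"
    using assms(1) by (simp_all add: iso_def)
  have \<psi>: "?\<psi> x \<in> carrier A" "\<phi> (?\<psi> x) = x" if "x \<in> carrier B" for x
    using bij that by (auto simp: bij_betw_def f_inv_into_f inv_into_into)
  have "?\<psi> (x \<otimes>\<^bsub>B\<^esub> y) = ?\<psi> x \<otimes>\<^bsub>A\<^esub> ?\<psi> y" if "x \<in> carrier B" "y \<in> carrier B" for x y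
  proof -
    have "\<phi> (?\<psi> x \<otimes>\<^bsub>A\<^esub> ?\<psi> y) = x \<otimes>\<^bsub>B\<^esub> y"
      using hom_mult[OF \<phi>] \<psi> that by simp
    moreover have "?\<psi> x \<otimes>\<^bsub>A\<^esub> ?\<psi> y \<in> carrier A"
      using assms(2) \<psi> that by simp
    ultimately show ?thesis
      using bij by (metis bij_betw_def inv_into_f_f)
  qed
  then show "?\<psi> \<in> iso B A"
    using \<psi> bij_betw_inv_into[OF bij] by (intro isoI homI) simp_all
qed

context ore_skein
begin

lemma representatives_of_subset:
  assumes "A \<in> X_sub R k"
  obtains t J where "length t = 1" "J \<subseteq> {1..leaves t}" "finite J" "card J = k" "A = pt t ` J"
proof -
  have A: "finite A" "A \<subseteq> X_set R" "card A = k"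
    using assms by (simp_all add: X_sub_def)
  obtain t J where t: "length t = 1" "J \<subseteq> {1..leaves t}" "A = pt t ` J"
    using A(1,2) by (rule finite_subset_of_X)
  have "inj_on (pt t) J"
    using inj_on_pt[OF t(1)] t(2) by (rule inj_on_subset)
  then have "card J = k"
    using A(3) t(3) by (simp add: card_image)
  then show ?thesis
    using that t finite_subset[OF t(2)] by blast
qed

text \<open>
  A rotation \<open>\<sigma>\<close> brings an element of \<open>J\<close> to the first leaf, after which \<open>J\<close> is the set of first leaves of a
  forest \<open>h\<close> with \<open>k\<close> roots. The inverse of \<open>\<sigma>\<close> restores the original positions.
\<close>

lemma transport_from_base:
  assumes b: "length b = 1" "leaves b = k" and k: "1 \<le> k" and A: "A \<in> X_sub R k"
  shows "\<exists>g\<in>carrier G. alpha R g ` pt b ` {1..k} = A"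
proof -
  obtain t J where t: "length t = 1" "J \<subseteq> {1..leaves t}" "finite J" "card J = k" "A = pt t ` J"
    using A by (rule representatives_of_subset)
  define n where "n = leaves t"
  have "J \<noteq> {}" using t(4) k by auto
  then obtain j0 where j0: "j0 \<in> J" by blast
  have j0n: "j0 \<in> {1..n}" using j0 t(2) n_def by blast
  \<comment> \<open>adding this amount to \<open>j0\<close> wraps around once and ends at 1\<close>
  define \<sigma> where "\<sigma> = cyc n ^^ (n + 1 - j0)"
  have \<sigma>: "\<sigma> \<in> rotations n" by (simp add: \<sigma>_def)
  have "j0 - 1 + (n + 1 - j0) = n" using j0n by auto
  then have \<sigma>1: "\<sigma> j0 = 1"
    using j0n by (simp only: \<sigma>_def cyc_funpow if_True) simp
  obtain \<tau> where \<tau>: "\<tau> \<in> rotations n" "\<tau> \<circ> \<sigma> = id"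
    using \<sigma> by (rule rotations_inverse)
  let ?J = "\<sigma> ` J"
  have "inj_on \<sigma> J"
    using rotations_bij_betw[OF \<sigma>] t(2) n_def by (auto simp: bij_betw_def intro: inj_on_subset)
  then have card: "card ?J = k"
    using t(4) by (simp add: card_image)
  have "?J \<subseteq> {1..Suc (n - 1)}" "1 \<in> ?J"
    using rotations_range[OF \<sigma>] t(2) n_def j0 \<sigma>1 j0n by (auto intro: rev_image_eqI)
  then obtain h :: "'s forest" where h: "length h = k" "leaves h = Suc (n - 1)" "first_leaf h ` {1..k} = ?J"
    using forest_with_first_leaves[of ?J "n - 1"] unfolding card by blast
  have hn: "leaves h = n" using h(2) j0n by auto
  have ok: "fr_ok t \<tau> (stack b h)"
    using t(1) b h(1) hn \<tau>(1) by (simp add: fr_ok_def n_def)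
  have "alpha R (fr t \<tau> (stack b h)) (pt b i) = pt t (\<tau> (first_leaf h i))" if i: "i \<in> {1..k}" for i
  proof -
    have "pt b i = pt (stack b h) (first_leaf h i)"
      using pt_expand[of b i h] b h(1) i by simp
    moreover have "first_leaf h i \<in> {1..leaves (stack b h)}"
      using first_leaf_range[of i h] b h(1) i by simp
    ultimately show ?thesis
      using alpha_fr[OF ok] by simp
  qed
  then have "alpha R (fr t \<tau> (stack b h)) ` pt b ` {1..k} = pt t ` \<tau> ` first_leaf h ` {1..k}"
    unfolding image_image by (rule image_cong[OF HOL.refl])
  also have "\<dots> = A"
    unfolding h(3) t(5) image_comp \<tau>(2) by simp
  finally show ?thesis
    using fr_in_carrier[OF ok] by blast
qed

lemma base_in_X_sub:
  assumes "length b = 1" "leaves b = k"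
  shows "pt b ` {1..k} \<in> X_sub R k"
  using assms inj_on_pt[of b] pt_in_X_set[of b] by (auto simp: X_sub_def card_image)

lemma alpha_sub_transitive:
  assumes "1 \<le> k"
  shows "transitive_action G (X_sub R k) (alpha_sub R k)"
proof -
  interpret group_action G "X_sub R k" "alpha_sub R k"
    by (rule alpha_sub_group_action)
  interpret grp: group G by (rule group_G)
  obtain b :: "'s forest" where b: "length b = 1" "leaves b = k"
    using assms by (rule obtain_tree_with_leaves)
  let ?A = "pt b ` {1..k}"
  have A: "?A \<in> X_sub R k"
    using b by (rule base_in_X_sub)
  have orb: "\<exists>g\<in>carrier G. alpha_sub R k g ?A = B" if "B \<in> X_sub R k" for B
    using transport_from_base[OF b assms that] A by (simp add: alpha_sub_def)
  show ?thesis
  proof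
    fix B C assume BC: "B \<in> X_sub R k" "C \<in> X_sub R k"
    obtain g h where gh: "g \<in> carrier G" "alpha_sub R k g ?A = B" "h \<in> carrier G" "alpha_sub R k h ?A = C"
      using orb BC by blast
    then have "alpha_sub R k (h \<otimes>\<^bsub>G\<^esub> inv\<^bsub>G\<^esub> g) B = C"
      using A BC composition_rule orbit_sym_aux by (metis grp.inv_closed)
    then show "\<exists>g\<in>carrier G. alpha_sub R k g B = C"
      using gh by blast
  qed
qed

lemma Fix_Stab_conjugate:
  assumes g: "g \<in> carrier G" and A: "A \<subseteq> X_set R"
  shows "G\<lparr>carrier := Fix R (alpha R g ` A)\<rparr> \<cong> G\<lparr>carrier := Fix R A\<rparr>"
    and "G\<lparr>carrier := Stab R (alpha R g ` A)\<rparr> \<cong> G\<lparr>carrier := Stab R A\<rparr>"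
proof -
  interpret group G by (rule group_G)
  have ax: "alpha R (g \<otimes>\<^bsub>G\<^esub> h \<otimes>\<^bsub>G\<^esub> inv\<^bsub>G\<^esub> g) (alpha R g x) = alpha R g (alpha R h x)"
    if h: "h \<in> carrier G" and x: "x \<in> A" for h x
  proof -
    have "x \<in> X_set R" "alpha R g x \<in> X_set R"
      using x A g alpha_closed by blast+
    then show ?thesis
      using g h by (simp add: alpha_mult alpha_inverse)
  qed
  have ax': "alpha R (inv\<^bsub>G\<^esub> g \<otimes>\<^bsub>G\<^esub> h \<otimes>\<^bsub>G\<^esub> g) x = alpha R (inv\<^bsub>G\<^esub> g) (alpha R h (alpha R g x))"
    if h: "h \<in> carrier G" and x: "x \<in> A" for h x
  proof -
    have "x \<in> X_set R" "alpha R g x \<in> X_set R"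
      using x A g alpha_closed by blast+
    then show ?thesis
      using g h alpha_closed by (simp add: alpha_mult)
  qed
  have inv_im: "alpha R (inv\<^bsub>G\<^esub> g) ` alpha R g ` A = A"
    using alpha_inverse(1)[OF g] A by (force simp: image_image)
  show "G\<lparr>carrier := Fix R (alpha R g ` A)\<rparr> \<cong> G\<lparr>carrier := Fix R A\<rparr>"
  proof (rule conjugate_carriers_iso[OF group_G g])
    show "g \<otimes>\<^bsub>G\<^esub> h \<otimes>\<^bsub>G\<^esub> inv\<^bsub>G\<^esub> g \<in> Fix R (alpha R g ` A)" if "h \<in> Fix R A" for h
      using that g by (auto simp: Fix_def ax)
    show "inv\<^bsub>G\<^esub> g \<otimes>\<^bsub>G\<^esub> h \<otimes>\<^bsub>G\<^esub> g \<in> Fix R A" if "h \<in> Fix R (alpha R g ` A)" for h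
      using that g A alpha_inverse(1)[OF g] by (auto simp: Fix_def ax')
  qed (auto simp: Fix_def)
  show "G\<lparr>carrier := Stab R (alpha R g ` A)\<rparr> \<cong> G\<lparr>carrier := Stab R A\<rparr>"
  proof (rule conjugate_carriers_iso[OF group_G g])
    show "g \<otimes>\<^bsub>G\<^esub> h \<otimes>\<^bsub>G\<^esub> inv\<^bsub>G\<^esub> g \<in> Stab R (alpha R g ` A)" if h: "h \<in> Stab R A" for h
    proof -
      have "alpha R (g \<otimes>\<^bsub>G\<^esub> h \<otimes>\<^bsub>G\<^esub> inv\<^bsub>G\<^esub> g) ` alpha R g ` A = alpha R g ` alpha R h ` A"
        unfolding image_image using h ax by (intro image_cong) (auto simp: Stab_def)
      then show ?thesis using h g by (simp add: Stab_def)
    qed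
    show "inv\<^bsub>G\<^esub> g \<otimes>\<^bsub>G\<^esub> h \<otimes>\<^bsub>G\<^esub> g \<in> Stab R A" if h: "h \<in> Stab R (alpha R g ` A)" for h
    proof -
      have "alpha R (inv\<^bsub>G\<^esub> g \<otimes>\<^bsub>G\<^esub> h \<otimes>\<^bsub>G\<^esub> g) ` A = alpha R (inv\<^bsub>G\<^esub> g) ` alpha R h ` alpha R g ` A"
        unfolding image_image using h ax' by (intro image_cong) (auto simp: Stab_def)
      then show ?thesis using h g inv_im by (simp add: Stab_def)
    qed
  qed (auto simp: Stab_def)
qed

end

section \<open>Gluing fractions over a base tree\<close>

lemma length_concat_blocks:
  "(\<And>i. i < length f \<Longrightarrow> length (p i) = size1 (f ! i))
    \<Longrightarrow> length (concat (map p [0..<length f])) = leaves f"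
proof (induction f rule: rev_induct)
  case (snoc t f)
  have "length (p i) = size1 (f ! i)" if "i < length f" for i
    using snoc.prems[of i] that by (simp add: nth_append)
  moreover have "length (p (length f)) = size1 t"
    using snoc.prems[of "length f"] by simp
  ultimately show ?case using snoc.IH by simp
qed simp

text \<open>
  A forest stacked on \<open>f\<close> is the concatenation of blocks, one on each tree of \<open>f\<close>. This is how expansions
  of the components of a glued fraction are assembled.
\<close>

lemma stack_concat_blocks:
  "(\<And>i. i < length f \<Longrightarrow> length (p i) = size1 (f ! i))
    \<Longrightarrow> stack f (concat (map p [0..<length f])) = concat (map (\<lambda>i. stack [f ! i] (p i)) [0..<length f])"
proof (induction f rule: rev_induct)
  case (snoc t f)
  have p: "length (p i) = size1 (f ! i)" if "i < length f" for i
    using snoc.prems[of i] that by (simp add: nth_append)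
  have pt: "length (p (length f)) = size1 t"
    using snoc.prems[of "length f"] by simp
  have "stack (f @ [t]) (concat (map p [0..<length f]) @ p (length f)) =
      stack f (concat (map p [0..<length f])) @ stack [t] (p (length f))"
    using length_concat_blocks[of f p, OF p] by (intro stack_append)
  also have "stack f (concat (map p [0..<length f])) = concat (map (\<lambda>i. stack [f ! i] (p i)) [0..<length f])"
    using snoc.IH p by blast
  also have "map (\<lambda>i. stack [f ! i] (p i)) [0..<length f] = map (\<lambda>i. stack [(f @ [t]) ! i] (p i)) [0..<length f]"
    by (rule map_cong) (simp_all add: nth_append)
  finally show ?case by (simp del: stack.simps)
qed simp

lemma strict_mono_same_image:
  fixes p q :: "nat \<Rightarrow> nat"
  assumes "\<And>i j. \<lbrakk>i \<in> {1..k}; j \<in> {1..k}; i < j\<rbrakk> \<Longrightarrow> p i < p j"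
    and "\<And>i j. \<lbrakk>i \<in> {1..k}; j \<in> {1..k}; i < j\<rbrakk> \<Longrightarrow> q i < q j"
    and "p ` {1..k} = q ` {1..k}" and i: "i \<in> {1..k}"
  shows "p i = q i"
proof -
  have sd: "sorted (map r [1..<Suc k]) \<and> distinct (map r [1..<Suc k])"
    if "\<And>i j. \<lbrakk>i \<in> {1..k}; j \<in> {1..k}; i < j\<rbrakk> \<Longrightarrow> r i < r j" for r :: "nat \<Rightarrow> nat"
  proof -
    have "sorted_wrt (<) (map r [1..<Suc k])"
      unfolding sorted_wrt_iff_nth_less using that by (auto simp del: upt_Suc)
    then show ?thesis
      using strict_sorted_iff by blast
  qed
  have "map p [1..<Suc k] = map q [1..<Suc k]"
    using sd[of p] sd[of q] assms(1-3)
    by (intro sorted_distinct_set_unique) (auto simp del: upt_Suc simp: atLeastLessThanSuc_atLeastAtMost)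
  then show ?thesis
    using i by (auto simp del: upt_Suc)
qed

lemma (in skein) cl_concat_cong:
  "(\<And>i. i < n \<Longrightarrow> cl (u i) = cl (v i)) \<Longrightarrow> cl (concat (map u [0..<n])) = cl (concat (map v [0..<n]))"
proof (induction n)
  case (Suc n)
  then have "cl (concat (map u [0..<n]) @ u n) = cl (concat (map v [0..<n]) @ v n)"
    by (intro cl_append_cong) simp_all
  then show ?case by simp
qed simp

lemma singleton_forest: "length t = 1 \<Longrightarrow> t = [t ! 0]"
  by (cases t) auto

context ore_skein
begin

lemma fr_id_eqI:
  assumes "fr_ok s id t" "fr_ok s' id t'" "length p = leaves t" "length q = leaves t'"
    and "cl (stack s p) = cl (stack s' q)" "cl (stack t p) = cl (stack t' q)"
  shows "fr s id t = fr s' id t'"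
proof -
  have "fr s id t = fr (stack s p) id (stack t p)"
    using fr_expand[OF assms(1,3)] by simp
  also have "\<dots> = fr (stack s' q) id (stack t' q)"
    unfolding assms(5,6) ..
  also have "\<dots> = fr s' id t'"
    using fr_expand[OF assms(2,4)] by simp
  finally show ?thesis .
qed

lemma carrier_F_group: "carrier (F_group R) = {fr s id t |s t. fr_ok s id t}"
  unfolding F_group_def skein_trees_iff by (auto simp: fr_ok_def) (metis id_in_rotations)

lemma mult_F_group [simp]: "mult (F_group R) = mult G"
  by (simp add: F_group_def)

text \<open>
  The expansion to a common middle tree of two fractions without rotation introduces none.
\<close>

lemma F_group_composable:
  assumes "g \<in> carrier (F_group R)" "h \<in> carrier (F_group R)"
  obtains u v w where "size1 u = size1 v" "size1 v = size1 w" "g = fr [u] id [v]" "h = fr [v] id [w]"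
proof -
  obtain s t where g: "fr_ok s id t" "g = fr s id t"
    using assms(1) unfolding carrier_F_group by blast
  obtain s' t' where h: "fr_ok s' id t'" "h = fr s' id t'"
    using assms(2) unfolding carrier_F_group by blast
  have len: "length s = 1" "length t = 1" "length s' = 1" "length t' = 1" "leaves s = leaves t"
      "leaves s' = leaves t'"
    using g(1) h(1) by (simp_all add: fr_ok_def)
  obtain p q where pq: "length p = leaves t" "length q = leaves s'" "cl (stack t p) = cl (stack s' q)"
      "leaves p = leaves q"
    using forest_ore_square[of t s'] len by auto
  have g': "g = fr (stack s p) id (stack t p)"
    using fr_expand[OF g(1) pq(1)] g(2) by simp
  have "fr (stack s' q) id (stack t' q) = h"
    using fr_expand[OF h(1), of q] pq(2) h(2) len by simp
  then have h': "h = fr (stack t p) id (stack t' q)"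
    unfolding pq(3)[symmetric] by simp
  have sing: "stack s p = [stack s p ! 0]" "stack t p = [stack t p ! 0]" "stack t' q = [stack t' q ! 0]"
    using len by (intro singleton_forest; simp)+
  have sz: "size1 (r ! 0) = leaves r" if "length r = 1" for r :: "'s forest"
    using that by (cases r) auto
  show ?thesis
    by (rule that[of "stack s p ! 0" "stack t p ! 0" "stack t' q ! 0"])
      (use sing g' h' len pq in \<open>simp_all add: sz\<close>)
qed

lemma F_group_mult_closed:
  assumes "g \<in> carrier (F_group R)" "h \<in> carrier (F_group R)"
  shows "g \<otimes>\<^bsub>G\<^esub> h \<in> carrier (F_group R)"
proof -
  obtain u v w where *: "size1 u = size1 v" "size1 v = size1 w" "g = fr [u] id [v]" "h = fr [v] id [w]"
    using assms by (rule F_group_composable)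
  then have "fr_ok [u] id [v]" "fr_ok [v] id [w]"
    by (simp_all add: fr_ok_def)
  then show ?thesis
    using fr_mult[of "[u]" id "[v]" id "[w]"] fr_ok_comp[of "[u]" id "[v]" id "[w]"] *
    unfolding carrier_F_group by auto
qed

end

locale based_skein = ore_skein R for R :: "('s tree \<times> 's tree) set" +
  fixes b :: "'s forest" and k :: nat
  assumes length_b: "length b = 1" and leaves_b: "leaves b = k" and k_pos: "1 \<le> k"
begin

abbreviation Gk :: "(int \<Rightarrow> 's fracT) monoid" where "Gk \<equiv> group_power (F_group R) k"

abbreviation A0 :: "('s forest set \<times> nat) set set" where "A0 \<equiv> pt b ` {1..k}"

lemma carrier_Gk: "carrier Gk = (\<Pi>\<^sub>E i\<in>{0..<int k}. carrier (F_group R))"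
  by (simp add: group_power_def)

lemma mult_Gk: "x \<otimes>\<^bsub>Gk\<^esub> y = (\<lambda>i\<in>{0..<int k}. x i \<otimes>\<^bsub>G\<^esub> y i)"
  by (simp add: group_power_def)

lemma mult_Gk_closed: "\<lbrakk>x \<in> carrier Gk; y \<in> carrier Gk\<rbrakk> \<Longrightarrow> x \<otimes>\<^bsub>Gk\<^esub> y \<in> carrier Gk"
  unfolding carrier_Gk mult_Gk by (auto intro!: F_group_mult_closed)

text \<open>
  The relation \<open>coords a f h\<close> expresses \<open>a\<close> in the components \<open>f\<^sub>i \<circ> h\<^sub>i\<^sup>-\<^sup>1\<close>. It is a relation because
  the forests \<open>f\<close> and \<open>h\<close> are unique only up to expansion.
\<close>

definition coords :: "(int \<Rightarrow> 's fracT) \<Rightarrow> 's forest \<Rightarrow> 's forest \<Rightarrow> bool" where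
  "coords a f h \<longleftrightarrow> length f = k \<and> length h = k \<and>
     (\<forall>i<k. size1 (f ! i) = size1 (h ! i) \<and> a (int i) = fr [f ! i] id [h ! i])"

abbreviation glue :: "'s forest \<Rightarrow> 's forest \<Rightarrow> 's fracT" where
  "glue f h \<equiv> fr (stack b f) id (stack b h)"

lemma coords_sizes:
  assumes "coords a f h"
  shows "length f = k" "length h = k" "map size1 f = map size1 h" "leaves f = leaves h"
proof -
  show "length f = k" "length h = k"
    using assms by (simp_all add: coords_def)
  show "map size1 f = map size1 h"
    using assms by (intro nth_equalityI) (simp_all add: coords_def)
  then show "leaves f = leaves h"
    by (simp add: leaves_def)
qed

lemma fr_ok_glue: "\<lbrakk>length f = k; length h = k; leaves f = leaves h\<rbrakk> \<Longrightarrow> fr_ok (stack b f) id (stack b h)"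
  using length_b leaves_b by (simp add: fr_ok_def)

text \<open>
  Common expansions of the components, taken side by side, form a common expansion of the glued
  fractions.
\<close>

lemma glue_eqI:
  assumes c: "coords a f h" "coords a' f' h'" and eq: "\<And>i. i < k \<Longrightarrow> a (int i) = a' (int i)"
  shows "glue f h = glue f' h'"
proof -
  note s = coords_sizes[OF c(1)] and s' = coords_sizes[OF c(2)]
  have "\<exists>p q. length p = size1 (h ! i) \<and> length q = size1 (h' ! i) \<and>
      cl (stack [f ! i] p) = cl (stack [f' ! i] q) \<and> cl (stack [h ! i] p) = cl (stack [h' ! i] q)"
    if i: "i < k" for i
  proof -
    have ok: "fr_ok [f ! i] id [h ! i]" "fr_ok [f' ! i] id [h' ! i]"
      using c i by (simp_all add: coords_def fr_ok_def)
    have "fr [f ! i] id [h ! i] = fr [f' ! i] id [h' ! i]"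
      using c eq i by (simp add: coords_def)
    then show ?thesis
      unfolding fr_eq_iff[OF ok] by (auto simp del: stack.simps)
  qed
  then obtain p q where pq: "\<And>i. i < k \<Longrightarrow> length (p i) = size1 (h ! i) \<and> length (q i) = size1 (h' ! i) \<and>
      cl (stack [f ! i] (p i)) = cl (stack [f' ! i] (q i)) \<and>
      cl (stack [h ! i] (p i)) = cl (stack [h' ! i] (q i))"
    by metis
  define P Q where "P = concat (map p [0..<k])" and "Q = concat (map q [0..<k])"
  have lp: "length (p i) = size1 (f ! i)" "length (p i) = size1 (h ! i)"
      "length (q i) = size1 (f' ! i)" "length (q i) = size1 (h' ! i)" if "i < k" for i
    using pq[OF that] c that by (simp_all add: coords_def)
  have len: "length P = leaves f" "length P = leaves h" "length Q = leaves f'" "length Q = leaves h'"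
    unfolding P_def Q_def
    using length_concat_blocks[of f p] length_concat_blocks[of h p]
      length_concat_blocks[of f' q] length_concat_blocks[of h' q] lp s s' by simp_all
  have st: "stack f P = concat (map (\<lambda>i. stack [f ! i] (p i)) [0..<k])"
      "stack h P = concat (map (\<lambda>i. stack [h ! i] (p i)) [0..<k])"
      "stack f' Q = concat (map (\<lambda>i. stack [f' ! i] (q i)) [0..<k])"
      "stack h' Q = concat (map (\<lambda>i. stack [h' ! i] (q i)) [0..<k])"
    unfolding P_def Q_def
    using stack_concat_blocks[of f p] stack_concat_blocks[of h p]
      stack_concat_blocks[of f' q] stack_concat_blocks[of h' q] lp s s' by (simp_all del: stack.simps)
  have fP: "cl (stack f P) = cl (stack f' Q)"
    unfolding st using pq by (intro cl_concat_cong) blast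
  have hP: "cl (stack h P) = cl (stack h' Q)"
    unfolding st using pq by (intro cl_concat_cong) blast
  have "cl (stack b (stack f P)) = cl (stack b (stack f' Q))"
    by (rule cl_stack_cong[OF HOL.refl fP]) (simp add: s leaves_b)
  then have 1: "cl (stack (stack b f) P) = cl (stack (stack b f') Q)"
    using stack_assoc[of f b P] stack_assoc[of f' b Q] len s s' leaves_b by simp
  have "cl (stack b (stack h P)) = cl (stack b (stack h' Q))"
    by (rule cl_stack_cong[OF HOL.refl hP]) (simp add: s leaves_b)
  then have 2: "cl (stack (stack b h) P) = cl (stack (stack b h') Q)"
    using stack_assoc[of h b P] stack_assoc[of h' b Q] len s s' leaves_b by simp
  show ?thesis
    by (rule fr_id_eqI[OF fr_ok_glue[OF s(1,2,4)] fr_ok_glue[OF s'(1,2,4)] _ _ 1 2])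
      (simp_all add: len s s' leaves_b)
qed

text \<open>
  Conversely, after cancellation of \<open>b\<close> a common expansion of the glued fractions is an equality of forests
  with \<open>k\<close> roots, and its \<open>i\<close>th tree is a common expansion of the \<open>i\<close>th components.
\<close>

lemma glue_eqD:
  assumes c: "coords a f h" "coords a' f' h'" and eq: "glue f h = glue f' h'" and i: "i < k"
  shows "a (int i) = a' (int i)"
proof -
  note s = coords_sizes[OF c(1)] and s' = coords_sizes[OF c(2)]
  obtain P Q where PQ: "length P = leaves (stack b h)" "length Q = leaves (stack b h')"
      "cl (stack (stack b f) P) = cl (stack (stack b f') Q)"
      "cl (stack (stack b h) P) = cl (stack (stack b h') Q)"
    using eq unfolding fr_eq_iff[OF fr_ok_glue[OF s(1,2,4)] fr_ok_glue[OF s'(1,2,4)]] by auto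
  have len: "length P = leaves f" "length P = leaves h" "length Q = leaves f'" "length Q = leaves h'"
    using PQ(1,2) s s' leaves_b by simp_all
  have "cl (stack b (stack f P)) = cl (stack b (stack f' Q))"
    using PQ(3) stack_assoc[of f b P] stack_assoc[of f' b Q] len s s' leaves_b by simp
  then have fP: "cl (stack f P) = cl (stack f' Q)"
    using s s' leaves_b by - (rule forest_cancel[where f = b], simp_all)
  have "cl (stack b (stack h P)) = cl (stack b (stack h' Q))"
    using PQ(4) stack_assoc[of h b P] stack_assoc[of h' b Q] len s s' leaves_b by simp
  then have hP: "cl (stack h P) = cl (stack h' Q)"
    using s s' leaves_b by - (rule forest_cancel[where f = b], simp_all)
  \<comment> \<open>the segment of \<open>P\<close> that is stacked on the \<open>i\<close>th tree\<close>
  define blk where "blk f P = take (size1 (f ! i)) (drop (leaves (take i f)) P)"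
    for f P :: "'s forest"
  have blk: "[stack f P ! i] = stack [f ! i] (blk f P)" "length (blk f P) = size1 (f ! i)"
    if "length P = leaves f" "length f = k" for f P :: "'s forest"
  proof -
    have "leaves (take i f) + (size1 (f ! i) + leaves (drop (Suc i) f)) = leaves f"
      using leaves_take_drop[of i f] Cons_nth_drop_Suc[of i f] i that(2) by (metis leaves_Cons)
    then show l: "length (blk f P) = size1 (f ! i)"
      using that by (simp add: blk_def)
    show "[stack f P ! i] = stack [f ! i] (blk f P)"
      using nth_stack[of P f i] that i l by (simp add: blk_def)
  qed
  have same: "blk f P = blk h P" "blk f' Q = blk h' Q"
    using s s' c i leaves_take_if_sizes[of f h i] leaves_take_if_sizes[of f' h' i]
    by (simp_all add: blk_def coords_def)
  have "cl [stack f P ! i] = cl [stack f' Q ! i]" "cl [stack h P ! i] = cl [stack h' Q ! i]"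
    using fP hP i s s' unfolding cl_eq_nth_iff[of "stack f P"] cl_eq_nth_iff[of "stack h P"] by simp_all
  then have e: "cl (stack [f ! i] (blk h P)) = cl (stack [f' ! i] (blk h' Q))"
      "cl (stack [h ! i] (blk h P)) = cl (stack [h' ! i] (blk h' Q))"
    using blk(1)[OF len(1) s(1)] blk(1)[OF len(2) s(2)] blk(1)[OF len(3) s'(1)] blk(1)[OF len(4) s'(2)] same
    by (simp_all del: stack.simps)
  have l: "length (blk h P) = size1 (h ! i)" "length (blk h' Q) = size1 (h' ! i)"
    using blk(2)[OF len(2) s(2)] blk(2)[OF len(4) s'(2)] .
  have ok: "fr_ok [f ! i] id [h ! i]" "fr_ok [f' ! i] id [h' ! i]"
    using c i by (simp_all add: coords_def fr_ok_def)
  have "fr [f ! i] id [h ! i] = fr [f' ! i] id [h' ! i]"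
    by (rule fr_id_eqI[OF ok _ _ e]) (simp_all add: l)
  then show ?thesis
    using c i by (simp add: coords_def)
qed

lemma coords_composable:
  assumes "x \<in> carrier Gk" "y \<in> carrier Gk"
  obtains f h l where "coords x f h" "coords y h l"
proof -
  have "\<exists>u v w. size1 u = size1 v \<and> size1 v = size1 w \<and> x (int i) = fr [u] id [v] \<and>
      y (int i) = fr [v] id [w]" if "i < k" for i
  proof -
    have "x (int i) \<in> carrier (F_group R)" "y (int i) \<in> carrier (F_group R)"
      using assms that unfolding carrier_Gk by auto
    then show ?thesis
      using F_group_composable by metis
  qed
  then obtain u v w where uvw: "\<And>i. i < k \<Longrightarrow> size1 (u i) = size1 (v i) \<and> size1 (v i) = size1 (w i) \<and>
      x (int i) = fr [u i] id [v i] \<and> y (int i) = fr [v i] id [w i]"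
    by metis
  show ?thesis
    by (rule that[of "map u [0..<k]" "map v [0..<k]" "map w [0..<k]"])
      (simp_all add: coords_def uvw)
qed

definition \<Psi> :: "(int \<Rightarrow> 's fracT) \<Rightarrow> 's fracT" where
  "\<Psi> a = (THE g. \<exists>f h. coords a f h \<and> g = glue f h)"

lemma \<Psi>_eq:
  assumes "coords a f h"
  shows "\<Psi> a = glue f h"
  unfolding \<Psi>_def
proof (rule the_equality)
  show "\<exists>f' h'. coords a f' h' \<and> glue f h = glue f' h'"
    using assms by blast
  show "g = glue f h" if g: "\<exists>f' h'. coords a f' h' \<and> g = glue f' h'" for g
  proof -
    obtain f' h' where *: "coords a f' h'" "g = glue f' h'"
      using g by blast
    show ?thesis
      unfolding *(2) by (rule glue_eqI[OF *(1) assms]) simp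
  qed
qed

lemma \<Psi>_mult:
  assumes "x \<in> carrier Gk" "y \<in> carrier Gk"
  shows "\<Psi> (x \<otimes>\<^bsub>Gk\<^esub> y) = \<Psi> x \<otimes>\<^bsub>G\<^esub> \<Psi> y"
proof -
  obtain f h l where c: "coords x f h" "coords y h l"
    using assms by (rule coords_composable)
  note s = coords_sizes[OF c(1)] and s' = coords_sizes[OF c(2)]
  have "fr [f ! i] id [h ! i] \<otimes>\<^bsub>G\<^esub> fr [h ! i] id [l ! i] = fr [f ! i] id [l ! i]" if "i < k" for i
    using fr_mult[of "[f ! i]" id "[h ! i]" id "[l ! i]"] c that by (simp add: coords_def fr_ok_def)
  then have "coords (x \<otimes>\<^bsub>Gk\<^esub> y) f l"
    using c unfolding coords_def mult_Gk by simp
  moreover have "glue f h \<otimes>\<^bsub>G\<^esub> glue h l = glue f l"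
    using fr_mult[OF fr_ok_glue[OF s(1,2,4)] fr_ok_glue[OF s'(1,2,4)]] by simp
  ultimately show ?thesis
    using \<Psi>_eq c by simp
qed

lemma \<Psi>_inj:
  assumes "x \<in> carrier Gk" "y \<in> carrier Gk" "\<Psi> x = \<Psi> y"
  shows "x = y"
proof -
  obtain f h where c: "coords x f h"
    using assms(1) coords_composable by blast
  obtain f' h' where c': "coords y f' h'"
    using assms(2) coords_composable by blast
  have eq: "glue f h = glue f' h'"
    using assms(3) \<Psi>_eq[OF c] \<Psi>_eq[OF c'] by simp
  have "x i = y i" if "i \<in> {0..<int k}" for i
    using glue_eqD[OF c c' eq, of "nat i"] that by auto
  then show ?thesis
    using assms(1,2) PiE_ext unfolding carrier_Gk by metis
qed

lemma \<Psi>_in_carrier: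
  assumes "x \<in> carrier Gk"
  shows "\<Psi> x \<in> carrier G"
proof -
  obtain f h where c: "coords x f h"
    using assms(1) coords_composable by blast
  note s = coords_sizes[OF c]
  show ?thesis
    unfolding \<Psi>_eq[OF c] by (rule fr_in_carrier[OF fr_ok_glue[OF s(1,2,4)]])
qed

lemma alpha_over_base:
  assumes "fr_ok (stack b f) \<pi> (stack b h)" "length h = k" "i \<in> {1..k}"
  shows "alpha R (fr (stack b f) \<pi> (stack b h)) (pt b i) = pt (stack b f) (\<pi> (first_leaf h i))"
proof -
  have "pt b i = pt (stack b h) (first_leaf h i)"
    using pt_expand[of b i h] assms(2,3) length_b leaves_b by simp
  moreover have "first_leaf h i \<in> {1..leaves (stack b h)}"
    using first_leaf_range[of i h] assms leaves_b by simp
  ultimately show ?thesis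
    using alpha_fr[OF assms(1)] by simp
qed

lemma pt_over_base:
  "\<lbrakk>length f = k; i \<in> {1..k}\<rbrakk> \<Longrightarrow> pt (stack b f) (first_leaf f i) = pt b i"
  using pt_expand[of b i f] length_b leaves_b by simp

lemma \<Psi>_fixes:
  assumes "x \<in> carrier Gk" "i \<in> {1..k}"
  shows "alpha R (\<Psi> x) (pt b i) = pt b i"
proof -
  obtain f h where c: "coords x f h"
    using assms(1) coords_composable by blast
  note s = coords_sizes[OF c]
  have "alpha R (glue f h) (pt b i) = pt (stack b f) (first_leaf h i)"
    using alpha_over_base[OF fr_ok_glue[OF s(1,2,4)] s(2) assms(2)] by simp
  also have "first_leaf h i = first_leaf f i"
    using first_leaf_cong[OF s(3)] by simp
  also have "pt (stack b f) (first_leaf f i) = pt b i"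
    by (rule pt_over_base[OF s(1) assms(2)])
  finally show ?thesis
    unfolding \<Psi>_eq[OF c] .
qed

lemma representative_over_base:
  assumes "g \<in> carrier G"
  obtains f \<pi> h where "length f = k" "length h = k" "fr_ok (stack b f) \<pi> (stack b h)"
    "g = fr (stack b f) \<pi> (stack b h)"
proof -
  obtain t \<pi> f where f: "length f = leaves b" "fr_ok (stack b f) \<pi> t" "g = fr (stack b f) \<pi> t"
    using assms length_b by (rule prescribe_numerator)
  have t: "length t = length b" "leaves t = leaves f"
    using f(1,2) length_b by (simp_all add: fr_ok_def)
  obtain p h where ph: "length p = leaves t" "length h = leaves b" "cl (stack t p) = cl (stack b h)"
      "leaves p = leaves h"
    using t(1) by (rule forest_ore_square)
  have sa: "stack (stack b f) (perm_forest \<pi> p) = stack b (stack f (perm_forest \<pi> p))"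
    using f(1) ph(1) t(2) by (simp add: stack_assoc)
  have g: "g = fr (stack b (stack f (perm_forest \<pi> p))) (perm_leaves \<pi> p) (stack b h)"
    using fr_expand[OF f(2) ph(1)] unfolding sa f(3) ph(3) by simp
  have ok: "fr_ok (stack b (stack f (perm_forest \<pi> p))) (perm_leaves \<pi> p) (stack b h)"
    using fr_ok_expand[OF f(2) ph(1)] ph(1,2,4) length_b unfolding sa by (simp add: fr_ok_def)
  show ?thesis
    by (rule that[OF _ _ ok g]) (simp_all add: f(1) ph(2) leaves_b)
qed

text \<open>
  The rotation is trivial since it fixes 1. Both increasing sequences of first leaves then enumerate the same
  set, so they are equal, and their differences are the numbers of leaves of the trees.
\<close>

lemma \<Psi>_surj:
  assumes "g \<in> Stab R A0" "alpha R g (pt b 1) = pt b 1"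
  shows "\<exists>x\<in>carrier Gk. g = \<Psi> x"
proof -
  have g: "g \<in> carrier G" "alpha R g ` A0 = A0"
    using assms(1) by (simp_all add: Stab_def)
  obtain f \<pi> h where f: "length f = k" "length h = k" "fr_ok (stack b f) \<pi> (stack b h)"
      "g = fr (stack b f) \<pi> (stack b h)"
    using g(1) by (rule representative_over_base)
  have lf: "leaves f = leaves h" and \<pi>: "\<pi> \<in> rotations (leaves f)"
    using f leaves_b by (simp_all add: fr_ok_def)
  have tree: "length (stack b f) = 1" "leaves (stack b f) = leaves f"
    using f length_b leaves_b by simp_all
  have one: "1 \<in> {1..k}" using k_pos by simp
  have kf: "1 \<in> {1..leaves f}"
    using first_leaf_range[of 1 f] one f(1) by simp
  have "pt (stack b f) (\<pi> 1) = pt (stack b f) 1"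
    using alpha_over_base[OF f(3,2) one] pt_over_base[OF f(1) one] assms(2) f(4) by simp
  then have "\<pi> 1 = 1"
    using tree kf rotations_range[OF \<pi> kf] by - (rule pt_inj[of "stack b f"], simp_all)
  with \<pi> have id: "\<pi> = id"
    by (rule rotation_one_eq_id)
  have "pt (stack b f) ` first_leaf h ` {1..k} = alpha R g ` A0"
    unfolding image_image f(4) using alpha_over_base[OF f(3,2)] id by (intro image_cong) simp_all
  also have "\<dots> = pt (stack b f) ` first_leaf f ` {1..k}"
    unfolding g(2) unfolding image_image using pt_over_base[OF f(1)] by (intro image_cong) simp_all
  finally have "pt (stack b f) ` first_leaf h ` {1..k} = pt (stack b f) ` first_leaf f ` {1..k}" .
  moreover have sub: "first_leaf h ` {1..k} \<subseteq> {1..leaves (stack b f)}"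
      "first_leaf f ` {1..k} \<subseteq> {1..leaves (stack b f)}"
    using first_leaf_range[of _ h] first_leaf_range[of _ f] f lf tree by auto
  ultimately have im: "first_leaf h ` {1..k} = first_leaf f ` {1..k}"
    using inj_on_image_eq_iff[OF inj_on_pt[OF tree(1)] sub] by simp
  have fl: "first_leaf h i = first_leaf f i" if "i \<in> {1..Suc k}" for i
  proof (cases "i = Suc k")
    case True
    then show ?thesis using f lf by (simp add: first_leaf_def)
  next
    case False
    then have "i \<in> {1..k}" using that by auto
    with im show ?thesis
      using f by - (rule strict_mono_same_image[of k "first_leaf h" "first_leaf f"],
        auto intro: first_leaf_less)
  qed
  have sz: "size1 (f ! i) = size1 (h ! i)" if "i < k" for i
    using fl[of "Suc i"] fl[of "Suc (Suc i)"] that f first_leaf_Suc[of "Suc i" f]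
      first_leaf_Suc[of "Suc i" h] by simp
  define x where "x = (\<lambda>i\<in>{0..<int k}. fr [f ! nat i] id [h ! nat i])"
  have c: "coords x f h"
    using f sz by (simp add: coords_def x_def)
  have "fr [f ! nat i] id [h ! nat i] \<in> carrier (F_group R)" if i: "i \<in> {0..<int k}" for i
  proof -
    have "fr_ok [f ! nat i] id [h ! nat i]"
      using sz[of "nat i"] i by (auto simp: fr_ok_def)
    then show ?thesis unfolding carrier_F_group by blast
  qed
  then have "x \<in> carrier Gk"
    unfolding carrier_Gk x_def by auto
  moreover have "g = \<Psi> x"
    unfolding \<Psi>_eq[OF c] f(4) id ..
  ultimately show ?thesis by blast
qed

lemma Fix_subset_Stab: "Fix R A \<subseteq> Stab R A"
  unfolding Fix_def Stab_def by force

theorem Fix_base_iso: "\<Psi> \<in> iso Gk (G\<lparr>carrier := Fix R A0\<rparr>)"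
proof (rule isoI)
  have fixing: "\<Psi> x \<in> Fix R A0" if "x \<in> carrier Gk" for x
    using \<Psi>_in_carrier[OF that] \<Psi>_fixes[OF that] by (auto simp: Fix_def)
  then show "\<Psi> \<in> hom Gk (G\<lparr>carrier := Fix R A0\<rparr>)"
    using \<Psi>_mult by (intro homI) simp_all
  have "inj_on \<Psi> (carrier Gk)"
    using \<Psi>_inj by (intro inj_onI)
  moreover have "Fix R A0 \<subseteq> \<Psi> ` carrier Gk"
  proof
    fix g assume g: "g \<in> Fix R A0"
    then have "alpha R g (pt b 1) = pt b 1"
      using k_pos by (auto simp: Fix_def)
    then show "g \<in> \<Psi> ` carrier Gk"
      using \<Psi>_surj[of g] g Fix_subset_Stab by blast
  qed
  ultimately show "bij_betw \<Psi> (carrier Gk) (carrier (G\<lparr>carrier := Fix R A0\<rparr>))"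
    using fixing by (auto simp: bij_betw_def)
qed

abbreviation rot :: "nat \<Rightarrow> 's fracT" where
  "rot m \<equiv> fr b (cyc k ^^ m) b"

lemma fr_ok_rot: "fr_ok b (cyc k ^^ m) b"
  using length_b leaves_b by (simp add: fr_ok_def)

lemma rot_mult: "rot m \<otimes>\<^bsub>G\<^esub> rot n = rot (m + n)"
  using fr_mult[OF fr_ok_rot fr_ok_rot] by (simp add: funpow_add)

lemma alpha_rot: "m < k \<Longrightarrow> alpha R (rot m) (pt b 1) = pt b (Suc m)"
  using alpha_fr[OF fr_ok_rot[of m], of 1] k_pos leaves_b by (simp add: cyc_funpow)

lemma alpha_rot_base: "alpha R (rot m) ` A0 = A0"
proof -
  have "alpha R (rot m) ` A0 = pt b ` (cyc k ^^ m) ` {1..k}"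
    unfolding image_image using alpha_fr[OF fr_ok_rot[of m]] leaves_b by (intro image_cong) simp_all
  also have "(cyc k ^^ m) ` {1..k} = {1..k}"
    using rotations_bij_betw[of "cyc k ^^ m" k] by (simp add: bij_betw_def)
  finally show ?thesis .
qed

text \<open>
  The tree at position \<open>i\<close> after a rotation by \<open>m\<close> stood at position \<open>i - m\<close> modulo \<open>k\<close> before, which
  is the index used by \<open>shift\<close>.
\<close>

lemma coords_shift:
  assumes "coords x f h" "m < k"
  shows "coords (shift k (int m) x) (perm_forest (cyc k ^^ m) f) (perm_forest (cyc k ^^ m) h)"
proof -
  note s = coords_sizes[OF assms(1)]
  let ?\<sigma> = "cyc k ^^ m"
  have "size1 (perm_forest ?\<sigma> f ! i) = size1 (perm_forest ?\<sigma> h ! i) \<and>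
      shift k (int m) x (int i) = fr [perm_forest ?\<sigma> f ! i] id [perm_forest ?\<sigma> h ! i]" if i: "i < k" for i
  proof -
    define j where "j = nat ((int i - int m) mod int k)"
    have j: "int j = (int i - int m) mod int k" "j < k"
      using k_pos by (simp_all add: j_def nat_less_iff)
    have "int ((j + m) mod k) = int i"
      using i by (simp add: zmod_int j(1) mod_add_left_eq)
    then have jm: "(j + m) mod k = i"
      by linarith
    then have "?\<sigma> (Suc j) - 1 = i"
      using j(2) by (simp add: cyc_funpow)
    then have "perm_forest ?\<sigma> f ! i = f ! j" "perm_forest ?\<sigma> h ! i = h ! j"
      using nth_perm_forest[of ?\<sigma> f "Suc j"] nth_perm_forest[of ?\<sigma> h "Suc j"] j(2) s(1,2) by simp_all
    moreover have "shift k (int m) x (int i) = x (int j)"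
      using i j(1) by (simp add: shift_def)
    ultimately show ?thesis
      using assms(1) j(2) by (simp add: coords_def)
  qed
  then show ?thesis
    using s by (simp add: coords_def)
qed

lemma shift_closed:
  assumes "x \<in> carrier Gk"
  shows "shift k m x \<in> carrier Gk"
proof -
  have "(i - m) mod int k \<in> {0..<int k}" for i
    using k_pos by simp
  then show ?thesis
    using assms unfolding carrier_Gk by (auto simp: shift_def)
qed

text \<open>
  Expanding \<open>b \<circ> \<sigma> \<circ> b\<^sup>-\<^sup>1\<close> by \<open>f\<close> and by \<open>h\<close> yields the same permutation \<open>\<sigma>\<^sup>f = \<sigma>\<^sup>h\<close> of leaves, because
  corresponding trees of \<open>f\<close> and \<open>h\<close> have equally many leaves.
\<close>

lemma rot_\<Psi>:
  assumes "x \<in> carrier Gk" "m < k"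
  shows "rot m \<otimes>\<^bsub>G\<^esub> \<Psi> x = \<Psi> (shift k (int m) x) \<otimes>\<^bsub>G\<^esub> rot m"
proof -
  obtain f h where c: "coords x f h"
    using assms(1) coords_composable by blast
  note s = coords_sizes[OF c]
  let ?\<sigma> = "cyc k ^^ m"
  note c' = coords_shift[OF c assms(2)]
  note s' = coords_sizes[OF c']
  have lb: "length f = leaves b" "length h = leaves b"
    using s leaves_b by simp_all
  have "rot m \<otimes>\<^bsub>G\<^esub> \<Psi> x = fr (stack b (perm_forest ?\<sigma> f)) (perm_leaves ?\<sigma> f) (stack b f) \<otimes>\<^bsub>G\<^esub> glue f h"
    unfolding fr_expand[OF fr_ok_rot lb(1)] \<Psi>_eq[OF c] ..
  also have "\<dots> = fr (stack b (perm_forest ?\<sigma> f)) (perm_leaves ?\<sigma> f) (stack b h)"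
    using fr_mult[OF fr_ok_expand[OF fr_ok_rot lb(1)] fr_ok_glue[OF s(1,2,4)]] by simp
  also have "perm_leaves ?\<sigma> f = perm_leaves ?\<sigma> h"
    by (rule perm_leaves_cong) (simp_all add: s)
  also have "fr (stack b (perm_forest ?\<sigma> f)) (perm_leaves ?\<sigma> h) (stack b h) =
      glue (perm_forest ?\<sigma> f) (perm_forest ?\<sigma> h) \<otimes>\<^bsub>G\<^esub>
      fr (stack b (perm_forest ?\<sigma> h)) (perm_leaves ?\<sigma> h) (stack b h)"
    using fr_mult[OF fr_ok_glue[OF s'(1,2,4)] fr_ok_expand[OF fr_ok_rot lb(2)]] by simp
  also have "\<dots> = \<Psi> (shift k (int m) x) \<otimes>\<^bsub>G\<^esub> rot m"
    unfolding fr_expand[OF fr_ok_rot lb(2)] \<Psi>_eq[OF c'] ..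
  finally show ?thesis .
qed

abbreviation GkZ :: "((int \<Rightarrow> 's fracT) \<times> int) monoid" where
  "GkZ \<equiv> semidirect Gk (integer_mod_group k) (shift k)"

lemma carrier_GkZ: "carrier GkZ = carrier Gk \<times> {0..<int k}"
  using k_pos by (simp add: semidirect_def carrier_integer_mod_group)

lemma mult_GkZ: "(x, m) \<otimes>\<^bsub>GkZ\<^esub> (y, n) = (x \<otimes>\<^bsub>Gk\<^esub> shift k m y, (m + n) mod int k)"
  by (simp add: semidirect_def)

lemma mult_GkZ_closed: "\<lbrakk>u \<in> carrier GkZ; v \<in> carrier GkZ\<rbrakk> \<Longrightarrow> u \<otimes>\<^bsub>GkZ\<^esub> v \<in> carrier GkZ"
  using mult_Gk_closed shift_closed k_pos by (cases u; cases v) (simp add: carrier_GkZ mult_GkZ)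

definition \<Theta> :: "(int \<Rightarrow> 's fracT) \<times> int \<Rightarrow> 's fracT" where
  "\<Theta> = (\<lambda>(x, m). \<Psi> x \<otimes>\<^bsub>G\<^esub> rot (nat m))"

text \<open>
  The image of the first leaf of \<open>b\<close> determines the rotation, which gives injectivity. For surjectivity,
  dividing by the rotation with the same effect on that leaf leaves an element covered by \<open>\<Psi>_surj\<close>.
\<close>

theorem Stab_base_iso: "\<Theta> \<in> iso GkZ (G\<lparr>carrier := Stab R A0\<rparr>)"
proof (rule isoI)
  interpret group G by (rule group_G)
  have rot_closed: "rot m \<in> carrier G" for m
    by (rule fr_in_carrier[OF fr_ok_rot])
  have base: "pt b i \<in> X_set R" if "i \<in> {1..k}" for i
    using that length_b leaves_b by (intro pt_in_X_set) simp_all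
  have one: "1 \<in> {1..k}" using k_pos by simp
  have stab: "\<Theta> u \<in> Stab R A0" if uC: "u \<in> carrier GkZ" for u
  proof -
    obtain x m where u: "u = (x, m)" "x \<in> carrier Gk"
      using uC by (cases u) (simp add: carrier_GkZ)
    have "alpha R (\<Psi> x \<otimes>\<^bsub>G\<^esub> rot (nat m)) ` A0 = alpha R (\<Psi> x) ` alpha R (rot (nat m)) ` A0"
      unfolding image_image using alpha_mult[OF \<Psi>_in_carrier[OF u(2)] rot_closed] base
      by (intro image_cong) simp_all
    also have "\<dots> = A0"
      unfolding alpha_rot_base unfolding image_image using \<Psi>_fixes[OF u(2)] by (intro image_cong) simp_all
    finally show ?thesis
      using \<Psi>_in_carrier[OF u(2)] rot_closed by (simp add: Stab_def \<Theta>_def u(1))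
  qed
  show "\<Theta> \<in> hom GkZ (G\<lparr>carrier := Stab R A0\<rparr>)"
  proof (rule homI)
    fix u v assume uv: "u \<in> carrier GkZ" "v \<in> carrier GkZ"
    obtain x m where u: "u = (x, m)" "x \<in> carrier Gk" "0 \<le> m" "m < int k"
      using uv(1) by (cases u) (simp add: carrier_GkZ)
    obtain y n where v: "v = (y, n)" "y \<in> carrier Gk" "0 \<le> n" "n < int k"
      using uv(2) by (cases v) (simp add: carrier_GkZ)
    have "nat ((m + n) mod int k) = (nat m + nat n) mod k"
      using u v by (simp add: nat_mod_distrib nat_add_distrib)
    then have r: "rot (nat ((m + n) mod int k)) = rot (nat m) \<otimes>\<^bsub>G\<^esub> rot (nat n)"
      unfolding rot_mult by (simp only: cyc_funpow_mod)
    have sy: "shift k m y \<in> carrier Gk"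
      using v(2) by (rule shift_closed)
    have c: "rot (nat m) \<otimes>\<^bsub>G\<^esub> \<Psi> y = \<Psi> (shift k m y) \<otimes>\<^bsub>G\<^esub> rot (nat m)"
      using rot_\<Psi>[of y "nat m"] u v by simp
    have "\<Theta> (u \<otimes>\<^bsub>GkZ\<^esub> v) = \<Psi> x \<otimes>\<^bsub>G\<^esub> \<Psi> (shift k m y) \<otimes>\<^bsub>G\<^esub> (rot (nat m) \<otimes>\<^bsub>G\<^esub> rot (nat n))"
      unfolding u v mult_GkZ \<Theta>_def using \<Psi>_mult[OF u(2) sy] r by simp
    also have "\<dots> = \<Psi> x \<otimes>\<^bsub>G\<^esub> (\<Psi> (shift k m y) \<otimes>\<^bsub>G\<^esub> rot (nat m)) \<otimes>\<^bsub>G\<^esub> rot (nat n)"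
      using \<Psi>_in_carrier u v sy rot_closed by (simp add: m_assoc)
    also have "\<dots> = \<Theta> u \<otimes>\<^bsub>G\<^esub> \<Theta> v"
      unfolding c[symmetric] u v \<Theta>_def using \<Psi>_in_carrier u v rot_closed by (simp add: m_assoc)
    finally show "\<Theta> (u \<otimes>\<^bsub>GkZ\<^esub> v) = \<Theta> u \<otimes>\<^bsub>G\<lparr>carrier := Stab R A0\<rparr>\<^esub> \<Theta> v"
      by simp
  qed (use stab in simp)
  have "inj_on \<Theta> (carrier GkZ)"
  proof (rule inj_onI)
    fix u v assume uv: "u \<in> carrier GkZ" "v \<in> carrier GkZ" "\<Theta> u = \<Theta> v"
    obtain x m where u: "u = (x, m)" "x \<in> carrier Gk" "0 \<le> m" "m < int k"
      using uv(1) by (cases u) (simp add: carrier_GkZ)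
    obtain y n where v: "v = (y, n)" "y \<in> carrier Gk" "0 \<le> n" "n < int k"
      using uv(2) by (cases v) (simp add: carrier_GkZ)
    have act: "alpha R (\<Psi> z \<otimes>\<^bsub>G\<^esub> rot (nat l)) (pt b 1) = pt b (Suc (nat l))"
      if "z \<in> carrier Gk" "0 \<le> l" "l < int k" for z l
    proof -
      have "nat l < k" using that by simp
      then show ?thesis
        using alpha_mult[OF \<Psi>_in_carrier[OF that(1)] rot_closed base[OF one]] alpha_rot[of "nat l"]
          \<Psi>_fixes[OF that(1), of "Suc (nat l)"] by simp
    qed
    have "pt b (Suc (nat m)) = pt b (Suc (nat n))"
      using act[OF u(2-4)] act[OF v(2-4)] uv(3) by (simp add: \<Theta>_def u(1) v(1))
    then have "Suc (nat m) = Suc (nat n)"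
      using u v length_b leaves_b by - (rule pt_inj[of b], auto)
    then have mn: "m = n"
      using u v by simp
    then have "\<Psi> x = \<Psi> y"
      using uv(3) right_cancel[OF rot_closed \<Psi>_in_carrier[OF u(2)] \<Psi>_in_carrier[OF v(2)]]
      by (simp add: \<Theta>_def u(1) v(1))
    then show "u = v"
      using \<Psi>_inj u v mn by blast
  qed
  moreover have "Stab R A0 \<subseteq> \<Theta> ` carrier GkZ"
  proof
    fix g assume g: "g \<in> Stab R A0"
    then have gc: "g \<in> carrier G" "alpha R g ` A0 = A0"
      by (simp_all add: Stab_def)
    then obtain j where j: "j \<in> {1..k}" "alpha R g (pt b 1) = pt b j"
      using one by blast
    define m where "m = j - 1"
    have m: "m < k" "Suc m = j" using j(1) by (auto simp: m_def)
    define g' where "g' = inv\<^bsub>G\<^esub> (rot m) \<otimes>\<^bsub>G\<^esub> g"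
    have g'c: "g' \<in> carrier G" using gc rot_closed by (simp add: g'_def)
    have act: "alpha R g' x = alpha R (inv\<^bsub>G\<^esub> (rot m)) (alpha R g x)" if "x \<in> X_set R" for x
      unfolding g'_def using that gc rot_closed by (intro alpha_mult) simp_all
    have "alpha R g' (pt b 1) = alpha R (inv\<^bsub>G\<^esub> (rot m)) (alpha R (rot m) (pt b 1))"
      using act[OF base[OF one]] j(2) alpha_rot[OF m(1)] m(2) by simp
    then have fix1: "alpha R g' (pt b 1) = pt b 1"
      using alpha_inverse(1)[OF rot_closed base[OF one]] by simp
    have "alpha R g' ` A0 = alpha R (inv\<^bsub>G\<^esub> (rot m)) ` alpha R g ` A0"
      unfolding image_image using act base by (intro image_cong) simp_all
    also have "\<dots> = alpha R (inv\<^bsub>G\<^esub> (rot m)) ` alpha R (rot m) ` A0"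
      unfolding gc(2) alpha_rot_base ..
    also have "\<dots> = A0"
      unfolding image_image using alpha_inverse(1)[OF rot_closed base] by (intro image_cong) simp_all
    finally have "g' \<in> Stab R A0"
      using g'c by (simp add: Stab_def)
    then obtain x where x: "x \<in> carrier Gk" "g' = \<Psi> x"
      using \<Psi>_surj fix1 by blast
    have "g = rot m \<otimes>\<^bsub>G\<^esub> g'"
      using gc rot_closed by (simp add: g'_def m_assoc[symmetric])
    then have "g = \<Theta> (shift k (int m) x, int m)"
      unfolding x(2) rot_\<Psi>[OF x(1) m(1)] by (simp add: \<Theta>_def)
    moreover have "(shift k (int m) x, int m) \<in> carrier GkZ"
      using shift_closed[OF x(1)] m(1) by (simp add: carrier_GkZ)
    ultimately show "g \<in> \<Theta> ` carrier GkZ"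
      by blast
  qed
  ultimately show "bij_betw \<Theta> (carrier GkZ) (carrier (G\<lparr>carrier := Stab R A0\<rparr>))"
    using stab by (auto simp: bij_betw_def)
qed

end

theorem proposition6p2:
  fixes R :: "('s tree \<times> 's tree) set" and k :: nat
  assumes "skein_relations R"
    and "ore_category (ForC R)"
    and "k \<ge> 1"
  shows "(\<forall>A\<in>X_sub R k. \<exists>n t j.
            t \<in> skein_trees R n \<and> inj_on j {1..k} \<and> j ` {1..k} \<subseteq> {1..n} \<and>
            A = {X_class R t (j i) |i. i \<in> {1..k}}) \<and>
         transitive_action (T_group R) (X_sub R k) (alpha_sub R k) \<and>
         (\<forall>A\<in>X_sub R k.
            (T_group R)\<lparr>carrier := Fix R A\<rparr> \<cong> group_power (F_group R) k \<and>
            (T_group R)\<lparr>carrier := Stab R A\<rparr> \<cong>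
              semidirect (group_power (F_group R) k) (integer_mod_group k) (shift k))"
proof -
  interpret ore_skein R
    by unfold_locales (fact assms)+
  obtain b :: "'s forest" where b: "length b = 1" "leaves b = k"
    using assms(3) by (rule obtain_tree_with_leaves)
  interpret based_skein R b k
    by unfold_locales (use b assms(3) in simp_all)
  have "\<exists>n t j. t \<in> skein_trees R n \<and> inj_on j {1..k} \<and> j ` {1..k} \<subseteq> {1..n} \<and>
            A = {X_class R t (j i) |i. i \<in> {1..k}}" if A: "A \<in> X_sub R k" for A
  proof -
    obtain t J where t: "length t = 1" "J \<subseteq> {1..leaves t}" "finite J" "card J = k" "A = pt t ` J"
      using A by (rule representatives_of_subset)
    obtain j where j: "bij_betw j {1..k} J"
      using ex_bij_betw_nat_finite_1[OF t(3)] t(4) by blast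
    have "A = {pt t (j i) |i. i \<in> {1..k}}"
      using j unfolding t(5) bij_betw_def by auto
    moreover have "cl t \<in> skein_trees R (leaves t)"
      using t(1) by (auto simp: skein_trees_iff)
    ultimately show ?thesis
      using j t(2) unfolding bij_betw_def by blast
  qed
  moreover have "G\<lparr>carrier := Fix R A\<rparr> \<cong> Gk \<and> G\<lparr>carrier := Stab R A\<rparr> \<cong> GkZ"
    if A: "A \<in> X_sub R k" for A
  proof -
    obtain g where g: "g \<in> carrier G" "alpha R g ` A0 = A"
      using transport_from_base[OF b assms(3) A] by blast
    have A0: "A0 \<subseteq> X_set R"
      using base_in_X_sub[OF b] by (simp add: X_sub_def)
    have "G\<lparr>carrier := Fix R A0\<rparr> \<cong> Gk"
      using Fix_base_iso mult_Gk_closed by (rule iso_sym_magma)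
    with Fix_Stab_conjugate(1)[OF g(1) A0] have "G\<lparr>carrier := Fix R A\<rparr> \<cong> Gk"
      unfolding g(2) by (rule iso_trans)
    moreover have "G\<lparr>carrier := Stab R A0\<rparr> \<cong> GkZ"
      using Stab_base_iso mult_GkZ_closed by (rule iso_sym_magma)
    with Fix_Stab_conjugate(2)[OF g(1) A0] have "G\<lparr>carrier := Stab R A\<rparr> \<cong> GkZ"
      unfolding g(2) by (rule iso_trans)
    ultimately show ?thesis ..
  qed
  ultimately show ?thesis
    using alpha_sub_transitive[OF assms(3)] by blast
qed

end
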